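(* Let $F(w_1,w_2)$ be an odd holomorphic function in a neighbourhood of the origin of $\mathbb{C}^2$ with $F(w_1,w_2)=O(\|(w_1,w_2)\|^3)$, and let $f(z)=F(z,\bar z)$. Suppose $g$ (an even $C^1$ function near $0\in\mathbb{C}$ with $g(z)=o(z)$) satisfies the polynomial condition with respect to some polynomial. Let $h$ be a $C^1$ function defined near the origin with $h(z)=o(g(z))$. Then for every closed disk $D\subset\mathbb{C}$ centered at $0$ with sufficiently small radius, $$[\,z^2,\ (\bar z+f(z)+g(z)+h(z))^2\,;\,D\,]=C(D).$$
   Context: All functions defined near the origin are assumed to be of class $C^1$. For continuous functions $f_1,f_2$ on a compact set $D\subset\mathbb{C}$, $[f_1,f_2;D]$ denotes the uniform closure in $C(D)$ of the set of polynomials (with complex coefficients) in $f_1$ and $f_2$. Polynomial condition: let $g$ be an even $C^1$ function defined near $0\in\mathbb{C}$ with $g(z)=o(z)$ as $z\to 0$. We say $g$ satisfies the polynomial condition with respect to a holomorphic polynomial $p(\zeta_1,\zeta_2)$ if for every $C^1$ function $R$ defined near $0$ with $R(z)=o(g(z))$ as $z\to0$, both $\operatorname{Im} p(z,\bar z+g(z)+R(z))>0$ and $\operatorname{Im} p(z,\bar z-g(z)+R(z))<0$ hold for all $z\neq0$ sufficiently close to $0$. *)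

theory Defs
  imports "HOL-Analysis.Analysis" "HOL-Library.Landau_Symbols"
begin

definition holomorphic2_on :: "(complex \<times> complex \<Rightarrow> complex) \<Rightarrow> (complex \<times> complex) set \<Rightarrow> bool" where
  "holomorphic2_on F U \<longleftrightarrow> open U \<and>
     (\<forall>w\<in>U. \<exists>a b. (F has_derivative (\<lambda>v. a * fst v + b * snd v)) (at w))"

definition C1_near0 :: "(complex \<Rightarrow> complex) \<Rightarrow> bool" where
  "C1_near0 g \<longleftrightarrow> (\<exists>r>0. \<exists>g' :: complex \<Rightarrow> (complex \<Rightarrow>\<^sub>L complex).
      (\<forall>z\<in>ball 0 r. (g has_derivative blinfun_apply (g' z)) (at z)) \<and>
      continuous_on (ball 0 r) g')"

definition poly2 :: "nat \<Rightarrow> (nat \<times> nat \<Rightarrow> complex) \<Rightarrow> complex \<Rightarrow> complex \<Rightarrow> complex" where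
  "poly2 N c a b = (\<Sum>i\<le>N. \<Sum>j\<le>N. c (i, j) * a ^ i * b ^ j)"

definition polynomial_condition :: "(complex \<Rightarrow> complex) \<Rightarrow> (complex \<Rightarrow> complex \<Rightarrow> complex) \<Rightarrow> bool" where
  "polynomial_condition g p \<longleftrightarrow>
     (\<forall>R. C1_near0 R \<and> R \<in> o[at 0](g) \<longrightarrow>
        (\<forall>\<^sub>F z in at 0. Im (p z (cnj z + g z + R z)) > 0 \<and>
                        Im (p z (cnj z - g z + R z)) < 0))"

definition poly_closure :: "(complex \<Rightarrow> complex) \<Rightarrow> (complex \<Rightarrow> complex) \<Rightarrow> complex set \<Rightarrow> (complex \<Rightarrow> complex) set" where
  "poly_closure f1 f2 D = {\<phi>. continuous_on D \<phi> \<and>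
      (\<forall>\<epsilon>>0. \<exists>N c. \<forall>z\<in>D. norm (\<phi> z - poly2 N c (f1 z) (f2 z)) < \<epsilon>)}"

end

theory Submission
  imports Defs "HOL-Complex_Analysis.Complex_Analysis" "HOL-Real_Asymp.Real_Asymp"
begin

text \<open>
  Write \<open>phi(z) = z\<^sup>* + F(z, z\<^sup>*) + g(z) + h(z)\<close> and let \<open>X\<close> be the union of the four discs
  \<open>{(\<plusminus>z, \<plusminus>phi(z))}\<close> in \<open>\<complex>\<^sup>2\<close>. Averaging over the signs turns polynomials on \<open>X\<close> into polynomials in
  \<open>z\<^sup>2\<close> and \<open>phi(z)\<^sup>2\<close>, so it suffices to approximate, on \<open>X\<close>, functions supported on the single disc
  \<open>{(z, phi(z))}\<close>. On that disc all continuous functions are limits of polynomials, by a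
  regularised Cauchy transform (Wermer's argument: \<open>phi - z\<^sup>*\<close> has Lipschitz constant \<open>1/2\<close>).
  The disc is cut off from the others by two applications of Kallin's separation argument.
  The function \<open>\<i> z w\<close> lies in opposite half planes on \<open>{\<plusminus>(z, phi(z))}\<close> and on the other two discs.
  The discs \<open>{(z, phi(z))}\<close> and \<open>{(-z, -phi(z))}\<close> are separated by \<open>p(z, G(z, w))\<close>, where \<open>p\<close> comes from
  the polynomial condition and \<open>w \<mapsto> G(z, w)\<close> inverts \<open>w \<mapsto> w + F(z, w)\<close>: this removes \<open>F\<close>, leaving
  \<open>z\<^sup>* \<plusminus> g(z) + o(g(z))\<close>.
\<close>

subsection \<open>Uniform closure of the polynomials on a subset of \<open>\<complex>\<^sup>2\<close>\<close>

text \<open>Parity is what makes the last separation possible: written over its first coordinate,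
  the disc \<open>{(-z, -phi(z))}\<close> is the graph of \<open>- phi(- z)\<close>. Since
  \<open>F\<close> and conjugation are odd and \<open>g\<close> is even, this keeps
  \<open>cnj z + F(z, cnj z)\<close> and changes \<open>g\<close> into \<open>- g\<close>, with
  another remainder \<open>o(g)\<close>. But \<open>F\<close> may be far larger than
  \<open>g\<close>, so it cannot count as a remainder in the polynomial condition and has to be
  removed by a change of variable. All discs meet at the origin, so no continuous function can be
  close to 1 on one disc and to 0 on the others. The cut-off is therefore a function
  \<open>psi\<close> that vanishes at 0, and \<open>f\<close> is approximated by
  \<open>f(0) + psi e\<close> with \<open>e\<close> continuous. Duality, measures and polynomial
  hulls do not appear; everything is membership in a uniform closure. Kallin's argument turns into
  the explicit root \<open>csqrt (- u^2)\<close>, and Wermer's into a Cauchy kernel with a positive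
  constant \<open>h^2\<close> in the denominator. That kernel is continuous, so its parameter
  integrals are limits of Riemann sums of functions already known to be approximable, and no
  derivative of \<open>phi\<close> is taken in that argument.\<close>

inductive polyfun :: "(complex \<times> complex \<Rightarrow> complex) \<Rightarrow> bool" where
  polyfun_const: "polyfun (\<lambda>x. c)"
| polyfun_fst: "polyfun fst"
| polyfun_snd: "polyfun snd"
| polyfun_add: "polyfun P \<Longrightarrow> polyfun Q \<Longrightarrow> polyfun (\<lambda>x. P x + Q x)"
| polyfun_mult: "polyfun P \<Longrightarrow> polyfun Q \<Longrightarrow> polyfun (\<lambda>x. P x * Q x)"

text \<open>Members are total functions of which only the values on \<open>X\<close> count.
  Continuity on \<open>X\<close> is not built in; it follows as for any uniform limit of
  polynomials.\<close>

definition polyclo :: "(complex \<times> complex) set \<Rightarrow> (complex \<times> complex \<Rightarrow> complex) set" where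
  "polyclo X = {u. \<forall>e>0. \<exists>P. polyfun P \<and> (\<forall>x\<in>X. norm (u x - P x) < e)}"

lemma polyfun_continuous_on: "polyfun P \<Longrightarrow> continuous_on X P"
  by (induction rule: polyfun.induct) (auto intro!: continuous_intros continuous_on_fst continuous_on_snd continuous_on_id simp: fst_def[symmetric])

lemma polyfun_bounded:
  assumes "polyfun P" "bounded X"
  obtains B where "B > 0" "\<And>x. x \<in> X \<Longrightarrow> norm (P x) \<le> B"
proof -
  have "compact (closure X)" using assms(2) by (simp add: compact_closure)
  then have "bounded (P ` closure X)"
    using compact_continuous_image[OF polyfun_continuous_on[OF assms(1)]] compact_imp_bounded by blast
  then obtain B where "B > 0" "\<forall>y\<in>P ` closure X. norm y \<le> B" using bounded_pos by blast
  then show ?thesis using that[of B] closure_subset by blast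
qed

lemma polycloE:
  assumes "u \<in> polyclo X" "e > 0"
  obtains P where "polyfun P" "\<And>x. x \<in> X \<Longrightarrow> norm (u x - P x) < e"
  using assms unfolding polyclo_def by blast

lemma polyclo_polyfun: "polyfun P \<Longrightarrow> P \<in> polyclo X"
  unfolding polyclo_def by (auto intro!: exI[of _ P])

lemmas polyclo_const = polyclo_polyfun[OF polyfun_const]
  and polyclo_fst = polyclo_polyfun[OF polyfun_fst]
  and polyclo_snd = polyclo_polyfun[OF polyfun_snd]

lemma polyclo_cong:
  assumes "u \<in> polyclo X" "\<And>x. x \<in> X \<Longrightarrow> u x = v x"
  shows "v \<in> polyclo X"
  using assms unfolding polyclo_def by auto

text \<open>Closedness in the form used throughout: the approximants may themselves be members of
  the closure, and a weak inequality suffices.\<close>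

lemma polyclo_limit:
  assumes "\<And>e. e > 0 \<Longrightarrow> \<exists>v\<in>polyclo X. \<forall>x\<in>X. norm (u x - v x) \<le> e"
  shows "u \<in> polyclo X"
  unfolding polyclo_def
proof (intro CollectI allI impI)
  fix e :: real assume "e > 0"
  then obtain v where v: "v \<in> polyclo X" "\<forall>x\<in>X. norm (u x - v x) \<le> e/2"
    using assms[of "e/2"] by auto
  obtain P where P: "polyfun P" "\<And>x. x \<in> X \<Longrightarrow> norm (v x - P x) < e/2"
    using polycloE[OF v(1), of "e/2"] \<open>e > 0\<close> by auto
  have "norm (u x - P x) < e" if "x \<in> X" for x
    using norm_triangle_ineq[of "u x - v x" "v x - P x"] v(2) P(2)[OF that] that by fastforce
  with P(1) show "\<exists>P. polyfun P \<and> (\<forall>x\<in>X. norm (u x - P x) < e)" by blast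
qed

lemma polyclo_uniform_limit:
  assumes "\<And>n. v n \<in> polyclo X" "uniform_limit X v u sequentially"
  shows "u \<in> polyclo X"
proof (rule polyclo_limit)
  fix e :: real assume "e > 0"
  then have "\<forall>\<^sub>F n in sequentially. \<forall>x\<in>X. dist (v n x) (u x) < e"
    using assms(2) uniform_limitD by blast
  then obtain n where "\<forall>x\<in>X. dist (v n x) (u x) < e"
    by (auto simp: eventually_sequentially)
  then show "\<exists>v\<in>polyclo X. \<forall>x\<in>X. norm (u x - v x) \<le> e"
    by (intro bexI[of _ "v n"]) (auto simp: assms(1) dist_norm norm_minus_commute intro: less_imp_le)
qed

lemma polyclo_bounded:
  assumes "u \<in> polyclo X" "bounded X"
  obtains B where "B > 0" "\<And>x. x \<in> X \<Longrightarrow> norm (u x) \<le> B"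
proof -
  obtain P where P: "polyfun P" "\<And>x. x \<in> X \<Longrightarrow> norm (u x - P x) < 1"
    using polycloE[OF assms(1), of 1] by auto
  obtain B where "B > 0" "\<And>x. x \<in> X \<Longrightarrow> norm (P x) \<le> B"
    using polyfun_bounded[OF P(1) assms(2)] by blast
  then show ?thesis
    using that[of "B + 1"] P(2) norm_triangle_sub[of "u _" "P _"]
    by (smt (verit, del_insts))
qed

lemma polyclo_continuous_on:
  assumes "u \<in> polyclo X"
  shows "continuous_on X u"
proof -
  have "\<exists>P. polyfun P \<and> (\<forall>x\<in>X. norm (u x - P x) < inverse (Suc n))" for n
    using assms unfolding polyclo_def by auto
  then obtain P where P: "\<And>n. polyfun (P n)" "\<And>n x. x \<in> X \<Longrightarrow> norm (u x - P n x) < inverse (Suc n)"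
    by metis
  have "uniform_limit X P u sequentially"
    unfolding uniform_limit_iff
  proof (intro allI impI)
    fix e :: real assume "e > 0"
    then have "\<forall>\<^sub>F n in sequentially. inverse (real (Suc n)) < e"
      using order_tendstoD(2)[OF LIMSEQ_inverse_real_of_nat] by blast
    then show "\<forall>\<^sub>F n in sequentially. \<forall>x\<in>X. dist (P n x) (u x) < e"
      by eventually_elim (use P(2) in \<open>auto simp: dist_norm norm_minus_commute intro: less_trans\<close>)
  qed
  then show ?thesis
    by (rule uniform_limit_theorem[rotated]) (auto simp: P(1) polyfun_continuous_on)
qed

lemma polyclo_add:
  assumes "u \<in> polyclo X" "v \<in> polyclo X"
  shows "(\<lambda>x. u x + v x) \<in> polyclo X"
proof (rule polyclo_limit)
  fix e :: real assume "e > 0"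
  obtain P where P: "polyfun P" "\<And>x. x \<in> X \<Longrightarrow> norm (u x - P x) < e/2"
    using polycloE[OF assms(1), of "e/2"] \<open>e > 0\<close> by auto
  obtain Q where Q: "polyfun Q" "\<And>x. x \<in> X \<Longrightarrow> norm (v x - Q x) < e/2"
    using polycloE[OF assms(2), of "e/2"] \<open>e > 0\<close> by auto
  have "norm (u x + v x - (P x + Q x)) \<le> e" if "x \<in> X" for x
    using norm_diff_triangle_ineq[of "u x" "v x" "P x" "Q x"] P(2)[OF that] Q(2)[OF that] by linarith
  then show "\<exists>w\<in>polyclo X. \<forall>x\<in>X. norm (u x + v x - w x) \<le> e"
    by (intro bexI[of _ "\<lambda>x. P x + Q x"]) (auto intro!: polyclo_polyfun polyfun_add P Q)
qed

lemma polyclo_mult: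
  assumes "u \<in> polyclo X" "v \<in> polyclo X" and "bounded X"
  shows "(\<lambda>x. u x * v x) \<in> polyclo X"
proof (rule polyclo_limit)
  fix e :: real assume "e > 0"
  obtain B where B: "B > 0" "\<And>x. x \<in> X \<Longrightarrow> norm (v x) \<le> B"
    using polyclo_bounded[OF assms(2,3)] by blast
  obtain P where P: "polyfun P" "\<And>x. x \<in> X \<Longrightarrow> norm (u x - P x) < e/(2*B)"
    using polycloE[OF assms(1), of "e/(2*B)"] \<open>e > 0\<close> \<open>B > 0\<close> by auto
  \<comment> \<open>The bound is for \<open>P\<close>, which is already fixed, so the precision
    demanded of \<open>Q\<close> may depend on it.\<close>
  obtain C where C: "C > 0" "\<And>x. x \<in> X \<Longrightarrow> norm (P x) \<le> C"
    using polyfun_bounded[OF P(1) assms(3)] by blast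
  obtain Q where Q: "polyfun Q" "\<And>x. x \<in> X \<Longrightarrow> norm (v x - Q x) < e/(2*C)"
    using polycloE[OF assms(2), of "e/(2*C)"] \<open>e > 0\<close> \<open>C > 0\<close> by auto
  have "norm (u x * v x - P x * Q x) \<le> e" if "x \<in> X" for x
  proof -
    have "u x * v x - P x * Q x = (u x - P x) * v x + P x * (v x - Q x)" by (simp add: algebra_simps)
    then have "norm (u x * v x - P x * Q x) \<le> norm (u x - P x) * norm (v x) + norm (P x) * norm (v x - Q x)"
      by (metis norm_mult norm_triangle_ineq)
    also have "\<dots> \<le> e/(2*B) * B + C * (e/(2*C))"
      using P(2)[OF that] Q(2)[OF that] B C that \<open>e > 0\<close>
      by (intro add_mono mult_mono) (auto intro: less_imp_le)
    also have "\<dots> = e" using B C by simp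
    finally show ?thesis .
  qed
  then show "\<exists>w\<in>polyclo X. \<forall>x\<in>X. norm (u x * v x - w x) \<le> e"
    by (intro bexI[of _ "\<lambda>x. P x * Q x"]) (auto intro!: polyclo_polyfun polyfun_mult P Q)
qed

lemma polyclo_cmult:
  assumes "u \<in> polyclo X"
  shows "(\<lambda>x. c * u x) \<in> polyclo X"
proof (rule polyclo_limit)
  fix e :: real assume "e > 0"
  \<comment> \<open>The 1 keeps the quotient meaningful for \<open>c = 0\<close>.\<close>
  have pos: "norm c + 1 > 0" by (simp add: add_nonneg_pos)
  then obtain P where P: "polyfun P" "\<And>x. x \<in> X \<Longrightarrow> norm (u x - P x) < e/(norm c + 1)"
    using polycloE[OF assms, of "e/(norm c + 1)"] \<open>e > 0\<close> by auto
  have "norm (c * u x - c * P x) \<le> e" if "x \<in> X" for x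
  proof -
    have "norm (c * u x - c * P x) = norm c * norm (u x - P x)"
      by (metis norm_mult right_diff_distrib)
    also have "\<dots> \<le> (norm c + 1) * (e / (norm c + 1))"
      using P(2)[OF that] by (intro mult_mono) auto
    finally show ?thesis using pos by simp
  qed
  then show "\<exists>w\<in>polyclo X. \<forall>x\<in>X. norm (c * u x - w x) \<le> e"
    by (intro bexI[of _ "\<lambda>x. c * P x"]) (auto intro!: polyclo_polyfun polyfun_mult polyfun_const P)
qed

lemma polyclo_diff:
  assumes "u \<in> polyclo X" "v \<in> polyclo X"
  shows "(\<lambda>x. u x - v x) \<in> polyclo X"
  using polyclo_add[OF assms(1) polyclo_cmult[OF assms(2), of "-1"]] by simp

lemma polyclo_power:
  assumes "u \<in> polyclo X" "bounded X"
  shows "(\<lambda>x. u x ^ n) \<in> polyclo X"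
  by (induction n) (auto intro: polyclo_const polyclo_mult assms)

lemma polyclo_sum:
  assumes "\<And>i. i \<in> I \<Longrightarrow> u i \<in> polyclo X"
  shows "(\<lambda>x. \<Sum>i\<in>I. u i x) \<in> polyclo X"
  using assms by (induction I rule: infinite_finite_induct) (auto intro: polyclo_const polyclo_add)

text \<open>The localisation device: a polynomial close to \<open>v\<close> on \<open>Y\<close> may
  do anything on the rest of \<open>X\<close>, because the factor \<open>psi\<close> vanishes
  there.\<close>

lemma polyclo_extend_by_zero:
  assumes psi: "psi \<in> polyclo X" and X: "bounded X" and v: "v \<in> polyclo Y" and YX: "Y \<subseteq> X"
    and zero: "\<And>x. x \<in> X - Y \<Longrightarrow> psi x = 0"
  shows "(\<lambda>x. psi x * v x) \<in> polyclo X"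
proof (rule polyclo_limit)
  fix e :: real assume "e > 0"
  obtain B where B: "B > 0" "\<And>x. x \<in> X \<Longrightarrow> norm (psi x) \<le> B"
    using polyclo_bounded[OF psi X] by blast
  obtain P where P: "polyfun P" "\<And>x. x \<in> Y \<Longrightarrow> norm (v x - P x) < e/B"
    using polycloE[OF v, of "e/B"] \<open>e > 0\<close> B by auto
  have "norm (psi x * v x - psi x * P x) \<le> e" if "x \<in> X" for x
  proof (cases "x \<in> Y")
    case True
    have "norm (psi x * v x - psi x * P x) = norm (psi x) * norm (v x - P x)"
      by (metis norm_mult right_diff_distrib)
    also have "\<dots> \<le> B * (e/B)"
      using P(2)[OF True] B that by (intro mult_mono) auto
    finally show ?thesis using B by simp
  qed (use zero that \<open>e > 0\<close> in simp)
  then show "\<exists>w\<in>polyclo X. \<forall>x\<in>X. norm (psi x * v x - w x) \<le> e"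
    by (intro bexI[of _ "\<lambda>x. psi x * P x"]) (auto intro!: polyclo_mult psi X intro: polyclo_polyfun[OF P(1)])
qed

subsection \<open>Functional calculus\<close>

text \<open>The values of \<open>u\<close> lie in a disc strictly inside the disc of convergence of
  the Taylor series at \<open>c\<close>, so the partial sums, which are polynomials in
  \<open>u\<close>, converge uniformly.\<close>

lemma polyclo_holomorphic:
  assumes u: "u \<in> polyclo X" and X: "bounded X"
    and f: "f holomorphic_on ball c r" and rho: "rho < r" "\<And>x. x \<in> X \<Longrightarrow> norm (u x - c) \<le> rho"
  shows "(\<lambda>x. f (u x)) \<in> polyclo X"
proof (cases "X = {}")
  case True
  then show ?thesis by (auto intro: polyclo_cong[OF polyclo_const])
next
  case False
  then have rho0: "rho \<ge> 0" using rho(2) by (meson all_not_in_conv norm_ge_zero order_trans)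
  define a where "a n = (deriv ^^ n) f c / fact n" for n
  have sums: "(\<lambda>n. a n * (w - c) ^ n) sums f w" if "w \<in> ball c r" for w
    using holomorphic_power_series[OF f that] unfolding a_def by simp
  \<comment> \<open>Convergence at a radius strictly beyond \<open>rho\<close> gives absolute
    convergence at \<open>rho\<close>.\<close>
  define rr where "rr = (rho + r) / 2"
  have rr: "rho < rr" "rr < r" using rho(1) by (auto simp: rr_def)
  have "summable (\<lambda>n. a n * of_real rr ^ n)"
    using sums[of "c + of_real rr"] rr rho0 by (auto simp: sums_iff dist_norm)
  then have summ: "summable (\<lambda>n. norm (a n * of_real rho ^ n))"
    by (rule powser_insidea) (use rr rho0 in auto)
  have "uniform_limit X (\<lambda>n x. \<Sum>i<n. a i * (u x - c) ^ i) (\<lambda>x. \<Sum>i. a i * (u x - c) ^ i) sequentially"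
  proof (rule Weierstrass_m_test[OF _ summ])
    fix n x assume "x \<in> X"
    then show "norm (a n * (u x - c) ^ n) \<le> norm (a n * of_real rho ^ n)"
      using rho(2)[of x] rho0 by (auto simp: norm_mult norm_power intro!: mult_left_mono power_mono)
  qed
  moreover have "(\<lambda>x. \<Sum>i<n. a i * (u x - c) ^ i) \<in> polyclo X" for n
    by (intro polyclo_sum polyclo_cmult polyclo_power polyclo_diff u polyclo_const X)
  ultimately have "(\<lambda>x. \<Sum>i. a i * (u x - c) ^ i) \<in> polyclo X"
    by (rule polyclo_uniform_limit[rotated])
  then show ?thesis
  proof (rule polyclo_cong)
    fix x assume "x \<in> X"
    then have "u x \<in> ball c r" using rho by (fastforce simp: dist_norm norm_minus_commute)
    then show "(\<Sum>i. a i * (u x - c) ^ i) = f (u x)" using sums by (simp add: sums_iff)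
  qed
qed

text \<open>A bounded set in the half plane \<open>Re \<ge> d\<close> fits into a disc around a
  large real number \<open>M\<close> that stays away from 0; there the reciprocal is
  holomorphic.\<close>

lemma polyclo_inverse:
  assumes u: "u \<in> polyclo X" and X: "bounded X" and d: "d > 0" "\<And>x. x \<in> X \<Longrightarrow> Re (u x) \<ge> d"
  shows "(\<lambda>x. inverse (u x)) \<in> polyclo X"
proof -
  obtain B where B: "B > 0" "\<And>x. x \<in> X \<Longrightarrow> norm (u x) \<le> B"
    using polyclo_bounded[OF u X] by blast
  \<comment> \<open>Since \<open>|u - M|^2 = |u|^2 - 2 M Re u + M^2\<close>, a radius below
    \<open>M\<close> results once \<open>2 M d\<close> exceeds \<open>B^2\<close>; with this
    \<open>M\<close> the excess is at least \<open>d^2\<close>.\<close>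
  define M where "M = B\<^sup>2 / d + d"
  have M: "M > 0" "M * d \<ge> B\<^sup>2" "2 * M * d - B\<^sup>2 \<ge> d\<^sup>2"
    using d B by (auto simp: M_def field_simps power2_eq_square add_pos_pos)
  define rho where "rho = sqrt (M\<^sup>2 - d\<^sup>2)"
  have rho: "rho < M"
    unfolding rho_def using M(1) d(1) by (intro real_less_lsqrt) auto
  have "inverse holomorphic_on ball (of_real M) M"
    by (intro holomorphic_intros) (use M(1) in \<open>auto simp: dist_norm\<close>)
  then show ?thesis
  proof (rule polyclo_holomorphic[OF u X _ rho])
    fix x assume x: "x \<in> X"
    have "(norm (u x - of_real M))\<^sup>2 = (norm (u x))\<^sup>2 - 2 * M * Re (u x) + M\<^sup>2"
      unfolding cmod_power2 by (simp add: algebra_simps power2_eq_square)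
    also have "\<dots> \<le> B\<^sup>2 - 2 * M * d + M\<^sup>2"
      using B(2)[OF x] d(2)[OF x] M(1) by (auto intro!: add_mono diff_mono power_mono mult_left_mono)
    also have "\<dots> \<le> M\<^sup>2 - d\<^sup>2" using M(3) by simp
    finally show "norm (u x - of_real M) \<le> rho"
      unfolding rho_def by (intro real_le_rsqrt)
  qed
qed

text \<open>The square root is continued along the segment from \<open>u\<close> to \<open>1\<close>: in short steps the
  quotient of consecutive square roots stays near \<open>1\<close>.\<close>

lemma polyclo_csqrt:
  assumes u: "u \<in> polyclo X" and X: "compact X" and slit: "\<And>x. x \<in> X \<Longrightarrow> u x \<notin> \<real>\<^sub>\<le>\<^sub>0"
  shows "(\<lambda>x. csqrt (u x)) \<in> polyclo X"
proof -
  have bX: "bounded X" using X compact_imp_bounded by blast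
  \<comment> \<open>The slit plane is star-shaped about 1, so the segment from \<open>u x\<close>
    (at \<open>s = 0\<close>) to 1 (at \<open>s = 1\<close>) avoids the slit.\<close>
  define U where "U s x = of_real (1 - s) * u x + of_real s" for s x
  have slitU: "U s x \<notin> \<real>\<^sub>\<le>\<^sub>0" if "x \<in> X" "0 \<le> s" "s \<le> 1" for s x
  proof
    assume *: "U s x \<in> \<real>\<^sub>\<le>\<^sub>0"
    then have im: "(1 - s) * Im (u x) = 0" and re: "(1 - s) * Re (u x) + s \<le> 0"
      by (auto simp: U_def complex_nonpos_Reals_iff)
    show False
    proof (cases "s = 1")
      case False
      then have "Im (u x) = 0" using im by simp
      then have "Re (u x) > 0" using slit[OF that(1)] by (auto simp: complex_nonpos_Reals_iff)
      then have "(1 - s) * Re (u x) > 0" using False that by simp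
      then show ?thesis using re that by simp
    qed (use re in simp)
  qed
  have Uin: "U s \<in> polyclo X" for s
    unfolding U_def by (intro polyclo_add polyclo_cmult u polyclo_const)
  define S where "S = (\<lambda>y. csqrt (U (fst y) (snd y)))"
  have contS: "continuous_on ({0..1} \<times> X) S"
  proof -
    have "continuous_on ({0..1} \<times> X) (\<lambda>y. U (fst y) (snd y))"
      unfolding U_def
      by (intro continuous_intros continuous_on_compose2[OF polyclo_continuous_on[OF u]]) auto
    then show ?thesis unfolding S_def
      by (intro continuous_on_compose2[OF continuous_on_csqrt]) (use slitU in \<open>auto simp: complex_nonpos_Reals_iff\<close>)
  qed
  have cmp: "compact ({0..1::real} \<times> X)" using X by (intro compact_Times) auto
  have Sne: "S y \<noteq> 0" if "y \<in> {0..1} \<times> X" for y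
    using slitU[of "snd y" "fst y"] that by (auto simp: S_def complex_nonpos_Reals_iff)
  have "\<exists>m>0. \<forall>y\<in>{0..1} \<times> X. m \<le> norm (S y)"
  proof (cases "X = {}")
    case False
    then obtain y0 where "y0 \<in> {0..1} \<times> X" "\<forall>y\<in>{0..1} \<times> X. norm (S y0) \<le> norm (S y)"
      using continuous_attains_inf[OF cmp _ continuous_on_norm[OF contS]] by auto
    then show ?thesis using Sne by (intro exI[of _ "norm (S y0)"]) auto
  qed (auto intro: exI[of _ 1])
  then obtain m where m: "m > 0" "\<And>y. y \<in> {0..1} \<times> X \<Longrightarrow> m \<le> norm (S y)" by blast
  have "uniformly_continuous_on ({0..1} \<times> X) S"
    using compact_uniformly_continuous[OF contS cmp] .
  \<comment> \<open>With \<open>m/4\<close>, consecutive roots differ by at most a quarter of their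
    modulus, which puts the quotient \<open>R\<close> below within 1/4 of 1.\<close>
  then obtain d where d: "d > 0" "\<And>y y'. y \<in> {0..1} \<times> X \<Longrightarrow> y' \<in> {0..1} \<times> X \<Longrightarrow> dist y' y < d \<Longrightarrow> dist (S y') (S y) < m/4"
    unfolding uniformly_continuous_on_def using m(1) by (metis zero_less_divide_iff zero_less_numeral)
  obtain N where N: "inverse (of_nat (Suc N)) < d" using reals_Archimedean[OF d(1)] by blast
  define n where "n = Suc N"
  have n: "n > 0" "1 / real n < d" using N by (auto simp: n_def inverse_eq_divide)
  \<comment> \<open>The induction starts at \<open>s = 1\<close>, where \<open>U\<close> is
    constantly 1, and runs down to \<open>s = 0\<close>. The reciprocal is carried along because the
    next quotient \<open>R^2 = U t / U s\<close> has to lie in the closure already.\<close>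
  have "(\<lambda>x. csqrt (U (1 - j / n) x)) \<in> polyclo X \<and> (\<lambda>x. inverse (U (1 - j / n) x)) \<in> polyclo X"
    if "j \<le> n" for j
    using that
  proof (induction j)
    case 0
    show ?case by (auto simp: U_def polyclo_const)
  next
    case (Suc j)
    define s where "s = 1 - real j / n"
    define t where "t = 1 - real (Suc j) / n"
    have st: "s \<in> {0..1}" "t \<in> {0..1}" "dist t s < d"
      using Suc.prems n by (auto simp: s_def t_def field_simps dist_real_def)
    have IH: "(\<lambda>x. csqrt (U s x)) \<in> polyclo X" "(\<lambda>x. inverse (U s x)) \<in> polyclo X"
      using Suc unfolding s_def by auto
    define R where "R x = csqrt (U t x) / csqrt (U s x)" for x
    have R2: "(R x)\<^sup>2 = U t x * inverse (U s x)" for x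
      unfolding R_def power_divide by (simp add: divide_inverse)
    have Rn: "norm (R x - 1) \<le> 1/4" if "x \<in> X" for x
    proof -
      have "R x - 1 = (S (t,x) - S (s,x)) / S (s,x)"
        using Sne[of "(s,x)"] st that by (simp add: R_def S_def diff_divide_distrib)
      moreover have "norm (S (t,x) - S (s,x)) \<le> m/4"
        using d(2)[of "(s,x)" "(t,x)"] st that by (auto simp: dist_Pair_Pair dist_norm)
      moreover have "m \<le> norm (S (s,x))" using m(2)[of "(s,x)"] st that by auto
      ultimately show ?thesis using m(1)
        by (simp add: norm_divide divide_le_eq)
    qed
    have R2n: "norm ((R x)\<^sup>2 - 1) \<le> 9/16" if "x \<in> X" for x
    proof -
      have "norm (R x + 1) \<le> 9/4"
        using Rn[OF that] norm_triangle_ineq[of "R x - 1" 2] by (simp add: add.commute)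
      then have "norm (R x - 1) * norm (R x + 1) \<le> 1/4 * (9/4)"
        using Rn[OF that] by (intro mult_mono) auto
      moreover have "(R x)\<^sup>2 - 1 = (R x - 1) * (R x + 1)"
        by (simp add: power2_eq_square algebra_simps)
      ultimately show ?thesis by (simp add: norm_mult)
    qed
    have R2in: "(\<lambda>x. (R x)\<^sup>2) \<in> polyclo X"
      unfolding R2 by (intro polyclo_mult Uin IH bX)
    have re: "0 < Re w" if "w \<in> ball 1 1" for w
      using that abs_Re_le_cmod[of "1 - w"] by (auto simp: dist_norm)
    \<comment> \<open>The bound \<open>1/4 * 9/4 = 9/16 < 1\<close> keeps \<open>R^2\<close> in a
      disc on which \<open>csqrt\<close> is holomorphic, and \<open>Re R > 0\<close> makes
      \<open>csqrt (R^2)\<close> equal to \<open>R\<close>.\<close>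
    have "(\<lambda>x. csqrt ((R x)\<^sup>2)) \<in> polyclo X"
      by (rule polyclo_holomorphic[OF R2in bX, of _ 1 1 "9/16"])
         (use re R2n in \<open>force intro!: holomorphic_intros simp: complex_nonpos_Reals_iff\<close>)+
    then have "R \<in> polyclo X"
    proof (rule polyclo_cong)
      fix x assume "x \<in> X"
      then have "0 < Re (R x)"
        using Rn[of x] abs_Re_le_cmod[of "R x - 1"] by auto
      then show "csqrt ((R x)\<^sup>2) = R x" by (simp add: csqrt_square)
    qed
    then have "(\<lambda>x. csqrt (U s x) * R x) \<in> polyclo X"
      by (intro polyclo_mult IH bX)
    then have 1: "(\<lambda>x. csqrt (U t x)) \<in> polyclo X"
    proof (rule polyclo_cong)
      fix x assume "x \<in> X"
      then show "csqrt (U s x) * R x = csqrt (U t x)"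
        using Sne[of "(s,x)"] st by (simp add: R_def S_def)
    qed
    have "(\<lambda>x. inverse ((R x)\<^sup>2)) \<in> polyclo X"
    proof (rule polyclo_inverse[OF R2in bX])
      fix x assume "x \<in> X"
      then show "7/16 \<le> Re ((R x)\<^sup>2)"
        using R2n[of x] abs_Re_le_cmod[of "(R x)\<^sup>2 - 1"] by (simp add: abs_le_iff)
    qed simp
    then have "(\<lambda>x. inverse (U s x) * inverse ((R x)\<^sup>2)) \<in> polyclo X"
      by (intro polyclo_mult IH bX)
    then have 2: "(\<lambda>x. inverse (U t x)) \<in> polyclo X"
    proof (rule polyclo_cong)
      fix x assume "x \<in> X"
      then have "U s x \<noteq> 0" using Sne[of "(s,x)"] st by (auto simp: S_def)
      then show "inverse (U s x) * inverse ((R x)\<^sup>2) = inverse (U t x)"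
        unfolding R2 by (simp add: field_simps)
    qed
    show ?case using 1 2 unfolding t_def by simp
  qed
  from this[of n] show ?thesis using n by (simp add: U_def)
qed

text \<open>Equal imaginary parts of the squares put the two roots into the same closed quadrant, so
  their difference is no longer than their sum; the product of difference and sum is
  \<open>a - b\<close>. It is applied to numbers that differ by a real shift.\<close>

lemma norm_csqrt_diff_le:
  assumes "Im a = Im b"
  shows "(norm (csqrt a - csqrt b))\<^sup>2 \<le> norm (a - b)"
proof -
  define s t where "s = csqrt a" and "t = csqrt b"
  have st: "Re s > 0 \<or> Re s = 0 \<and> Im s \<ge> 0" "Re t > 0 \<or> Re t = 0 \<and> Im t \<ge> 0" "s\<^sup>2 = a" "t\<^sup>2 = b"
    unfolding s_def t_def using csqrt_principal by auto
  have "Re s * Im s = Re t * Im t"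
    using assms st(3,4) by (auto simp: Im_power2)
  then have "Im s * Im t \<ge> 0"
    using st(1,2) by (metis linorder_not_le mult_eq_0_iff mult_less_0_iff mult_pos_neg mult_pos_pos not_less_iff_gr_or_eq order_less_imp_le)
  moreover have "Re s * Re t \<ge> 0" using st(1,2) by auto
  moreover have "(norm (s + t))\<^sup>2 - (norm (s - t))\<^sup>2 = 4 * (Re s * Re t + Im s * Im t)"
    unfolding cmod_power2 by (simp add: power2_eq_square algebra_simps)
  ultimately have "(norm (s - t))\<^sup>2 \<le> (norm (s + t))\<^sup>2" by (smt (verit))
  then have "norm (s - t) \<le> norm (s + t)" by (rule power2_le_imp_le) simp
  then have "norm (s - t) * norm (s - t) \<le> norm (s - t) * norm (s + t)"
    by (intro mult_left_mono) auto
  also have "\<dots> = norm (a - b)"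
    unfolding norm_mult[symmetric] using st(3,4) by (simp add: algebra_simps power2_eq_square)
  finally show ?thesis by (simp add: s_def t_def power2_eq_square)
qed

text \<open>Kallin's separation: off the real axis, \<open>csqrt (- u\<^sup>2)\<close> is \<open>- \<i> u\<close> in the upper
  and \<open>\<i> u\<close> in the lower half plane, and it is the uniform limit of \<open>csqrt (\<epsilon> - u\<^sup>2)\<close>.\<close>

lemma polyclo_upper_half_part:
  assumes u: "u \<in> polyclo X" and X: "compact X" and nr: "\<And>x. x \<in> X \<Longrightarrow> u x = 0 \<or> Im (u x) \<noteq> 0"
  shows "(\<lambda>x. if Im (u x) > 0 then u x else 0) \<in> polyclo X"
proof -
  have bX: "bounded X" using X compact_imp_bounded by blast
  have "(\<lambda>x. csqrt (- (u x)\<^sup>2)) \<in> polyclo X"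
  proof (rule polyclo_limit)
    fix e :: real assume "e > 0"
    \<comment> \<open>The shift moves the values off the slit: \<open>e^2 - u^2 \<le> 0\<close>
      would need \<open>u\<close> real with \<open>|u| \<ge> e\<close>, and real nonzero values are
      excluded. By \<open>norm_csqrt_diff_le\<close> it changes the root by at most
      \<open>e\<close>.\<close>
    define v where "v x = of_real (e\<^sup>2) - (u x)\<^sup>2" for x
    have "v \<in> polyclo X"
      unfolding v_def by (intro polyclo_diff polyclo_const polyclo_power u bX)
    moreover have "v x \<notin> \<real>\<^sub>\<le>\<^sub>0" if "x \<in> X" for x
    proof
      assume "v x \<in> \<real>\<^sub>\<le>\<^sub>0"
      then have *: "Re (u x) * Im (u x) = 0" "e\<^sup>2 \<le> (Re (u x))\<^sup>2 - (Im (u x))\<^sup>2"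
        by (auto simp: v_def complex_nonpos_Reals_iff Re_power2 Im_power2)
      have "e\<^sup>2 > 0" using \<open>e > 0\<close> by simp
      with *(2) have "u x \<noteq> 0" by auto
      then have "Im (u x) \<noteq> 0" using nr[OF that] by simp
      then have "Re (u x) = 0" using *(1) by simp
      then show False using *(2) \<open>e\<^sup>2 > 0\<close> zero_le_power2[of "Im (u x)"] by simp
    qed
    ultimately have "(\<lambda>x. csqrt (v x)) \<in> polyclo X" by (intro polyclo_csqrt X)
    moreover have "norm (csqrt (- (u x)\<^sup>2) - csqrt (v x)) \<le> e" for x
    proof -
      have "(norm (csqrt (- (u x)\<^sup>2) - csqrt (v x)))\<^sup>2 \<le> norm (- (u x)\<^sup>2 - v x)"
        by (rule norm_csqrt_diff_le) (simp add: v_def)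
      also have "\<dots> = e\<^sup>2" by (simp add: v_def norm_power)
      finally show ?thesis using \<open>e > 0\<close> by (meson power2_le_imp_le less_imp_le)
    qed
    ultimately show "\<exists>w\<in>polyclo X. \<forall>x\<in>X. norm (csqrt (- (u x)\<^sup>2) - w x) \<le> e"
      by (intro bexI[of _ "\<lambda>x. csqrt (v x)"]) auto
  qed
  \<comment> \<open>\<open>\<i>\<close> times the root is \<open>u\<close> above and
    \<open>- u\<close> below the axis, so half the sum keeps \<open>u\<close> or cancels it.\<close>
  then have "(\<lambda>x. (1/2) * (u x + \<i> * csqrt (- (u x)\<^sup>2))) \<in> polyclo X"
    by (intro polyclo_cmult polyclo_add u)
  then show ?thesis
  proof (rule polyclo_cong)
    fix x assume x: "x \<in> X"
    consider "u x = 0" | "Im (u x) > 0" | "Im (u x) < 0" using nr[OF x] by linarith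
    then show "(1/2) * (u x + \<i> * csqrt (- (u x)\<^sup>2)) = (if Im (u x) > 0 then u x else 0)"
    proof cases
      case 2
      have "- (u x)\<^sup>2 = (- \<i> * u x)\<^sup>2" by (simp add: power_mult_distrib)
      then have "csqrt (- (u x)\<^sup>2) = - \<i> * u x"
        using csqrt_square[of "- \<i> * u x"] 2 by simp
      then show ?thesis using 2 by (simp add: algebra_simps)
    next
      case 3
      have "- (u x)\<^sup>2 = (\<i> * u x)\<^sup>2" by (simp add: power_mult_distrib)
      then have "csqrt (- (u x)\<^sup>2) = \<i> * u x"
        using csqrt_square[of "\<i> * u x"] 3 by simp
      then show ?thesis using 3 by (simp add: algebra_simps)
    qed simp
  qed
qed

subsection \<open>Integrals depending on a parameter\<close>

text \<open>Uniform continuity on the compact product makes the Riemann sums converge uniformly in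
  \<open>x\<close>, and each sum is a finite linear combination of members.\<close>

lemma polyclo_integral:
  fixes f :: "complex \<times> complex \<Rightarrow> real \<Rightarrow> complex"
  assumes X: "compact X" and ab: "a \<le> b"
    and cont: "continuous_on (X \<times> {a..b}) (\<lambda>(x, t). f x t)"
    and f: "\<And>t. t \<in> {a..b} \<Longrightarrow> (\<lambda>x. f x t) \<in> polyclo X"
  shows "(\<lambda>x. integral {a..b} (f x)) \<in> polyclo X"
proof (rule polyclo_limit)
  fix e :: real assume "e > 0"
  define e' where "e' = e / (b - a + 1)"
  have e': "e' > 0" "(b - a) * e' \<le> e" using \<open>e > 0\<close> ab by (auto simp: e'_def field_simps)
  have "uniformly_continuous_on (X \<times> {a..b}) (\<lambda>(x, t). f x t)"
    by (intro compact_uniformly_continuous[OF cont] compact_Times X) auto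
  then obtain d where d: "d > 0"
    "\<And>y y'. y \<in> X \<times> {a..b} \<Longrightarrow> y' \<in> X \<times> {a..b} \<Longrightarrow> dist y' y < d \<Longrightarrow>
       dist ((\<lambda>(x, t). f x t) y') ((\<lambda>(x, t). f x t) y) < e'"
    unfolding uniformly_continuous_on_def using e'(1) by metis
  obtain N where N: "(b - a) / d < real N" "N > 0"
    using reals_Archimedean2 by (metis gr_zeroI less_trans of_nat_0_less_iff reals_Archimedean2
      zero_less_one of_nat_1 max_less_iff_conj)
  define h where "h = (b - a) / N"
  have h: "h \<ge> 0" "h < d" "a + N * h = b" using N ab d(1) by (auto simp: h_def field_simps)
  have contx: "continuous_on {a..b} (f x)" if "x \<in> X" for x
    using continuous_on_compose2[OF cont continuous_on_Pair[OF continuous_on_const continuous_on_id], of x "{a..b}"] that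
    by auto
  \<comment> \<open>Left-endpoint sums: every subinterval adds an error of at most
    \<open>h e'\<close>, which totals \<open>(b - a) e' \<le> e\<close>.\<close>
  have riemann: "norm (integral {a..a + real j * h} (f x) - (\<Sum>i<j. of_real h * f x (a + real i * h))) \<le> real j * h * e'"
    if "j \<le> N" "x \<in> X" for j :: nat and x
    using that
  proof (induction j)
    case (Suc j)
    define s where "s = a + j * h"
    have le: "a \<le> s" "s \<le> s + h" "s + h \<le> b"
    proof -
      have "real (Suc j) * h \<le> real N * h" using Suc.prems h(1) by (intro mult_right_mono) auto
      then show "s + h \<le> b" using h(3) by (simp add: s_def algebra_simps)
    qed (use h(1) in \<open>auto simp: s_def\<close>)
    have int: "f x integrable_on {c..c'}" if "a \<le> c" "c' \<le> b" for c c'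
      using integrable_continuous_real[OF continuous_on_subset[OF contx[OF Suc.prems(2)]]] that by auto
    have split: "integral {a..s + h} (f x) = integral {a..s} (f x) + integral {s..s + h} (f x)"
      using le by (intro Henstock_Kurzweil_Integration.integral_combine[symmetric] int) auto
    have "norm (integral {s..s + h} (f x) - of_real h * f x s) \<le> h * e'"
    proof -
      have "integral {s..s + h} (\<lambda>t. f x t - f x s) = integral {s..s + h} (f x) - of_real h * f x s"
        using le by (subst Henstock_Kurzweil_Integration.integral_diff) (auto intro!: int simp: scaleR_conv_of_real)
      moreover have "norm (integral {s..s + h} (\<lambda>t. f x t - f x s)) \<le> e' * (s + h - s)"
      proof (rule integral_bound)
        show "continuous_on {s..s + h} (\<lambda>t. f x t - f x s)"
          using le by (intro continuous_intros continuous_on_subset[OF contx[OF Suc.prems(2)]]) auto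
        fix t assume "t \<in> {s..s + h}"
        then show "norm (f x t - f x s) \<le> e'"
          using d(2)[of "(x, s)" "(x, t)"] le h Suc.prems
          by (auto simp: dist_Pair_Pair dist_norm)
      qed (use h in auto)
      ultimately show ?thesis by (simp add: mult.commute)
    qed
    moreover have "norm (integral {a..s} (f x) - (\<Sum>i<j. of_real h * f x (a + real i * h))) \<le> j * h * e'"
      using Suc unfolding s_def by auto
    ultimately have "norm (integral {a..s + h} (f x) - ((\<Sum>i<j. of_real h * f x (a + real i * h)) + of_real h * f x s))
       \<le> j * h * e' + h * e'"
      unfolding split using norm_diff_triangle_ineq[of "integral {a..s} (f x)" "integral {s..s + h} (f x)"
         "(\<Sum>i<j. of_real h * f x (a + real i * h))" "of_real h * f x s"] by linarith
    then show ?case by (simp add: s_def algebra_simps)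
  qed (use ab in auto)
  have "norm (integral {a..b} (f x) - (\<Sum>i<N. of_real h * f x (a + real i * h))) \<le> e"
    if "x \<in> X" for x
  proof -
    have "real N * h = b - a" using h(3) by simp
    with riemann[of N x] that e'(2) show ?thesis unfolding h(3) by auto
  qed
  moreover have "(\<lambda>x. \<Sum>i<N. of_real h * f x (a + real i * h)) \<in> polyclo X"
  proof (intro polyclo_sum polyclo_cmult f)
    fix i assume "i \<in> {..<N}"
    then have "real i * h \<le> real N * h" using h(1) by (intro mult_right_mono) auto
    then show "a + real i * h \<in> {a..b}" using h(1,3) by auto
  qed
  ultimately show "\<exists>v\<in>polyclo X. \<forall>x\<in>X. norm (integral {a..b} (f x) - v x) \<le> e"
    by (intro bexI[of _ "\<lambda>x. \<Sum>i<N. of_real h * f x (a + real i * h)"]) simp_all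
qed

text \<open>Fubini reduces this to two one-dimensional integrals; the outer one needs the inner
  integral to be continuous in \<open>x\<close> and \<open>s\<close> jointly.\<close>

lemma polyclo_integral2:
  fixes f :: "complex \<times> complex \<Rightarrow> real \<times> real \<Rightarrow> complex"
  assumes X: "compact X" and L: "0 \<le> L"
    and cont: "continuous_on (X \<times> cbox (-L,-L) (L,L)) (\<lambda>(x, p). f x p)"
    and f: "\<And>p. p \<in> cbox (-L,-L) (L,L) \<Longrightarrow> (\<lambda>x. f x p) \<in> polyclo X"
  shows "(\<lambda>x. integral (cbox (-L,-L) (L,L)) (f x)) \<in> polyclo X"
proof -
  have *: "continuous_on ((X \<times> {-L..L}) \<times> cbox (-L) L) (\<lambda>(y, t). f (fst y) (snd y, t))"
    unfolding split_beta
    by (rule continuous_on_compose2[OF cont[unfolded split_beta],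
         of _ "\<lambda>y. (fst (fst y), (snd (fst y), snd y))", simplified])
       (auto intro!: continuous_intros)
  have "(\<lambda>x. integral {-L..L} (\<lambda>s. integral {-L..L} (\<lambda>t. f x (s, t)))) \<in> polyclo X"
  proof (intro polyclo_integral X)
    show "continuous_on (X \<times> {- L..L}) (\<lambda>(x, s). integral {- L..L} (\<lambda>t. f x (s, t)))"
      using integral_continuous_on_param[OF *] by (simp add: split_beta)
    fix s assume s: "s \<in> {-L..L}"
    show "continuous_on (X \<times> {- L..L}) (\<lambda>(x, t). f x (s, t))"
      using s unfolding split_beta
      by (intro continuous_on_compose2[OF cont[unfolded split_beta],
         of _ "\<lambda>y. (fst y, (s, snd y))", simplified]) (auto intro!: continuous_intros)
  qed (use L f in auto)
  then show ?thesis
  proof (rule polyclo_cong)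
    fix x assume "x \<in> X"
    then have "continuous_on (cbox (-L,-L) (L,L)) (f x)"
      using continuous_on_compose2[OF cont continuous_on_Pair[OF continuous_on_const continuous_on_id],
          of x "cbox (-L,-L) (L,L)"] by auto
    then show "integral {-L..L} (\<lambda>s. integral {-L..L} (\<lambda>t. f x (s, t))) = integral (cbox (-L,-L) (L,L)) (f x)"
      using integral_prod_continuous[of "-L" "-L" L L "f x"] by simp
  qed
qed

subsection \<open>A regularised Cauchy transform\<close>

text \<open>From \<open>v w = |v|^2 + v (w - cnj v)\<close>, where the second term is at most
  \<open>|v|^2 / 2\<close> in modulus. In the uses, \<open>v\<close> and \<open>w\<close> are the
  increments of the two coordinates along the graph. A positive \<open>e\<close> gives a denominator
  to which \<open>polyclo_inverse\<close> applies; with \<open>e = 0\<close> the estimate yields the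
  sign of \<open>Re (z phi(z))\<close>.\<close>

lemma regularised_kernel_denominator:
  assumes "norm (w - cnj v) \<le> norm v / 2"
  shows "Re (v * w + of_real e) \<ge> (norm v)\<^sup>2 / 2 + e"
proof -
  have "v * w = of_real ((norm v)\<^sup>2) + v * (w - cnj v)"
    unfolding complex_norm_square by (simp add: algebra_simps)
  then have "Re (v * w) = (norm v)\<^sup>2 + Re (v * (w - cnj v))"
    by (metis Re_complex_of_real plus_complex.sel(1))
  moreover have "\<bar>Re (v * (w - cnj v))\<bar> \<le> norm v * (norm v / 2)"
    using abs_Re_le_cmod[of "v * (w - cnj v)"] assms mult_left_mono[OF assms, of "norm v"]
    by (simp add: norm_mult)
  ultimately have "Re (v * w) \<ge> (norm v)\<^sup>2 / 2"
    unfolding power2_eq_square by linarith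
  then show ?thesis by simp
qed

text \<open>Over a common denominator the numerator \<open>w (v cnj v + e) - cnj v (v w + e)\<close>
  collapses to \<open>e (w - cnj v)\<close>. The factor \<open>e\<close> makes the exchange of
  kernels harmless in the limit.\<close>

lemma regularised_kernel_diff:
  assumes w: "norm (w - cnj v) \<le> norm v / 2" and e: "e > 0"
  shows "norm (w / (v * w + of_real e) - cnj v / of_real ((norm v)\<^sup>2 + e))
    \<le> e * norm v / ((norm v)\<^sup>2 + e)\<^sup>2"
proof -
  define q where "q = (norm v)\<^sup>2 + e"
  have q: "q > 0" using e by (auto simp: q_def add_nonneg_pos)
  have cq: "of_real q = v * cnj v + of_real e"
    by (simp add: q_def complex_norm_square flip: of_real_power)
  have "q / 2 \<le> Re (v * w + of_real e)"
    using regularised_kernel_denominator[OF w, of e] e unfolding q_def by argo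
  then have d: "q / 2 \<le> norm (v * w + of_real e)"
    using complex_Re_le_cmod order_trans by blast
  then have ne: "v * w + of_real e \<noteq> 0" using q by auto
  have "w / (v * w + of_real e) - cnj v / of_real q = of_real e * (w - cnj v) / ((v * w + of_real e) * of_real q)"
    using ne q by (simp add: diff_frac_eq) (simp add: cq algebra_simps)
  then have "norm (w / (v * w + of_real e) - cnj v / of_real q) = e * norm (w - cnj v) / (norm (v * w + of_real e) * q)"
    using e q by (simp add: norm_mult norm_divide)
  also have "\<dots> \<le> e * (norm v / 2) / (q / 2 * q)"
    using d q w e by (intro frac_le mult_left_mono mult_right_mono mult_pos_pos) auto
  also have "\<dots> = e * norm v / q\<^sup>2" by (simp add: power2_eq_square)
  finally show ?thesis by (simp add: q_def)
qed

lemma has_integral_arsinh_kernel: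
  assumes "L \<ge> 0" "h > 0"
  shows "((\<lambda>s. 1 / sqrt ((x - s)\<^sup>2 + h\<^sup>2)) has_integral arsinh ((x + L) / h) - arsinh ((x - L) / h)) {-L..L}"
proof -
  have "((\<lambda>s. 1 / sqrt ((x - s)\<^sup>2 + h\<^sup>2)) has_integral (- arsinh ((x - L) / h)) - (- arsinh ((x - (-L)) / h))) {-L..L}"
  proof (rule fundamental_theorem_of_calculus)
    fix s
    have "sqrt (((x - s) / h)\<^sup>2 + 1) * h = sqrt ((x - s)\<^sup>2 + h\<^sup>2)"
    proof -
      have "(x - s)\<^sup>2 + h\<^sup>2 = (((x - s) / h)\<^sup>2 + 1) * h\<^sup>2"
        using assms(2) by (simp add: field_simps)
      then show ?thesis using assms(2) by (simp add: real_sqrt_mult)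
    qed
    moreover have "((\<lambda>s. - arsinh ((x - s) / h)) has_real_derivative 1 / (sqrt (((x - s) / h)\<^sup>2 + 1) * h)) (at s)"
    proof -
      have "((\<lambda>s. (x - s) / h) has_real_derivative (- 1 / h)) (at s)"
        using assms(2) by (auto intro!: derivative_eq_intros)
      from DERIV_minus[OF DERIV_chain2[OF arsinh_real_has_field_derivative this]]
      show ?thesis by simp
    qed
    ultimately show "((\<lambda>s. - arsinh ((x - s) / h)) has_vector_derivative 1 / sqrt ((x - s)\<^sup>2 + h\<^sup>2)) (at s within {-L..L})"
      by (simp add: has_real_derivative_iff_has_vector_derivative has_vector_derivative_at_within)
  qed (use assms in auto)
  then show ?thesis by simp
qed

text \<open>Put \<open>q = |v|^2 + h^2\<close>. By \<open>2 h |v| \<le> q\<close> the integrand is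
  at most \<open>h / (2 q)\<close>, and \<open>1 / q\<close> is at most the product of
  \<open>1 / sqrt (a^2 + h^2)\<close> and \<open>1 / sqrt (b^2 + h^2)\<close>, with \<open>a\<close>
  and \<open>b\<close> the coordinates of \<open>v\<close>. The integral over the square then splits
  into two one-dimensional ones, each at most \<open>2 arsinh (2 L / h)\<close>.\<close>

lemma integral_regularised_error_le:
  assumes L: "L \<ge> 0" and h: "h > 0" and z: "\<bar>Re z\<bar> \<le> L" "\<bar>Im z\<bar> \<le> L"
  shows "integral (cbox (-L,-L) (L,L)) (\<lambda>p. h\<^sup>2 * norm (z - Complex (fst p) (snd p)) / ((norm (z - Complex (fst p) (snd p)))\<^sup>2 + h\<^sup>2)\<^sup>2)
    \<le> 2 * h * (arsinh (2 * L / h))\<^sup>2"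
proof -
  define k where "k x s = 1 / sqrt ((x - s)\<^sup>2 + h\<^sup>2)" for x s :: real
  have pos: "(a::real)\<^sup>2 + h\<^sup>2 > 0" for a using h by (simp add: add_nonneg_pos)
  have contk: "continuous_on A (\<lambda>p. k x (f p))" if "continuous_on A f" for A :: "'b::topological_space set" and x f
    unfolding k_def using pos that by (intro continuous_intros) (auto simp: less_imp_neq[symmetric])
  have one: "integral {-L..L} (k x) \<le> 2 * arsinh (2 * L / h)" "integral {-L..L} (k x) \<ge> 0" if "\<bar>x\<bar> \<le> L" for x
  proof -
    have "integral {-L..L} (k x) = arsinh ((x + L) / h) - arsinh ((x - L) / h)"
      unfolding k_def using has_integral_arsinh_kernel[OF L h] by (rule integral_unique)
    also have "\<dots> = arsinh ((x + L) / h) + arsinh ((L - x) / h)"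
      using arsinh_minus_real[of "(L - x) / h"] by (simp add: minus_divide_left)
    also have "\<dots> \<le> arsinh (2 * L / h) + arsinh (2 * L / h)"
    proof (intro add_mono)
      have mono: "arsinh a \<le> arsinh b" if "a \<le> b" for a b :: real
        using that arsinh_less_iff_real[of b a] by linarith
      show "arsinh ((x + L) / h) \<le> arsinh (2 * L / h)" "arsinh ((L - x) / h) \<le> arsinh (2 * L / h)"
        using that h by (auto intro!: mono divide_right_mono)
    qed
    finally show "integral {-L..L} (k x) \<le> 2 * arsinh (2 * L / h)" by simp
    show "integral {-L..L} (k x) \<ge> 0"
      by (intro Henstock_Kurzweil_Integration.integral_nonneg integrable_continuous_real contk continuous_on_id) (auto simp: k_def)
  qed
  have "integral (cbox (-L,-L) (L,L)) (\<lambda>p. h\<^sup>2 * norm (z - Complex (fst p) (snd p)) / ((norm (z - Complex (fst p) (snd p)))\<^sup>2 + h\<^sup>2)\<^sup>2)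
      \<le> integral (cbox (-L,-L) (L,L)) (\<lambda>p. h / 2 * (k (Re z) (fst p) * k (Im z) (snd p)))"
  proof (intro integral_le integrable_continuous)
    show "continuous_on (cbox (-L,-L) (L,L)) (\<lambda>p. h\<^sup>2 * norm (z - Complex (fst p) (snd p)) / ((norm (z - Complex (fst p) (snd p)))\<^sup>2 + h\<^sup>2)\<^sup>2)"
      unfolding Complex_eq by (intro continuous_intros) (use pos in \<open>auto simp: less_imp_neq[symmetric]\<close>)
    show "continuous_on (cbox (-L,-L) (L,L)) (\<lambda>p. h / 2 * (k (Re z) (fst p) * k (Im z) (snd p)))"
      by (intro continuous_intros contk)
    fix p
    define v where "v = z - Complex (fst p) (snd p)"
    define q where "q = (norm v)\<^sup>2 + h\<^sup>2"
    have q: "q > 0" using pos by (simp add: q_def)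
    have "2 * (h * norm v) \<le> q"
      using sum_squares_bound[of h "norm v"] by (simp add: q_def)
    then have "h\<^sup>2 * norm v / q\<^sup>2 \<le> h / 2 * (1 / q)"
      using q h by (simp add: field_simps power2_eq_square)
    also have "1 / q \<le> k (Re z) (fst p) * k (Im z) (snd p)"
    proof -
      define a b where "a = Re z - fst p" and "b = Im z - snd p"
      have qab: "q = a\<^sup>2 + b\<^sup>2 + h\<^sup>2" unfolding q_def cmod_power2 by (simp add: v_def a_def b_def)
      have "(a\<^sup>2 + h\<^sup>2) * (b\<^sup>2 + h\<^sup>2) \<le> q * q"
        unfolding qab by (intro mult_mono) auto
      then have "sqrt (a\<^sup>2 + h\<^sup>2) * sqrt (b\<^sup>2 + h\<^sup>2) \<le> q"
        unfolding real_sqrt_mult[symmetric] using q by (intro real_le_lsqrt) (auto simp: power2_eq_square)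
      then have "1 / q \<le> 1 / (sqrt (a\<^sup>2 + h\<^sup>2) * sqrt (b\<^sup>2 + h\<^sup>2))"
        using q pos[of a] pos[of b] by (intro divide_left_mono) auto
      then show ?thesis by (simp add: k_def a_def b_def)
    qed
    finally show "h\<^sup>2 * norm (z - Complex (fst p) (snd p)) / ((norm (z - Complex (fst p) (snd p)))\<^sup>2 + h\<^sup>2)\<^sup>2
       \<le> h / 2 * (k (Re z) (fst p) * k (Im z) (snd p))"
      using h by (simp add: v_def q_def)
  qed
  also have "\<dots> = integral {-L..L} (\<lambda>s. integral {-L..L} (\<lambda>t. h / 2 * (k (Re z) s * k (Im z) t)))"
  proof -
    have "continuous_on (cbox (-L,-L) (L,L)) (\<lambda>p. h / 2 * (k (Re z) (fst p) * k (Im z) (snd p)))"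
      by (intro continuous_intros contk)
    from integral_prod_continuous[OF this] show ?thesis
      by (simp only: fst_conv snd_conv box_real)
  qed
  also have "\<dots> = h / 2 * (integral {-L..L} (k (Re z)) * integral {-L..L} (k (Im z)))"
    by simp
  also have "\<dots> \<le> h / 2 * ((2 * arsinh (2 * L / h)) * (2 * arsinh (2 * L / h)))"
    using one z h L order_trans[OF one(2) one(1), of "Re z"] by (intro mult_left_mono mult_mono) auto
  finally show ?thesis by (simp add: power2_eq_square algebra_simps)
qed

text \<open>\<open>arsinh\<close> grows only logarithmically, so the factor \<open>h\<close>
  wins.\<close>

lemma arsinh_error_tendsto_0:
  fixes L :: real
  assumes "L > 0"
  shows "((\<lambda>h. 2 * h * (arsinh (2 * L / h))\<^sup>2) \<longlongrightarrow> 0) (at_right 0)"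
proof (rule tendsto_sandwich[of "\<lambda>_. 0" _ _ "\<lambda>h. 2 * h * (ln (4 * L / h + 1))\<^sup>2"])
  have "arsinh y \<le> ln (2 * y + 1)" "0 \<le> arsinh y" if "y > 0" for y :: real
  proof -
    have "sqrt (y\<^sup>2 + 1) \<le> y + 1"
      using that by (intro real_le_lsqrt) (auto simp: power2_eq_square algebra_simps)
    then show "arsinh y \<le> ln (2 * y + 1)"
      unfolding arsinh_real_def using that arsinh_real_aux[of y] by (subst ln_le_cancel_iff) auto
    show "0 \<le> arsinh y" using that by (simp add: less_imp_le)
  qed
  from this[of "2 * L / _"] show "\<forall>\<^sub>F h in at_right 0. 2 * h * (arsinh (2 * L / h))\<^sup>2 \<le> 2 * h * (ln (4 * L / h + 1))\<^sup>2"
    using assms by (intro eventually_at_rightI[of 0 1]) (auto intro!: mult_left_mono power_mono)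
  show "((\<lambda>h. 2 * h * (ln (4 * L / h + 1))\<^sup>2) \<longlongrightarrow> 0) (at_right 0)"
    using assms by real_asymp
qed (auto intro!: eventually_at_rightI[of 0 1])

text \<open>The kernel \<open>cnj v / (|v|\<^sup>2 + e)\<close>, with \<open>v = z - \<zeta>\<close>, satisfies
  \<open>(\<partial>\<^sub>s + \<i> \<partial>\<^sub>t) = - 2 e / (|v|\<^sup>2 + e)\<^sup>2\<close> for \<open>\<zeta> = s + \<i> t\<close>.\<close>

lemma integral_dbar_by_parts:
  fixes A A' B B' :: "complex \<Rightarrow> complex"
  assumes L: "L \<ge> 0" and e: "e > 0"
    and A: "\<And>s. (A has_field_derivative A' s) (at s)" and B: "\<And>s. (B has_field_derivative B' s) (at s)"
    and cA: "continuous_on UNIV A'" and cB: "continuous_on UNIV B'"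
    and zA: "A (of_real L) = 0" "A (- of_real L) = 0" and zB: "B (of_real L) = 0" "B (- of_real L) = 0"
  shows "integral (cbox (-L,-L) (L,L)) (\<lambda>p. (A' (of_real (fst p)) * B (of_real (snd p)) + \<i> * A (of_real (fst p)) * B' (of_real (snd p)))
            * (cnj (z - Complex (fst p) (snd p)) / of_real ((norm (z - Complex (fst p) (snd p)))\<^sup>2 + e)))
       = integral (cbox (-L,-L) (L,L)) (\<lambda>p. 2 * A (of_real (fst p)) * B (of_real (snd p)) *
            of_real (e / ((norm (z - Complex (fst p) (snd p)))\<^sup>2 + e)\<^sup>2))"
proof -
  \<comment> \<open>The real coordinates become complex variables \<open>S\<close> and
    \<open>T\<close>, so that the rules for field derivatives apply. On real arguments
    \<open>X - S - \<i> (Y - T)\<close> and \<open>Q S T\<close> are the conjugate of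
    \<open>z - \<zeta>\<close> and \<open>|z - \<zeta>|^2 + e\<close>. \<open>Hs\<close> and
    \<open>Ht\<close> are the partial derivatives of \<open>H\<close>, the weight times the
    kernel.\<close>
  define X Y :: complex where "X = of_real (Re z)" and "Y = of_real (Im z)"
  define E :: complex where "E = of_real e"
  define Q where "Q = (\<lambda>S T. (X - S)\<^sup>2 + (Y - T)\<^sup>2 + E)"
  define H where "H = (\<lambda>S T. A S * B T * (((X - S) - \<i> * (Y - T)) / Q S T))"
  define Hs where "Hs = (\<lambda>S T. A' S * B T * (((X - S) - \<i> * (Y - T)) / Q S T)
      - A S * B T * (1 / Q S T - ((X - S) - \<i> * (Y - T)) * (2 * (X - S)) / (Q S T)\<^sup>2))"
  define Ht where "Ht = (\<lambda>S T. A S * B' T * (((X - S) - \<i> * (Y - T)) / Q S T)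
      - A S * B T * (- \<i> / Q S T - ((X - S) - \<i> * (Y - T)) * (2 * (Y - T)) / (Q S T)\<^sup>2))"
  have Qr: "Q (of_real s) (of_real t) = of_real ((norm (z - Complex s t))\<^sup>2 + e)" for s t
    unfolding Q_def X_def Y_def E_def cmod_power2 by simp
  have Qne: "Q (of_real s) (of_real t) \<noteq> 0" for s t
    unfolding Qr of_real_eq_0_iff using e by (metis add_nonneg_pos less_irrefl zero_le_power2)
  have dS: "((\<lambda>S. H S T) has_field_derivative Hs S T) (at S)" if "Q S T \<noteq> 0" for S T
  proof -
    define n q where "n S = (X - S) - \<i> * (Y - T)" and "q S = Q S T" for S
    have "(n has_field_derivative - 1) (at S)" "(q has_field_derivative - (2 * (X - S))) (at S)"
      unfolding n_def q_def Q_def by (auto intro!: derivative_eq_intros)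
    moreover have "q S \<noteq> 0" using that by (simp add: q_def)
    ultimately have "((\<lambda>S. A S * B T * (n S / q S)) has_field_derivative
       (A' S * B T * (n S / q S) + ((- 1 * q S - n S * (- (2 * (X - S)))) / (q S * q S)) * (A S * B T))) (at S)"
      by (intro DERIV_mult DERIV_divide DERIV_cmult_right A)
    moreover have "(- 1 * q S - n S * (- (2 * (X - S)))) / (q S * q S) = - (1 / q S - n S * (2 * (X - S)) / (q S)\<^sup>2)"
      using \<open>q S \<noteq> 0\<close> by (simp add: divide_simps power2_eq_square) (simp add: algebra_simps)?
    ultimately show ?thesis
      unfolding H_def Hs_def n_def[symmetric] q_def[symmetric]
      by (simp only: mult_minus_left mult_minus_right add_uminus_conv_diff mult.commute[of _ "A S * B T"])
  qed
  have dT: "((\<lambda>T. H S T) has_field_derivative Ht S T) (at T)" if "Q S T \<noteq> 0" for S T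
  proof -
    define n q where "n T = (X - S) - \<i> * (Y - T)" and "q T = Q S T" for T
    have "(n has_field_derivative \<i>) (at T)" "(q has_field_derivative - (2 * (Y - T))) (at T)"
      unfolding n_def q_def Q_def by (auto intro!: derivative_eq_intros)
    moreover have "q T \<noteq> 0" using that by (simp add: q_def)
    ultimately have "((\<lambda>T. A S * B T * (n T / q T)) has_field_derivative
       (A S * B' T * (n T / q T) + ((\<i> * q T - n T * (- (2 * (Y - T)))) / (q T * q T)) * (A S * B T))) (at T)"
      by (intro DERIV_mult DERIV_divide DERIV_cmult B)
    moreover have "(\<i> * q T - n T * (- (2 * (Y - T)))) / (q T * q T) = - (- \<i> / q T - n T * (2 * (Y - T)) / (q T)\<^sup>2)"
      using \<open>q T \<noteq> 0\<close> by (simp add: divide_simps power2_eq_square) (simp add: algebra_simps)?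
    ultimately show ?thesis
      unfolding H_def Ht_def n_def[symmetric] q_def[symmetric]
      by (simp only: mult_minus_left mult_minus_right add_uminus_conv_diff mult.commute[of _ "A S * B T"])
  qed
  have cA0: "continuous_on UNIV A" and cB0: "continuous_on UNIV B"
    using A B by (meson DERIV_continuous continuous_at_imp_continuous_on)+
  note [continuous_intros] = continuous_on_compose2[OF cA] continuous_on_compose2[OF cB]
     continuous_on_compose2[OF cA0] continuous_on_compose2[OF cB0]
  have cQ: "continuous_on S (\<lambda>p. Q (of_real (f p)) (of_real (g p)))" if "continuous_on S f" "continuous_on S g"
    for S :: "'b::topological_space set" and f g
    unfolding Q_def using that by (intro continuous_intros)
  have cHs: "continuous_on S (\<lambda>p. Hs (of_real (fst p)) (of_real (snd p)))" for S
    unfolding Hs_def by (intro continuous_intros cQ) (auto simp: Qne)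
  have cHt: "continuous_on S (\<lambda>p. Ht (of_real (fst p)) (of_real (snd p)))" for S
    unfolding Ht_def by (intro continuous_intros cQ) (auto simp: Qne)
  let ?box = "cbox (-L,-L) (L,L)"
  \<comment> \<open>The weight vanishes at both ends of each segment, so no boundary term
    remains.\<close>
  have intS: "integral {-L..L} (\<lambda>s. Hs (of_real s) (of_real t)) = 0" for t
  proof -
    have "((\<lambda>s. Hs (of_real s) (of_real t)) has_integral H (of_real L) (of_real t) - H (of_real (-L)) (of_real t)) {-L..L}"
    proof (rule fundamental_theorem_of_calculus)
      fix s
      show "((\<lambda>s. H (of_real s) (of_real t)) has_vector_derivative Hs (of_real s) (of_real t)) (at s within {-L..L})"
        by (rule has_vector_derivative_real_field[OF dS[OF Qne]])
    qed (use L in simp)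
    then show ?thesis using zA by (simp add: H_def integral_unique)
  qed
  have intT: "integral {-L..L} (\<lambda>t. Ht (of_real s) (of_real t)) = 0" for s
  proof -
    have "((\<lambda>t. Ht (of_real s) (of_real t)) has_integral H (of_real s) (of_real L) - H (of_real s) (of_real (-L))) {-L..L}"
    proof (rule fundamental_theorem_of_calculus)
      fix t
      show "((\<lambda>t. H (of_real s) (of_real t)) has_vector_derivative Ht (of_real s) (of_real t)) (at t within {-L..L})"
        by (rule has_vector_derivative_real_field[OF dT[OF Qne]])
    qed (use L in simp)
    then show ?thesis using zB by (simp add: H_def integral_unique)
  qed
  have t0: "integral ?box (\<lambda>p. Ht (of_real (fst p)) (of_real (snd p))) = 0"
    using integral_prod_continuous[OF cHt] by (simp add: intT)
  have "integral ?box (\<lambda>p. Hs (of_real (fst p)) (of_real (snd p)))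
     = integral {-L..L} (\<lambda>s. integral {-L..L} (\<lambda>t. Hs (of_real s) (of_real t)))"
    using integral_prod_continuous[OF cHs] by simp
  also have "\<dots> = integral {-L..L} (\<lambda>t. integral {-L..L} (\<lambda>s. Hs (of_real s) (of_real t)))"
    using integral_swap_continuous[of "-L" "-L" L L "\<lambda>s t. Hs (of_real s) (of_real t)"] cHs
    by (simp add: split_beta)
  also have "\<dots> = 0" by (simp add: intS)
  finally have s0: "integral ?box (\<lambda>p. Hs (of_real (fst p)) (of_real (snd p))) = 0" .
  define M where "M p = 2 * A (of_real (fst p)) * B (of_real (snd p)) *
            of_real (e / ((norm (z - Complex (fst p) (snd p)))\<^sup>2 + e)\<^sup>2)" for p
  have cM: "continuous_on ?box M"
  proof -
    have "continuous_on ?box (\<lambda>p. 2 * A (of_real (fst p)) * B (of_real (snd p)) * (E / (Q (of_real (fst p)) (of_real (snd p)))\<^sup>2))"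
      by (intro continuous_intros cQ) (auto simp: Qne)
    then show ?thesis unfolding M_def Qr E_def by simp
  qed
  have "(A' (of_real s) * B (of_real t) + \<i> * A (of_real s) * B' (of_real t))
            * (cnj (z - Complex s t) / of_real ((norm (z - Complex s t))\<^sup>2 + e))
     = (Hs (of_real s) (of_real t) + \<i> * Ht (of_real s) (of_real t)) + M (s, t)" for s t
  proof -
    define a b q where "a = X - of_real s" and "b = Y - of_real t" and "q = Q (of_real s) (of_real t)"
    have cv: "cnj (z - Complex s t) = a - \<i> * b"
      by (simp add: a_def b_def X_def Y_def complex_eq_iff)
    have M: "M (s, t) = 2 * A (of_real s) * B (of_real t) * (E / q\<^sup>2)"
      unfolding M_def q_def Qr E_def by simp
    have q: "q = a\<^sup>2 + b\<^sup>2 + E" by (simp add: q_def Q_def a_def b_def)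
    have q0: "q \<noteq> 0" using Qne by (simp add: q_def)
    \<comment> \<open>As \<open>(a - \<i> b) (a + \<i> b) = q - E\<close>, only \<open>2 E\<close>
      survives. For \<open>E = 0\<close> nothing would, the Cauchy kernel being holomorphic.\<close>
    have 1: "(1 / q - (a - \<i> * b) * (2 * a) / q\<^sup>2) + \<i> * (- \<i> / q - (a - \<i> * b) * (2 * b) / q\<^sup>2) = 2 * (E / q\<^sup>2)"
    proof -
      have "(1 / q - (a - \<i> * b) * (2 * a) / q\<^sup>2) + \<i> * (- \<i> / q - (a - \<i> * b) * (2 * b) / q\<^sup>2)
         = (2 * q - 2 * (a - \<i> * b) * (a + \<i> * b)) / q\<^sup>2"
        using q0 by (simp add: field_simps power2_eq_square)
      also have "2 * q - 2 * (a - \<i> * b) * (a + \<i> * b) = 2 * E"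
        unfolding q by (simp add: algebra_simps power2_eq_square)
      finally show ?thesis by simp
    qed
    have distr: "(\<alpha> * \<beta> * n - \<gamma> * \<beta> * k1) + j * (\<gamma> * \<delta> * n - \<gamma> * \<beta> * k2)
        = (\<alpha> * \<beta> + j * \<gamma> * \<delta>) * n - \<gamma> * \<beta> * (k1 + j * k2)" for \<alpha> \<beta> \<gamma> \<delta> n k1 k2 j :: complex
      by (simp add: algebra_simps)
    have "Hs (of_real s) (of_real t) + \<i> * Ht (of_real s) (of_real t) =
       (A' (of_real s) * B (of_real t) + \<i> * A (of_real s) * B' (of_real t)) * ((a - \<i> * b) / q)
       - A (of_real s) * B (of_real t) * ((1 / q - (a - \<i> * b) * (2 * a) / q\<^sup>2) + \<i> * (- \<i> / q - (a - \<i> * b) * (2 * b) / q\<^sup>2))"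
      unfolding Hs_def Ht_def a_def[symmetric] b_def[symmetric] q_def[symmetric] by (rule distr)
    then show ?thesis unfolding 1 M cv Qr[symmetric] q_def[symmetric] by simp
  qed
  then have "integral ?box (\<lambda>p. (A' (of_real (fst p)) * B (of_real (snd p)) + \<i> * A (of_real (fst p)) * B' (of_real (snd p)))
            * (cnj (z - Complex (fst p) (snd p)) / of_real ((norm (z - Complex (fst p) (snd p)))\<^sup>2 + e)))
     = integral ?box (\<lambda>p. (Hs (of_real (fst p)) (of_real (snd p)) + \<i> * Ht (of_real (fst p)) (of_real (snd p))) + M p)"
    by simp
  also have "\<dots> = integral ?box (\<lambda>p. Hs (of_real (fst p)) (of_real (snd p)))
      + \<i> * integral ?box (\<lambda>p. Ht (of_real (fst p)) (of_real (snd p))) + integral ?box M"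
    by (simp add: Henstock_Kurzweil_Integration.integral_add integrable_continuous cHs cHt cM continuous_intros)
  finally show ?thesis unfolding s0 t0 M_def by simp
qed

subsection \<open>Wermer's theorem for small perturbations of the conjugation\<close>

text \<open>Integrals run over a square of half-side \<open>L\<close> that contains the disc of
  radius \<open>r\<close> with a margin, so that a weight vanishing on the border of the square is
  still bounded below near the disc. The constant 1/2 is the one of
  \<open>regularised_kernel_denominator\<close>.\<close>

locale near_conjugation =
  fixes phi :: "complex \<Rightarrow> complex" and L r :: real
  assumes r0: "0 < r" and rL: "r < L"
    and lip: "\<And>z w. \<bar>Re z\<bar> \<le> L \<Longrightarrow> \<bar>Im z\<bar> \<le> L \<Longrightarrow> \<bar>Re w\<bar> \<le> L \<Longrightarrow> \<bar>Im w\<bar> \<le> L \<Longrightarrow>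
      norm ((phi z - cnj z) - (phi w - cnj w)) \<le> norm (z - w) / 2"
begin

definition graph :: "(complex \<times> complex) set" where
  "graph = (\<lambda>z. (z, phi z)) ` cball 0 r"

abbreviation box :: "(real \<times> real) set" where
  "box \<equiv> cbox (-L,-L) (L,L)"

definition pt :: "real \<times> real \<Rightarrow> complex" where
  "pt p = Complex (fst p) (snd p)"

lemma L0: "L > 0" using r0 rL by simp

lemma cball_coords: "z \<in> cball 0 r \<Longrightarrow> \<bar>Re z\<bar> \<le> L \<and> \<bar>Im z\<bar> \<le> L"
  using abs_Re_le_cmod[of z] abs_Im_le_cmod[of z] rL by auto

lemma box_coords: "p \<in> box \<Longrightarrow> \<bar>Re (pt p)\<bar> \<le> L \<and> \<bar>Im (pt p)\<bar> \<le> L"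
  by (cases p) (auto simp: pt_def cbox_Pair_eq)

lemma continuous_phi: "continuous_on {z. \<bar>Re z\<bar> \<le> L \<and> \<bar>Im z\<bar> \<le> L} phi"
proof -
  have "(1/2)-lipschitz_on {z. \<bar>Re z\<bar> \<le> L \<and> \<bar>Im z\<bar> \<le> L} (\<lambda>z. phi z - cnj z)"
    using lip by (intro lipschitz_onI) (auto simp: dist_norm)
  then have "continuous_on {z. \<bar>Re z\<bar> \<le> L \<and> \<bar>Im z\<bar> \<le> L} (\<lambda>z. (phi z - cnj z) + cnj z)"
    by (intro continuous_intros lipschitz_on_continuous_on)
  then show ?thesis by simp
qed

lemma compact_graph: "compact graph"
  unfolding graph_def
  by (intro compact_continuous_image continuous_intros continuous_on_subset[OF continuous_phi])
     (use cball_coords in auto)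

lemma bounded_graph: "bounded graph"
  using compact_graph compact_imp_bounded by blast

text \<open>For \<open>h = 0\<close> this is, on the graph, the Cauchy kernel
  \<open>1 / (z - \<zeta>)\<close> expanded by \<open>w - phi \<zeta>\<close>. The expansion gives
  the denominator a nonnegative real part there, so that \<open>h^2\<close> removes the pole and the
  inverse becomes approximable by polynomials in \<open>x\<close>.\<close>

definition kern :: "real \<Rightarrow> complex \<times> complex \<Rightarrow> real \<times> real \<Rightarrow> complex" where
  "kern h x p = (snd x - phi (pt p)) / ((fst x - pt p) * (snd x - phi (pt p)) + of_real (h\<^sup>2))"

lemma graph_increment:
  assumes "x \<in> graph" "p \<in> box"
  shows "norm ((snd x - phi (pt p)) - cnj (fst x - pt p)) \<le> norm (fst x - pt p) / 2"
proof -
  obtain z where z: "z \<in> cball 0 r" "x = (z, phi z)" using assms(1) by (auto simp: graph_def)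
  then show ?thesis
    using lip[of z "pt p"] cball_coords[OF z(1)] box_coords[OF assms(2)] by (simp add: algebra_simps)
qed

lemma kern_denominator:
  assumes "x \<in> graph" "p \<in> box"
  shows "Re ((fst x - pt p) * (snd x - phi (pt p)) + of_real (h\<^sup>2)) \<ge> h\<^sup>2"
  using regularised_kernel_denominator[OF graph_increment[OF assms], of "h\<^sup>2"]
    zero_le_power2[of "norm (fst x - pt p)"] by linarith

lemma kern_in_polyclo:
  assumes "p \<in> box" "h > 0"
  shows "(\<lambda>x. kern h x p) \<in> polyclo graph"
  unfolding kern_def divide_inverse
  by (intro polyclo_mult polyclo_diff polyclo_snd polyclo_const bounded_graph
        polyclo_inverse[where d = "h\<^sup>2"] polyclo_add polyclo_fst kern_denominator assms)
     (use assms in auto)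

lemma continuous_pt: "continuous_on S pt"
  unfolding pt_def Complex_eq by (intro continuous_intros)

lemma continuous_kern:
  assumes "h > 0"
  shows "continuous_on (graph \<times> box) (\<lambda>(x, p). kern h x p)"
proof -
  have 1: "continuous_on (graph \<times> box) (\<lambda>y. phi (pt (snd y)))"
    by (intro continuous_on_compose2[OF continuous_phi] continuous_on_compose2[OF continuous_pt[of UNIV]] continuous_intros)
       (use box_coords in auto)
  have 2: "continuous_on (graph \<times> box) (\<lambda>y. pt (snd y))"
    by (intro continuous_on_compose2[OF continuous_pt[of UNIV]] continuous_intros) auto
  have "(fst x - pt p) * (snd x - phi (pt p)) + of_real (h\<^sup>2) \<noteq> 0" if "x \<in> graph" "p \<in> box" for x p
    using kern_denominator[OF that, of h] assms by (metis less_irrefl order_less_le_trans zero_complex.sel(1) zero_less_power)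
  then show ?thesis
    unfolding kern_def split_beta by (intro continuous_intros 1 2) auto
qed

lemma kern_integral_in_polyclo:
  assumes "h > 0" "continuous_on box c"
  shows "(\<lambda>x. integral box (\<lambda>p. c p * kern h x p)) \<in> polyclo graph"
proof (rule polyclo_integral2[OF compact_graph])
  have "continuous_on (graph \<times> box) (\<lambda>y. c (snd y))"
    by (intro continuous_on_compose2[OF assms(2)] continuous_intros) auto
  then show "continuous_on (graph \<times> box) (\<lambda>(x, p). c p * kern h x p)"
    using continuous_kern[OF assms(1)] unfolding split_beta by (intro continuous_intros)
qed (use L0 assms in \<open>auto intro!: polyclo_cmult kern_in_polyclo\<close>)

definition err :: "real \<Rightarrow> real" where
  "err h = 2 * h * (arsinh (2 * L / h))\<^sup>2"

text \<open>Minus the dbar-derivative in \<open>\<zeta>\<close> of the regularised kernel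
  \<open>cnj v / (|v|^2 + h^2)\<close>: an approximate identity at \<open>z\<close>, of total mass
  pi over the plane for every \<open>h > 0\<close>.\<close>

definition poisson :: "real \<Rightarrow> complex \<Rightarrow> real \<times> real \<Rightarrow> real" where
  "poisson h z p = h\<^sup>2 / ((norm (z - pt p))\<^sup>2 + h\<^sup>2)\<^sup>2"

lemma continuous_poisson: "h > 0 \<Longrightarrow> continuous_on S (poisson h z)"
  unfolding poisson_def
  by (intro continuous_intros continuous_pt) (auto simp: add_nonneg_pos less_imp_neq[symmetric])

lemma poisson_nonneg: "poisson h z p \<ge> 0"
  by (simp add: poisson_def)

lemma integral_poisson_norm_le:
  assumes "h > 0" "z \<in> cball 0 r"
  shows "integral box (\<lambda>p. poisson h z p * norm (z - pt p)) \<le> err h"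
  using integral_regularised_error_le[of L h z] cball_coords[OF assms(2)] assms(1) L0
  by (simp add: poisson_def pt_def err_def)

text \<open>Two errors have this pointwise form: that of exchanging the kernels and that of
  replacing \<open>s\<close> by \<open>Re z\<close> under the integral.\<close>

lemma integral_norm_le_err:
  fixes f :: "real \<times> real \<Rightarrow> complex"
  assumes h: "h > 0" and z: "z \<in> cball 0 r" and f: "continuous_on box f" and C: "C \<ge> 0"
    and le: "\<And>p. p \<in> box \<Longrightarrow> norm (f p) \<le> C * (poisson h z p * norm (z - pt p))"
  shows "norm (integral box f) \<le> C * err h"
proof -
  have "norm (integral box f) \<le> integral box (\<lambda>p. C * (poisson h z p * norm (z - pt p)))"
    by (intro integral_norm_bound_integral integrable_continuous f continuous_intros continuous_poisson h continuous_pt le)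
  also have "\<dots> = C * integral box (\<lambda>p. poisson h z p * norm (z - pt p))" by simp
  also have "\<dots> \<le> C * err h"
    using integral_poisson_norm_le[OF h z] C by (intro mult_left_mono)
  finally show ?thesis .
qed

text \<open>\<open>kern\<close> is exchanged for the explicit kernel \<open>kap\<close>, at a cost
  controlled by \<open>regularised_kernel_diff\<close>; integration by parts then moves the
  derivative from the weight to \<open>kap\<close> and leaves the weight smoothed by
  \<open>poisson\<close>. \<open>C\<close> bounds the density on the square and so depends neither
  on \<open>h\<close> nor on \<open>z\<close>.\<close>

lemma kern_integral_approx:
  fixes A A' B B' :: "complex \<Rightarrow> complex"
  assumes A: "\<And>s. (A has_field_derivative A' s) (at s)" and B: "\<And>s. (B has_field_derivative B' s) (at s)"
    and cA: "continuous_on UNIV A'" and cB: "continuous_on UNIV B'"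
    and zA: "A (of_real L) = 0" "A (- of_real L) = 0" and zB: "B (of_real L) = 0" "B (- of_real L) = 0"
  obtains C c where "C > 0" "continuous_on box c"
    "\<And>h z. h > 0 \<Longrightarrow> z \<in> cball 0 r \<Longrightarrow>
       norm (integral box (\<lambda>p. c p * kern h (z, phi z) p)
         - integral box (\<lambda>p. 2 * A (of_real (fst p)) * B (of_real (snd p)) * of_real (poisson h z p))) \<le> C * err h"
proof -
  \<comment> \<open>The operator \<open>d/ds + \<i> d/dt\<close> applied to the weight
    \<open>A(s) B(t)\<close>, that is, twice its dbar-derivative.\<close>
  define c where "c p = A' (of_real (fst p)) * B (of_real (snd p)) + \<i> * A (of_real (fst p)) * B' (of_real (snd p))" for p :: "real \<times> real"
  have cA0: "continuous_on UNIV A" and cB0: "continuous_on UNIV B"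
    using A B by (meson DERIV_continuous continuous_at_imp_continuous_on)+
  have cc: "continuous_on box c"
    unfolding c_def
    by (intro continuous_intros continuous_on_compose2[OF cA] continuous_on_compose2[OF cB]
          continuous_on_compose2[OF cA0] continuous_on_compose2[OF cB0]) auto
  have "bounded (c ` box)"
    by (intro compact_imp_bounded compact_continuous_image cc) auto
  then obtain C where C: "C > 0" "\<And>p. p \<in> box \<Longrightarrow> norm (c p) \<le> C" unfolding bounded_pos by auto
  show ?thesis
  proof (rule that[OF C(1) cc])
    fix h :: real and z :: complex assume h: "h > 0" and z: "z \<in> cball 0 r"
    then have zg: "(z, phi z) \<in> graph" by (auto simp: graph_def)
    define kap where "kap p = cnj (z - pt p) / of_real ((norm (z - pt p))\<^sup>2 + h\<^sup>2)" for p
    have ck: "continuous_on box (kern h (z, phi z))"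
      using continuous_on_compose2[OF continuous_kern[OF h] continuous_on_Pair[OF continuous_on_const continuous_on_id],
          of "(z, phi z)" box] zg by auto
    have ckap: "continuous_on box kap"
      unfolding kap_def using h
      by (intro continuous_intros continuous_pt)
         (metis add_nonneg_pos less_irrefl of_real_eq_0_iff zero_le_power2 zero_less_power)
    have parts: "integral box (\<lambda>p. c p * kap p) =
        integral box (\<lambda>p. 2 * A (of_real (fst p)) * B (of_real (snd p)) * of_real (poisson h z p))"
      unfolding c_def kap_def poisson_def pt_def
      using L0 h by (intro integral_dbar_by_parts A B cA cB zA zB) auto
    have "integral box (\<lambda>p. c p * kern h (z, phi z) p) - integral box (\<lambda>p. c p * kap p)
        = integral box (\<lambda>p. c p * kern h (z, phi z) p - c p * kap p)"
      by (intro Henstock_Kurzweil_Integration.integral_diff[symmetric] integrable_continuous continuous_intros cc ck ckap)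
    also have "norm \<dots> \<le> C * err h"
    proof (rule integral_norm_le_err[OF h z])
      show "continuous_on box (\<lambda>p. c p * kern h (z, phi z) p - c p * kap p)"
        by (intro continuous_intros cc ck ckap)
      fix p assume p: "p \<in> box"
      have "norm (kern h (z, phi z) p - kap p) \<le> poisson h z p * norm (z - pt p)"
        using regularised_kernel_diff[OF graph_increment[OF zg p], of "h\<^sup>2"] h
        by (simp add: kern_def kap_def poisson_def)
      then have "norm (c p) * norm (kern h (z, phi z) p - kap p) \<le> C * (poisson h z p * norm (z - pt p))"
        using C(1) C(2)[OF p] by (intro mult_mono) auto
      then show "norm (c p * kern h (z, phi z) p - c p * kap p) \<le> C * (poisson h z p * norm (z - pt p))"
        by (metis norm_mult right_diff_distrib)
    qed (use C in auto)
    finally show "norm (integral box (\<lambda>p. c p * kern h (z, phi z) p)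
         - integral box (\<lambda>p. 2 * A (of_real (fst p)) * B (of_real (snd p)) * of_real (poisson h z p))) \<le> C * err h"
      unfolding parts .
  qed
qed

text \<open>The weight vanishes on the border of the square, as the integration by parts demands;
  the leading 2 is the constant which that integration produces.\<close>

definition wt :: "real \<times> real \<Rightarrow> real" where
  "wt p = 2 * (L\<^sup>2 - (fst p)\<^sup>2) * (L\<^sup>2 - (snd p)\<^sup>2)"

lemma continuous_wt: "continuous_on S wt"
  unfolding wt_def by (intro continuous_intros)

lemma wt_bounds:
  assumes "p \<in> box"
  shows "0 \<le> wt p" "wt p \<le> 2 * L\<^sup>2 * L\<^sup>2"
proof -
  have "(fst p)\<^sup>2 \<le> L\<^sup>2" "(snd p)\<^sup>2 \<le> L\<^sup>2"
    using box_coords[OF assms] by (auto simp: pt_def abs_le_square_iff[symmetric])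
  then show "0 \<le> wt p" "wt p \<le> 2 * L\<^sup>2 * L\<^sup>2"
    unfolding wt_def by (auto intro!: mult_mono)
qed

text \<open>A bound uniform in \<open>h\<close> is enough because a quotient of two transforms is
  formed later. On a square of side \<open>h\<close> with a corner at \<open>z\<close>, the weight
  is at least \<open>2 k^2\<close> and \<open>poisson\<close> at least \<open>1 / (9 h^2)\<close>,
  so the area \<open>h^2\<close> cancels.\<close>

lemma mass_lower_bound:
  obtains \<mu> where "\<mu> > 0" "\<And>h z. 0 < h \<Longrightarrow> h \<le> (L - r) / 2 \<Longrightarrow> z \<in> cball 0 r \<Longrightarrow>
     integral box (\<lambda>p. wt p * poisson h z p) \<ge> \<mu>"
proof -
  \<comment> \<open>The midpoint of \<open>r\<close> and \<open>L\<close>: for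
    \<open>h \<le> (L - r) / 2\<close> the small square stays within coordinates of modulus
    \<open>\<rho> < L\<close>.\<close>
  define \<rho> where "\<rho> = (L + r) / 2"
  have rho: "0 \<le> \<rho>" "\<rho> < L" using r0 rL by (auto simp: \<rho>_def)
  define k where "k = L\<^sup>2 - \<rho>\<^sup>2"
  have k: "k > 0" unfolding k_def using rho by (simp add: power_strict_mono)
  show ?thesis
  proof (rule that[of "2 * k * k / 9"])
    show "2 * k * k / 9 > 0" using k by simp
    fix h z assume h: "0 < h" "h \<le> (L - r) / 2" and z: "z \<in> cball (0::complex) r"
    define sq where "sq = cbox (Re z, Im z) (Re z + h, Im z + h)"
    have zr: "\<bar>Re z\<bar> \<le> r" "\<bar>Im z\<bar> \<le> r"
      using z abs_Re_le_cmod[of z] abs_Im_le_cmod[of z] by auto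
    have pr: "\<bar>fst p\<bar> \<le> \<rho>" "\<bar>snd p\<bar> \<le> \<rho>" "\<bar>Re z - fst p\<bar> \<le> h" "\<bar>Im z - snd p\<bar> \<le> h" if "p \<in> sq" for p
      using that zr h rL by (cases p; auto simp: sq_def cbox_Pair_eq \<rho>_def abs_le_iff field_simps)+
    have sub: "sq \<subseteq> box"
    proof
      fix p assume "p \<in> sq"
      then show "p \<in> box" using pr[of p] rho by (cases p) (auto simp: cbox_Pair_eq)
    qed
    have "measure lborel sq = h * h"
      unfolding sq_def using h by (simp add: content_Pair)
    then have "2 * k * k / 9 = integral sq (\<lambda>p. 2 * k * k * (1 / (9 * h\<^sup>2)))"
      using h unfolding sq_def by (simp add: power2_eq_square field_simps)
    also have "\<dots> \<le> integral sq (\<lambda>p. wt p * poisson h z p)"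
      unfolding sq_def
    proof (intro integral_le integrable_continuous continuous_intros continuous_wt continuous_poisson h(1))
      fix p assume "p \<in> cbox (Re z, Im z) (Re z + h, Im z + h)"
      then have p: "p \<in> sq" by (simp add: sq_def)
      have "(fst p)\<^sup>2 \<le> \<rho>\<^sup>2" "(snd p)\<^sup>2 \<le> \<rho>\<^sup>2"
        using pr[OF p] rho by (auto simp: abs_le_square_iff[symmetric])
      then have 1: "2 * k * k \<le> wt p"
        unfolding wt_def k_def using k by (intro mult_mono) (auto simp: k_def)
      have "(Re z - fst p)\<^sup>2 \<le> h\<^sup>2" "(Im z - snd p)\<^sup>2 \<le> h\<^sup>2"
        using pr[OF p] h by (auto simp: abs_le_square_iff[symmetric])
      then have "(norm (z - pt p))\<^sup>2 + h\<^sup>2 \<le> 3 * h\<^sup>2"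
        unfolding cmod_power2 by (simp add: pt_def)
      then have "((norm (z - pt p))\<^sup>2 + h\<^sup>2)\<^sup>2 \<le> (3 * h\<^sup>2)\<^sup>2"
        by (intro power_mono) auto
      then have "h\<^sup>2 / (3 * h\<^sup>2)\<^sup>2 \<le> poisson h z p"
        unfolding poisson_def using h by (intro divide_left_mono) (auto intro!: mult_pos_pos zero_less_power add_nonneg_pos)
      moreover have "h\<^sup>2 / (3 * h\<^sup>2)\<^sup>2 = 1 / (9 * h\<^sup>2)"
        using h by (simp add: field_simps power2_eq_square)
      moreover have "0 \<le> wt p" using 1 k by (smt (verit) mult_pos_pos)
      ultimately show "2 * k * k * (1 / (9 * h\<^sup>2)) \<le> wt p * poisson h z p"
        using 1 by (intro mult_mono) auto
    qed
    also have "\<dots> \<le> integral box (\<lambda>p. wt p * poisson h z p)"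
      using sub wt_bounds(1) poisson_nonneg unfolding sq_def
      by (intro integral_subset_le integrable_continuous continuous_intros continuous_wt continuous_poisson h(1)) auto
    finally show "2 * k * k / 9 \<le> integral box (\<lambda>p. wt p * poisson h z p)" .
  qed
qed

lemma err_small:
  assumes "d > 0" "k > 0"
  obtains h where "0 < h" "h \<le> k" "err h \<le> d"
proof -
  have "(err \<longlongrightarrow> 0) (at_right 0)"
    unfolding err_def using arsinh_error_tendsto_0[OF L0] .
  then have "\<forall>\<^sub>F h in at_right 0. err h < d" using assms(1) order_tendstoD(2) by blast
  moreover have "\<forall>\<^sub>F h in at_right 0. h \<in> {0<..<k}" by (rule eventually_at_right_real[OF assms(2)])
  ultimately have "\<forall>\<^sub>F h in at_right 0. err h < d \<and> h \<in> {0<..<k}" by (rule eventually_conj)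
  then obtain h where "err h < d \<and> h \<in> {0<..<k}"
    using eventually_happens[of _ "at_right (0::real)"] by (auto simp: trivial_limit_at_right_real)
  then show ?thesis using that[of h] by auto
qed

text \<open>The quotient of the two transforms with densities \<open>s wt\<close> and \<open>wt\<close> tends to \<open>Re z\<close>.\<close>

theorem Re_in_polyclo_graph: "(\<lambda>x. of_real (Re (fst x))) \<in> polyclo graph"
proof -
  \<comment> \<open>The products \<open>2 A0 A0\<close> and \<open>2 A1 A0\<close> are the densities
    \<open>wt\<close> and \<open>s wt\<close>; all factors vanish at the ends of the
    interval.\<close>
  define A0 A1 :: "complex \<Rightarrow> complex" where "A0 = (\<lambda>S. of_real L ^ 2 - S\<^sup>2)" and "A1 = (\<lambda>S. S * (of_real L ^ 2 - S\<^sup>2))"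
  have dA0: "(A0 has_field_derivative (- 2 * s)) (at s)" for s
    unfolding A0_def by (auto intro!: derivative_eq_intros)
  have dA1: "(A1 has_field_derivative (of_real L ^ 2 - 3 * s\<^sup>2)) (at s)" for s
    unfolding A1_def by (auto intro!: derivative_eq_intros simp: power2_eq_square algebra_simps)
  obtain C0 c0 where C0: "C0 > 0" "continuous_on box c0"
    "\<And>h z. h > 0 \<Longrightarrow> z \<in> cball 0 r \<Longrightarrow>
       norm (integral box (\<lambda>p. c0 p * kern h (z, phi z) p)
         - integral box (\<lambda>p. 2 * A0 (of_real (fst p)) * A0 (of_real (snd p)) * of_real (poisson h z p))) \<le> C0 * err h"
    by (rule kern_integral_approx[OF dA0 dA0]) (auto simp: A0_def intro!: continuous_intros)
  obtain C1 c1 where C1: "C1 > 0" "continuous_on box c1"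
    "\<And>h z. h > 0 \<Longrightarrow> z \<in> cball 0 r \<Longrightarrow>
       norm (integral box (\<lambda>p. c1 p * kern h (z, phi z) p)
         - integral box (\<lambda>p. 2 * A1 (of_real (fst p)) * A0 (of_real (snd p)) * of_real (poisson h z p))) \<le> C1 * err h"
    by (rule kern_integral_approx[OF dA1 dA0]) (auto simp: A0_def A1_def intro!: continuous_intros)
  have w0: "2 * A0 (of_real (fst p)) * A0 (of_real (snd p)) * of_real (poisson h z p) = of_real (wt p * poisson h z p)" for p h z
    by (simp add: A0_def wt_def)
  have w1: "2 * A1 (of_real (fst p)) * A0 (of_real (snd p)) * of_real (poisson h z p) = of_real (fst p * (wt p * poisson h z p))" for p h z
    by (simp add: A0_def A1_def wt_def)
  obtain \<mu> where \<mu>: "\<mu> > 0" "\<And>h z. 0 < h \<Longrightarrow> h \<le> (L - r) / 2 \<Longrightarrow> z \<in> cball 0 r \<Longrightarrow>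
     integral box (\<lambda>p. wt p * poisson h z p) \<ge> \<mu>"
    using mass_lower_bound by blast
  \<comment> \<open>The summands are the error of \<open>I1\<close>, the cost of replacing
    \<open>s\<close> by \<open>Re z\<close> under the integral, and \<open>|Re z| \<le> L\<close>
    times the error of \<open>I0\<close>.\<close>
  define C where "C = C1 + 2 * L\<^sup>2 * L\<^sup>2 + L * C0"
  have C: "C > 0" unfolding C_def using C0 C1 L0 by (intro add_pos_nonneg) auto
  show ?thesis
  proof (rule polyclo_limit)
    fix e :: real assume e: "e > 0"
    \<comment> \<open>The first bound keeps \<open>Re I0 \<ge> \<mu> / 2\<close>, so that
      \<open>I0\<close> can be inverted; the second makes the numerator error
      \<open>e \<mu> / 2\<close>, hence the quotient error \<open>e\<close>.\<close>
    define d where "d = min (\<mu> / (2 * C0)) (e * \<mu> / (2 * C))"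
    have d: "d > 0" using \<mu> C C0 e by (simp add: d_def)
    obtain h where h: "0 < h" "h \<le> (L - r) / 2" "err h \<le> d"
      using err_small[OF d, of "(L - r) / 2"] rL by auto
    have err0: "C0 * err h \<le> \<mu> / 2" "C * err h \<le> e * \<mu> / 2"
    proof -
      have "C0 * err h \<le> C0 * (\<mu> / (2 * C0))" using h(3) C0 by (intro mult_left_mono) (auto simp: d_def)
      then show "C0 * err h \<le> \<mu> / 2" using C0 by simp
      have "C * err h \<le> C * (e * \<mu> / (2 * C))" using h(3) C by (intro mult_left_mono) (auto simp: d_def)
      then show "C * err h \<le> e * \<mu> / 2" using C by simp
    qed
    define I0 I1 where "I0 x = integral box (\<lambda>p. c0 p * kern h x p)" and "I1 x = integral box (\<lambda>p. c1 p * kern h x p)" for x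
    have Iin: "I0 \<in> polyclo graph" "I1 \<in> polyclo graph"
      unfolding I0_def I1_def using kern_integral_in_polyclo[OF h(1)] C0(2) C1(2) by auto
    have est: "Re (I0 x) \<ge> \<mu> / 2 \<and> norm (I1 x - of_real (Re (fst x)) * I0 x) \<le> e * \<mu> / 2" if x: "x \<in> graph" for x
    proof -
      obtain z where z: "z \<in> cball 0 r" and xz: "x = (z, phi z)" using x by (auto simp: graph_def)
      define N0 where "N0 = integral box (\<lambda>p. wt p * poisson h z p)"
      define N1 where "N1 = integral box (\<lambda>p. fst p * (wt p * poisson h z p))"
      have cw: "continuous_on box (\<lambda>p. wt p * poisson h z p)"
        by (intro continuous_intros continuous_wt continuous_poisson h)
      have N0: "integral box (\<lambda>p. complex_of_real (wt p * poisson h z p)) = of_real N0"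
        unfolding N0_def by (intro integral_unique has_integral_of_real integrable_integral integrable_continuous cw)
      have N1: "integral box (\<lambda>p. complex_of_real (fst p * (wt p * poisson h z p))) = of_real N1"
        unfolding N1_def by (intro integral_unique has_integral_of_real integrable_integral integrable_continuous cw continuous_intros)
      have a0: "norm (I0 x - of_real N0) \<le> C0 * err h"
        using C0(3)[OF h(1) z] unfolding w0 N0 I0_def xz .
      have a1: "norm (I1 x - of_real N1) \<le> C1 * err h"
        using C1(3)[OF h(1) z] unfolding w1 N1 I1_def xz .
      have "of_real N1 - of_real (Re z) * of_real N0
         = integral box (\<lambda>p. complex_of_real (fst p * (wt p * poisson h z p)) - of_real (Re z) * of_real (wt p * poisson h z p))"
        unfolding N0[symmetric] N1[symmetric]
        by (subst Henstock_Kurzweil_Integration.integral_diff) (auto intro!: integrable_continuous continuous_intros continuous_wt continuous_poisson h)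
      also have "norm \<dots> \<le> (2 * L\<^sup>2 * L\<^sup>2) * err h"
      proof (rule integral_norm_le_err[OF h(1) z])
        show "continuous_on box (\<lambda>p. complex_of_real (fst p * (wt p * poisson h z p)) - of_real (Re z) * of_real (wt p * poisson h z p))"
          by (intro continuous_intros cw)
        fix p assume p: "p \<in> box"
        \<comment> \<open>\<open>s - Re z = - Re (z - \<zeta>)\<close>, so the concentration of
          \<open>poisson\<close> at \<open>z\<close> controls the difference.\<close>
        have "complex_of_real (fst p * (wt p * poisson h z p)) - of_real (Re z) * of_real (wt p * poisson h z p)
          = of_real (- Re (z - pt p) * (wt p * poisson h z p))"
          by (simp add: pt_def algebra_simps)
        then have "norm (complex_of_real (fst p * (wt p * poisson h z p)) - of_real (Re z) * of_real (wt p * poisson h z p))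
          = \<bar>Re (z - pt p)\<bar> * (wt p * poisson h z p)"
          using wt_bounds(1)[OF p] poisson_nonneg[of h z p] by (simp only: norm_of_real abs_mult abs_minus_cancel abs_of_nonneg)
        also have "\<dots> \<le> norm (z - pt p) * ((2 * L\<^sup>2 * L\<^sup>2) * poisson h z p)"
          using wt_bounds[OF p] poisson_nonneg[of h z p] by (intro mult_mono abs_Re_le_cmod) auto
        finally show "norm (complex_of_real (fst p * (wt p * poisson h z p)) - of_real (Re z) * of_real (wt p * poisson h z p))
          \<le> 2 * L\<^sup>2 * L\<^sup>2 * (poisson h z p * norm (z - pt p))" by (simp add: mult_ac)
      qed simp
      finally have a2: "norm (of_real N1 - of_real (Re z) * of_real N0 :: complex) \<le> (2 * L\<^sup>2 * L\<^sup>2) * err h" .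
      have "I1 x - of_real (Re z) * I0 x = (I1 x - of_real N1) + (of_real N1 - of_real (Re z) * of_real N0) - of_real (Re z) * (I0 x - of_real N0)"
        by (simp add: algebra_simps)
      also have "norm \<dots> \<le> norm (I1 x - of_real N1) + norm (of_real N1 - of_real (Re z) * of_real N0 :: complex) + norm (of_real (Re z) * (I0 x - of_real N0))"
        by (meson add_right_mono norm_triangle_ineq norm_triangle_ineq4 order_trans)
      also have "norm (of_real (Re z) * (I0 x - of_real N0)) \<le> L * (C0 * err h)"
        unfolding norm_mult using a0 cball_coords[OF z] L0 by (intro mult_mono) auto
      finally have "norm (I1 x - of_real (Re z) * I0 x) \<le> C * err h"
        using a1 a2 by (simp add: C_def algebra_simps)
      moreover have "\<mu> \<le> N0" unfolding N0_def using \<mu>(2)[OF h(1,2) z] .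
      moreover have "\<bar>Re (I0 x) - N0\<bar> \<le> C0 * err h"
        using a0 abs_Re_le_cmod[of "I0 x - of_real N0"] by simp
      ultimately show ?thesis using err0 xz by auto
    qed
    have inv: "(\<lambda>x. inverse (I0 x)) \<in> polyclo graph"
      by (rule polyclo_inverse[OF Iin(1) bounded_graph, of "\<mu> / 2"]) (use est \<mu> in auto)
    show "\<exists>v\<in>polyclo graph. \<forall>x\<in>graph. norm (of_real (Re (fst x)) - v x) \<le> e"
    proof (intro bexI[of _ "\<lambda>x. I1 x * inverse (I0 x)"] ballI)
      show "(\<lambda>x. I1 x * inverse (I0 x)) \<in> polyclo graph"
        by (intro polyclo_mult Iin inv bounded_graph)
      fix x assume x: "x \<in> graph"
      have m: "\<mu> / 2 \<le> norm (I0 x)" using est[OF x] complex_Re_le_cmod order_trans by blast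
      then have ne: "I0 x \<noteq> 0" using \<mu> by auto
      have "of_real (Re (fst x)) - I1 x * inverse (I0 x) = - ((I1 x - of_real (Re (fst x)) * I0 x) / I0 x)"
        using ne by (simp add: field_simps)
      then have "norm (of_real (Re (fst x)) - I1 x * inverse (I0 x)) = norm (I1 x - of_real (Re (fst x)) * I0 x) / norm (I0 x)"
        by (simp add: norm_divide)
      also have "\<dots> \<le> (e * \<mu> / 2) / (\<mu> / 2)"
        using est[OF x] m \<mu> e by (intro frac_le) auto
      also have "\<dots> = e" using \<mu> by simp
      finally show "norm (of_real (Re (fst x)) - I1 x * inverse (I0 x)) \<le> e" .
    qed
  qed
qed

text \<open>\<open>Im z = - \<i> (z - Re z)\<close> follows at once, hence all polynomials in the
  two real coordinates, which are dense by Stone-Weierstrass. On a graph every function is a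
  function of the first coordinate.\<close>

corollary continuous_in_polyclo_graph:
  assumes "continuous_on (cball 0 r) f"
  shows "(\<lambda>x. f (fst x)) \<in> polyclo graph"
proof (rule polyclo_limit)
  fix e :: real assume "e > 0"
  obtain g where g: "polynomial_function g" "\<And>z. z \<in> cball 0 r \<Longrightarrow> norm (f z - g z) < e"
    using Stone_Weierstrass_polynomial_function[OF _ assms \<open>e > 0\<close>] by auto
  have Im: "(\<lambda>x. of_real (Im (fst x))) \<in> polyclo graph"
  proof -
    have "(\<lambda>x. - \<i> * (fst x - of_real (Re (fst x)))) \<in> polyclo graph"
      by (intro polyclo_cmult polyclo_diff polyclo_fst Re_in_polyclo_graph)
    then show ?thesis by (rule polyclo_cong) (simp add: complex_eq_iff)
  qed
  have real_poly: "(\<lambda>x. of_real (k (fst x))) \<in> polyclo graph" if "real_polynomial_function k" for k :: "complex \<Rightarrow> real"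
    using that
  proof induction
    case (linear k)
    have "k z = Re z * k 1 + Im z * k \<i>" for z
    proof -
      have "k (Re z *\<^sub>R 1 + Im z *\<^sub>R \<i>) = Re z * k 1 + Im z * k \<i>"
        using linear by (simp add: linear_simps)
      moreover have "Re z *\<^sub>R 1 + Im z *\<^sub>R \<i> = z" by (simp add: complex_eq_iff)
      ultimately show ?thesis by simp
    qed
    moreover have "(\<lambda>x. of_real (k 1) * of_real (Re (fst x)) + of_real (k \<i>) * of_real (Im (fst x))) \<in> polyclo graph"
      by (intro polyclo_add polyclo_cmult Re_in_polyclo_graph Im)
    ultimately show ?case
      by (elim polyclo_cong) (metis (no_types, lifting) mult.commute of_real_add of_real_mult)
  qed (auto intro: polyclo_const polyclo_add polyclo_mult bounded_graph)
  have "real_polynomial_function (\<lambda>z. Re (g z))" "real_polynomial_function (\<lambda>z. Im (g z))"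
    using g(1) bounded_linear_Re bounded_linear_Im unfolding polynomial_function_def o_def by blast+
  then have "(\<lambda>x. of_real (Re (g (fst x))) + \<i> * of_real (Im (g (fst x)))) \<in> polyclo graph"
    by (intro polyclo_add polyclo_cmult real_poly)
  then have "(\<lambda>x. g (fst x)) \<in> polyclo graph"
    by (rule polyclo_cong) (simp add: complex_eq_iff)
  then show "\<exists>v\<in>polyclo graph. \<forall>x\<in>graph. norm (f (fst x) - v x) \<le> e"
    by (intro bexI[of _ "\<lambda>x. g (fst x)"]) (use g(2) in \<open>auto simp: graph_def less_imp_le\<close>)
qed

end

subsection \<open>Holomorphic functions of two variables\<close>

lemma holomorphic2_on_has_derivative:
  assumes "holomorphic2_on F U" "w \<in> U"
  obtains a b where "(F has_derivative (\<lambda>v. a * fst v + b * snd v)) (at w)"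
  using assms unfolding holomorphic2_on_def by blast

lemma holomorphic2_on_continuous_on:
  assumes "holomorphic2_on F U"
  shows "continuous_on U F"
  using assms unfolding holomorphic2_on_def
  by (meson has_derivative_continuous continuous_at_imp_continuous_on)

lemma has_derivative_line:
  assumes "(F has_derivative (\<lambda>v. a * fst v + b * snd v)) (at (w1 + t * e1, w2 + t * e2))"
  shows "((\<lambda>t. F (w1 + t * e1, w2 + t * e2)) has_field_derivative a * e1 + b * e2) (at t)"
proof -
  have "((\<lambda>t. (w1 + t * e1, w2 + t * e2)) has_derivative (\<lambda>t. (t * e1, t * e2))) (at t)"
    by (auto intro!: derivative_eq_intros)
  from has_derivative_compose[OF this assms]
  show ?thesis
    unfolding has_field_derivative_def by (rule has_derivative_eq_rhs) (auto simp: fun_eq_iff algebra_simps)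
qed

text \<open>Cauchy's formula in the second variable writes \<open>F (u, v)\<close> as a circle
  integral of products of a holomorphic function of \<open>u\<close> and one of \<open>v\<close>.
  The one-variable calculus handles the factors, \<open>polyclo_integral\<close> the
  integral.\<close>

lemma polyclo_holomorphic2:
  assumes F: "holomorphic2_on F (ball 0 \<delta>)" and X: "compact X"
    and u: "u \<in> polyclo X" and v: "v \<in> polyclo X"
    and bd: "\<And>x. x \<in> X \<Longrightarrow> norm (u x) \<le> \<sigma>" "\<And>x. x \<in> X \<Longrightarrow> norm (v x) \<le> \<sigma>"
    and \<sigma>: "0 < \<sigma>" "2 * \<sigma> < \<delta>"
  shows "(\<lambda>x. F (u x, v x)) \<in> polyclo X"
proof -
  have bX: "bounded X" using X compact_imp_bounded by blast
  \<comment> \<open>Strictly between \<open>\<sigma>\<close> and \<open>\<delta> / 2\<close>: the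
    circle encloses the values of \<open>v\<close>, and the closed bidisc of radius
    \<open>\<tau>\<close> lies in the ball.\<close>
  define \<tau> where "\<tau> = (\<sigma> + \<delta> / 2) / 2"
  have \<tau>: "\<sigma> < \<tau>" "2 * \<tau> < \<delta>" "\<tau> > 0" using \<sigma> by (auto simp: \<tau>_def)
  have inball: "(z, w) \<in> ball 0 \<delta>" if "norm z \<le> \<tau>" "norm w \<le> \<tau>" for z w :: complex
    using norm_Pair_le[of z w] that \<tau> by (simp del: norm_Pair_le)
  have dF: "\<exists>a b. (F has_derivative (\<lambda>v. a * fst v + b * snd v)) (at (z, w))" if "norm z \<le> \<tau>" "norm w \<le> \<tau>" for z w
    using holomorphic2_on_has_derivative[OF F inball[OF that]] by blast
  define \<gamma> where "\<gamma> = circlepath 0 \<tau>"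
  have \<gamma>n: "norm (\<gamma> t) = \<tau>" for t
    using \<tau> by (simp add: \<gamma>_def circlepath norm_mult norm_exp_eq_Re)
  have \<gamma>d: "vector_derivative \<gamma> (at t within {0..1}) = 2 * of_real pi * \<i> * \<gamma> t" if "t \<in> {0..1}" for t
  proof -
    have "vector_derivative \<gamma> (at t within {0..1}) = 2 * of_real pi * \<i> * \<tau> * exp (2 * of_real pi * \<i> * t)"
      using that unfolding \<gamma>_def by (subst vector_derivative_circlepath01) auto
    then show ?thesis by (simp add: \<gamma>_def circlepath)
  qed
  have \<gamma>c: "continuous_on S \<gamma>" for S
    unfolding \<gamma>_def circlepath by (intro continuous_intros)
  have hol1: "(\<lambda>z. F (z, w)) holomorphic_on ball 0 \<tau>" if nw: "norm w \<le> \<tau>" for w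
    unfolding holomorphic_on_open[OF open_ball]
  proof
    fix z :: complex assume "z \<in> ball 0 \<tau>"
    then obtain a b where "(F has_derivative (\<lambda>v. a * fst v + b * snd v)) (at (z, w))"
      using dF[of z w] nw by auto
    then show "\<exists>f'. ((\<lambda>z. F (z, w)) has_field_derivative f') (at z)"
      using has_derivative_line[of F a b 0 z 1 w 0] by auto
  qed
  have hol2: "(\<lambda>w. F (z, w)) holomorphic_on ball 0 \<tau>" if nz: "norm z \<le> \<tau>" for z
    unfolding holomorphic_on_open[OF open_ball]
  proof
    fix w :: complex assume "w \<in> ball 0 \<tau>"
    then obtain a b where "(F has_derivative (\<lambda>v. a * fst v + b * snd v)) (at (z, w))"
      using dF[of z w] nz by auto
    then show "\<exists>f'. ((\<lambda>w. F (z, w)) has_field_derivative f') (at w)"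
      using has_derivative_line[of F a b z w 0 0 1] by auto
  qed
  have cF: "continuous_on (ball 0 \<delta>) F" using holomorphic2_on_continuous_on[OF F] .
  \<comment> \<open>Since \<open>\<gamma>' = 2 pi \<i> \<gamma>\<close>, the contour integral
    becomes an integral over \<open>[0, 1]\<close> with the factor
    \<open>\<gamma> / (\<gamma> - w)\<close>.\<close>
  have cauchy: "((\<lambda>t. F (z, \<gamma> t) * (\<gamma> t / (\<gamma> t - w))) has_integral F (z, w)) {0..1}"
    if "norm z \<le> \<sigma>" "norm w \<le> \<sigma>" for z w
  proof -
    have "continuous_on (cball 0 \<tau>) (\<lambda>w. F (z, w))"
      by (intro continuous_on_compose2[OF cF] continuous_intros) (use inball that \<tau> in auto)
    then have "((\<lambda>u. F (z, u) / (u - w)) has_contour_integral (2 * of_real pi * \<i> * F (z, w))) (circlepath 0 \<tau>)"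
      using that \<tau> by (intro Cauchy_integral_circlepath hol2) auto
    then have "((\<lambda>t. F (z, \<gamma> t) / (\<gamma> t - w) * (2 * of_real pi * \<i> * \<gamma> t)) has_integral 2 * of_real pi * \<i> * F (z, w)) {0..1}"
      unfolding has_contour_integral_def \<gamma>_def[symmetric]
      by (rule has_integral_eq[rotated]) (simp only: \<gamma>d)
    from has_integral_mult_right[OF this, of "1 / (2 * of_real pi * \<i>)"]
    show ?thesis by (simp add: field_simps)
  qed
  have "(\<lambda>x. integral {0..1} (\<lambda>t. F (u x, \<gamma> t) * (\<gamma> t / (\<gamma> t - v x)))) \<in> polyclo X"
  proof (rule polyclo_integral[OF X])
    have cu: "continuous_on (X \<times> {0..1}) (\<lambda>y. u (fst y))" and cv: "continuous_on (X \<times> {0..1}) (\<lambda>y. v (fst y))"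
      by (intro continuous_on_compose2[OF polyclo_continuous_on[OF u]]
                continuous_on_compose2[OF polyclo_continuous_on[OF v]] continuous_intros; auto)+
    have cg: "continuous_on (X \<times> {0..1::real}) (\<lambda>y. \<gamma> (snd y))"
      by (intro continuous_on_compose2[OF \<gamma>c[of UNIV]] continuous_intros) auto
    have "continuous_on (X \<times> {0..1}) (\<lambda>y. F (u (fst y), \<gamma> (snd y)))"
    proof (intro continuous_on_compose2[OF cF] continuous_intros cu cg)
      have "(u x, \<gamma> t) \<in> ball 0 \<delta>" if "x \<in> X" for x t
        by (rule inball) (use bd(1)[OF that] \<tau>(1) \<gamma>n in auto)
      then show "(\<lambda>y. (u (fst y), \<gamma> (snd y))) ` (X \<times> {0..1}) \<subseteq> ball 0 \<delta>"
        by (auto simp del: mem_ball mem_ball_0)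
    qed
    moreover have "\<gamma> t - v x \<noteq> 0" if "x \<in> X" for x t
      using bd(2)[OF that] \<gamma>n[of t] \<tau> by auto
    ultimately show "continuous_on (X \<times> {0..1}) (\<lambda>(x, t). F (u x, \<gamma> t) * (\<gamma> t / (\<gamma> t - v x)))"
      unfolding split_beta by (intro continuous_intros cv cg) auto
    fix t :: real assume "t \<in> {0..1}"
    have "(\<lambda>x. F (u x, \<gamma> t)) \<in> polyclo X"
      by (rule polyclo_holomorphic[OF u bX hol1 \<tau>(1)]) (use \<gamma>n bd in auto)
    moreover have "(\<lambda>x. \<gamma> t / (\<gamma> t - v x)) \<in> polyclo X"
      by (rule polyclo_holomorphic[OF v bX, of "\<lambda>w. \<gamma> t / (\<gamma> t - w)" 0 \<tau> \<sigma>])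
         (use \<gamma>n[of t] bd \<tau> in \<open>auto intro!: holomorphic_intros\<close>)
    ultimately show "(\<lambda>x. F (u x, \<gamma> t) * (\<gamma> t / (\<gamma> t - v x))) \<in> polyclo X"
      by (rule polyclo_mult[OF _ _ bX])
  qed simp
  then show ?thesis
    by (rule polyclo_cong) (use cauchy bd in \<open>auto intro!: integral_unique\<close>)
qed

text \<open>The partial derivatives are continuous by Cauchy's estimate for differences of translates.\<close>

lemma holomorphic2_directional_continuous:
  assumes F: "holomorphic2_on F U" and e: "norm e1 \<le> 1" "norm e2 \<le> 1"
    and d: "\<And>w. w \<in> U \<Longrightarrow> (F has_derivative (\<lambda>v. a w * fst v + b w * snd v)) (at w)"
  shows "continuous_on U (\<lambda>w. a w * e1 + b w * e2)"
  unfolding continuous_on_iff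
proof (intro ballI allI impI)
  fix w :: "complex \<times> complex" and \<epsilon> :: real assume w: "w \<in> U" and \<epsilon>: "\<epsilon> > 0"
  have "open U" using F by (simp add: holomorphic2_on_def)
  then obtain R where R: "R > 0" "cball w R \<subseteq> U" using w open_contains_cball by blast
  \<comment> \<open>A translate of a point within \<open>\<rho>\<close> of \<open>w\<close> along
    the direction, with \<open>|t| \<le> \<rho>\<close>, moves at most \<open>3 \<rho> < R\<close>
    away from \<open>w\<close>.\<close>
  define \<rho> where "\<rho> = R / 4"
  have \<rho>: "\<rho> > 0" using R by (simp add: \<rho>_def)
  have "uniformly_continuous_on (cball w R) F"
    by (intro compact_uniformly_continuous continuous_on_subset[OF holomorphic2_on_continuous_on[OF F] R(2)]) auto
  then obtain \<eta> where \<eta>: "\<eta> > 0" "\<And>x y. x \<in> cball w R \<Longrightarrow> y \<in> cball w R \<Longrightarrow> dist y x < \<eta> \<Longrightarrow> dist (F y) (F x) < \<epsilon> * \<rho> / 2"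
    unfolding uniformly_continuous_on_def using \<epsilon> \<rho> by (metis half_gt_zero mult_pos_pos)
  define tr where "tr y t = (fst y + t * e1, snd y + t * e2)" for y :: "complex \<times> complex" and t
  have tr_dist: "dist (tr y t) (tr w t) = dist y w" for y t
    by (simp add: tr_def dist_prod_def dist_norm)
  have tr_in: "tr y t \<in> cball w R" if "dist y w \<le> \<rho>" "norm t \<le> \<rho>" for y t
  proof -
    have "dist (tr y t) y = norm (t * e1, t * e2)"
      by (simp add: tr_def dist_prod_def dist_norm norm_prod_def)
    also have "\<dots> \<le> norm t * norm e1 + norm t * norm e2"
      by (metis norm_Pair_le norm_mult)
    also have "\<dots> \<le> \<rho> * 1 + \<rho> * 1"
      using that e \<rho> by (intro add_mono mult_mono) auto
    finally have "dist (tr y t) w \<le> 2 * \<rho> + \<rho>"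
      using dist_triangle[of "tr y t" w y] that by linarith
    then show ?thesis using R by (simp add: \<rho>_def dist_commute)
  qed
  have tr_deriv: "((\<lambda>t. F (tr y t)) has_field_derivative a (tr y t) * e1 + b (tr y t) * e2) (at t)"
    if "dist y w \<le> \<rho>" "norm t \<le> \<rho>" for y t
    unfolding tr_def using d[of "tr y t"] tr_in[OF that] R(2) unfolding tr_def
    by (intro has_derivative_line) auto
  show "\<exists>\<delta>>0. \<forall>y\<in>U. dist y w < \<delta> \<longrightarrow> dist (a y * e1 + b y * e2) (a w * e1 + b w * e2) < \<epsilon>"
  proof (intro exI[of _ "min \<rho> \<eta>"] conjI ballI impI)
    fix y assume "y \<in> U" and y: "dist y w < min \<rho> \<eta>"
    \<comment> \<open>\<open>F\<close> along two parallel discs, subtracted: uniform continuity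
      bounds \<open>D\<close> by \<open>\<epsilon> \<rho> / 2\<close>, and Cauchy's estimate bounds
      \<open>D'(0)\<close>, the difference of the directional derivatives, by
      \<open>\<epsilon> / 2\<close>.\<close>
    define D where "D t = F (tr y t) - F (tr w t)" for t
    have dD: "(D has_field_derivative (a (tr y t) * e1 + b (tr y t) * e2) - (a (tr w t) * e1 + b (tr w t) * e2)) (at t)"
      if "norm t \<le> \<rho>" for t
      unfolding D_def using that y \<rho> by (intro DERIV_diff tr_deriv) auto
    have "norm ((deriv ^^ 1) D 0) \<le> fact 1 * (\<epsilon> * \<rho> / 2) / \<rho> ^ 1"
    proof (rule Cauchy_inequality)
      show "D holomorphic_on ball 0 \<rho>"
        unfolding holomorphic_on_open[OF open_ball]
      proof
        fix t :: complex assume "t \<in> ball 0 \<rho>"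
        then have "norm t \<le> \<rho>" by simp
        from dD[OF this] show "\<exists>f'. (D has_field_derivative f') (at t)" by blast
      qed
      show "continuous_on (cball 0 \<rho>) D"
        by (intro continuous_at_imp_continuous_on ballI DERIV_isCont[OF dD]) auto
      fix t :: complex assume "norm (0 - t) = \<rho>"
      then show "norm (D t) \<le> \<epsilon> * \<rho> / 2"
        using \<eta>(2)[of "tr w t" "tr y t"] tr_in[of y t] tr_in[of w t] tr_dist[of y t] y \<rho>
        by (auto simp: D_def dist_norm less_imp_le)
    qed (use \<rho> in auto)
    moreover have "deriv D 0 = (a y * e1 + b y * e2) - (a w * e1 + b w * e2)"
      using DERIV_imp_deriv[OF dD[of 0]] \<rho> by (simp add: tr_def)
    ultimately show "dist (a y * e1 + b y * e2) (a w * e1 + b w * e2) < \<epsilon>"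
      using \<rho> \<epsilon> by (simp add: dist_norm)
  qed (use \<rho> \<eta> in auto)
qed

text \<open>\<open>holomorphic2_on\<close> asks for a derivative at each point. Continuity of its
  coefficients serves to see that compositions are of class C1 and that the derivative is small near
  0.\<close>

lemma holomorphic2_continuous_partials:
  assumes F: "holomorphic2_on F U"
  obtains a b where "continuous_on U a" "continuous_on U b"
    "\<And>w. w \<in> U \<Longrightarrow> (F has_derivative (\<lambda>v. a w * fst v + b w * snd v)) (at w)"
proof -
  have "\<forall>w\<in>U. \<exists>ab. (F has_derivative (\<lambda>v. fst ab * fst v + snd ab * snd v)) (at w)"
    using F unfolding holomorphic2_on_def by auto
  then obtain ab where ab: "\<And>w. w \<in> U \<Longrightarrow> (F has_derivative (\<lambda>v. fst (ab w) * fst v + snd (ab w) * snd v)) (at w)"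
    by metis
  show ?thesis
    using holomorphic2_directional_continuous[OF F, of 1 0 "\<lambda>w. fst (ab w)" "\<lambda>w. snd (ab w)", OF _ _ ab]
      holomorphic2_directional_continuous[OF F, of 0 1 "\<lambda>w. fst (ab w)" "\<lambda>w. snd (ab w)", OF _ _ ab]
    by (intro that[OF _ _ ab]) auto
qed

lemma lipschitz_on_ball_if_derivative_bounded:
  fixes f :: "'a::{real_normed_vector, perfect_space} \<Rightarrow> 'b::real_normed_vector"
  assumes "\<And>x. x \<in> ball 0 \<delta> \<Longrightarrow> (f has_derivative f' x) (at x)"
    and "\<And>x v. x \<in> ball 0 \<delta> \<Longrightarrow> norm (f' x v) \<le> \<epsilon> * norm v"
    and "x \<in> ball 0 \<delta>" "y \<in> ball 0 \<delta>"
  shows "norm (f x - f y) \<le> \<epsilon> * norm (x - y)"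
proof (rule differentiable_bound[of "ball 0 \<delta>" f f'])
  fix x :: 'a assume x: "x \<in> ball 0 \<delta>"
  show "(f has_derivative f' x) (at x within ball 0 \<delta>)"
    using assms(1)[OF x] by (rule has_derivative_at_withinI)
  show "onorm (f' x) \<le> \<epsilon>" by (rule onorm_le) (rule assms(2)[OF x])
qed (use assms in auto)

text \<open>The cubic bound forces the derivative at 0 to vanish; continuity of the partial
  derivatives and the mean value inequality do the rest.\<close>

lemma holomorphic2_small_lipschitz:
  assumes F: "holomorphic2_on F (ball 0 R)" and R: "R > 0"
    and cubic: "\<And>w. w \<in> ball 0 R \<Longrightarrow> norm (F w) \<le> C * norm w ^ 3" and \<epsilon>: "\<epsilon> > 0"
  obtains \<delta> where "\<delta> > 0" "\<delta> \<le> R"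
    "\<And>x y. x \<in> ball 0 \<delta> \<Longrightarrow> y \<in> ball 0 \<delta> \<Longrightarrow> norm (F x - F y) \<le> \<epsilon> * norm (x - y)"
proof -
  obtain a b where c: "continuous_on (ball 0 R) a" "continuous_on (ball 0 R) b"
    and d: "\<And>w. w \<in> ball 0 R \<Longrightarrow> (F has_derivative (\<lambda>v. a w * fst v + b w * snd v)) (at w)"
    using holomorphic2_continuous_partials[OF F] by metis
  have F0: "F 0 = 0" using cubic[of 0] R by simp
  have "(F has_derivative (\<lambda>v. 0)) (at 0)"
    unfolding has_derivative_at
  proof (intro conjI bounded_linear_zero, rule Lim_null_comparison)
    show "\<forall>\<^sub>F h in at 0. norm (norm (F (0 + h) - F 0 - 0) / norm h) \<le> C * norm h ^ 2"
      unfolding eventually_at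
    proof (intro exI[of _ R] conjI ballI impI R)
      fix h :: "complex \<times> complex" assume "h \<noteq> 0 \<and> dist h 0 < R"
      then show "norm (norm (F (0 + h) - F 0 - 0) / norm h) \<le> C * norm h ^ 2"
        using cubic[of h] F0 by (simp add: divide_le_eq power3_eq_cube power2_eq_square mult.assoc)
    qed
    show "((\<lambda>h. C * norm h ^ 2) \<longlongrightarrow> 0) (at 0)"
      by (auto intro!: tendsto_eq_intros)
  qed
  then have z: "(\<lambda>v. a 0 * fst v + b 0 * snd v) = (\<lambda>v. 0)"
    using has_derivative_unique[OF d[of 0]] R by auto
  have a0: "a 0 = 0" using fun_cong[OF z, of "(1,0)"] by simp
  have b0: "b 0 = 0" using fun_cong[OF z, of "(0,1)"] by simp
  have "isCont (\<lambda>w. norm (a w) + norm (b w)) 0"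
    using c R by (intro continuous_intros) (auto simp: continuous_on_eq_continuous_at)
  then have "((\<lambda>w. norm (a w) + norm (b w)) \<longlongrightarrow> 0) (at 0)"
    using a0 b0 by (simp add: isCont_def)
  then have "\<forall>\<^sub>F w in at 0. norm (a w) + norm (b w) < \<epsilon>" using \<epsilon> order_tendstoD(2) by blast
  then obtain \<delta>0 where \<delta>0: "\<delta>0 > 0" "\<And>w. w \<noteq> 0 \<Longrightarrow> dist w 0 < \<delta>0 \<Longrightarrow> norm (a w) + norm (b w) < \<epsilon>"
    unfolding eventually_at by auto
  have small: "norm (a w) + norm (b w) \<le> \<epsilon>" if "norm w < \<delta>0" for w
    using \<delta>0(2)[of w] that a0 b0 \<epsilon> by (cases "w = 0") auto
  show ?thesis
  proof (rule that[of "min \<delta>0 R"])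
    fix x y :: "complex \<times> complex" assume xy: "x \<in> ball 0 (min \<delta>0 R)" "y \<in> ball 0 (min \<delta>0 R)"
    show "norm (F x - F y) \<le> \<epsilon> * norm (x - y)"
    proof (rule lipschitz_on_ball_if_derivative_bounded[OF _ _ xy])
      fix w v :: "complex \<times> complex" assume w: "w \<in> ball 0 (min \<delta>0 R)"
      then show "(F has_derivative (\<lambda>v. a w * fst v + b w * snd v)) (at w)" by (intro d) auto
      have "norm (a w * fst v + b w * snd v) \<le> norm (a w) * norm (fst v) + norm (b w) * norm (snd v)"
        by (metis norm_mult norm_triangle_ineq)
      also have "\<dots> \<le> norm (a w) * norm v + norm (b w) * norm v"
        by (intro add_mono mult_left_mono) (use norm_fst_le[of "fst v" "snd v"] norm_snd_le[of "snd v" "fst v"] in auto)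
      also have "\<dots> = (norm (a w) + norm (b w)) * norm v" by (simp add: algebra_simps)
      also have "\<dots> \<le> \<epsilon> * norm v"
        using small[of w] w by (intro mult_right_mono) auto
      finally show "norm (a w * fst v + b w * snd v) \<le> \<epsilon> * norm v" .
    qed
  qed (use \<delta>0 R in auto)
qed

subsection \<open>Straightening the holomorphic perturbation\<close>

text \<open>For fixed \<open>x\<close> the map \<open>w \<mapsto> snd x - F (fst x, w)\<close> is a
  contraction with constant 1/4, and \<open>G x\<close> is its fixed point. The iterates from 0 are
  approximable by \<open>polyclo_holomorphic2\<close> and converge geometrically, uniformly on the
  bidisc. Holomorphy comes from differentiating the inverse of
  \<open>(z, w) \<mapsto> (z, w + F (z, w))\<close>.\<close>

lemma straightening:
  assumes F: "holomorphic2_on F (ball 0 R)" and R: "R > 0"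
    and cubic: "\<And>w. w \<in> ball 0 R \<Longrightarrow> norm (F w) \<le> C * norm w ^ 3"
  obtains \<rho> G where "\<rho> > 0" "G (0, 0) = 0"
    "\<forall>X. compact X \<and> X \<subseteq> cball 0 \<rho> \<times> cball 0 \<rho> \<longrightarrow> G \<in> polyclo X"
    "\<forall>x \<in> cball 0 \<rho> \<times> cball 0 \<rho>. G x + F (fst x, G x) = snd x"
    "holomorphic2_on G (ball 0 \<rho> \<times> ball 0 \<rho>)"
proof -
  obtain \<delta> where \<delta>: "\<delta> > 0" "\<delta> \<le> R"
    and lip: "\<And>x y. x \<in> ball 0 \<delta> \<Longrightarrow> y \<in> ball 0 \<delta> \<Longrightarrow> norm (F x - F y) \<le> (1/4) * norm (x - y)"
    using holomorphic2_small_lipschitz[OF F R cubic, of "1/4"] by (metis zero_less_divide_1_iff zero_less_numeral)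
  have F0: "F 0 = 0" using cubic[of 0] R by simp
  \<comment> \<open>The fixed point is sought in the disc of radius \<open>4 \<rho>\<close>, and
    \<open>polyclo_holomorphic2\<close> with \<open>\<sigma> = 4 \<rho>\<close> asks for
    \<open>8 \<rho> < \<delta>\<close>.\<close>
  define \<rho> where "\<rho> = \<delta> / 16"
  have \<rho>: "\<rho> > 0" "\<delta> = 16 * \<rho>" using \<delta> by (auto simp: \<rho>_def)
  let ?P = "cball (0::complex) \<rho> \<times> cball (0::complex) \<rho>"
  have inb: "(z, w) \<in> ball 0 \<delta>" if "norm z \<le> \<rho>" "norm w \<le> 4 * \<rho>" for z w :: complex
    using norm_Pair_le[of z w] that \<rho> by (simp del: norm_Pair_le)
  have lip2: "norm (F (z, w) - F (z, w')) \<le> (1/4) * norm (w - w')"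
    if "norm z \<le> \<rho>" "norm w \<le> 4 * \<rho>" "norm w' \<le> 4 * \<rho>" for z w w'
    using lip[OF inb inb, of z w z w'] that by (simp add: norm_Pair)
  have bound: "norm (F (z, w)) \<le> (5/4) * \<rho>" if "norm z \<le> \<rho>" "norm w \<le> 4 * \<rho>" for z w
    using lip[OF inb[OF that], of 0] F0 \<delta> norm_Pair_le[of z w] that by simp
  define T where "T x w = snd x - F (fst x, w)" for x w
  have Tmap: "norm (T x w) \<le> 4 * \<rho>" if "x \<in> ?P" "norm w \<le> 4 * \<rho>" for x w
    using bound[of "fst x" w] that norm_triangle_ineq4[of "snd x" "F (fst x, w)"] \<rho>
    by (cases x) (auto simp: T_def)
  have Tcon: "norm (T x w - T x w') \<le> (1/4) * norm (w - w')" if "x \<in> ?P" "norm w \<le> 4 * \<rho>" "norm w' \<le> 4 * \<rho>" for x w w'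
    using lip2[of "fst x" w' w] that by (cases x) (auto simp: T_def norm_minus_commute)
  have "\<exists>!w. w \<in> cball 0 (4 * \<rho>) \<and> T x w = w" if "x \<in> ?P" for x
    by (rule Banach_fix[of _ "1/4"])
       (use Tmap[OF that] Tcon[OF that] \<rho> in \<open>auto simp: dist_norm complete_eq_closed\<close>)
  then have "\<forall>x\<in>?P. \<exists>w. norm w \<le> 4 * \<rho> \<and> T x w = w"
    unfolding mem_cball dist_0_norm by blast
  then obtain G where G: "\<And>x. x \<in> ?P \<Longrightarrow> norm (G x) \<le> 4 * \<rho>" "\<And>x. x \<in> ?P \<Longrightarrow> T x (G x) = G x"
    by metis
  have eq: "G x + F (fst x, G x) = snd x" if "x \<in> ?P" for x
    using G(2)[OF that] by (simp add: T_def algebra_simps)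
  have poly: "G \<in> polyclo X" if X: "compact X" "X \<subseteq> ?P" for X
  proof -
    define I where "I n x = (T x ^^ n) 0" for n x
    have Ib: "norm (I n x) \<le> 4 * \<rho>" if "x \<in> X" for n x
      using that X(2) \<rho> by (induction n) (auto simp: I_def intro!: Tmap)
    have Iin: "I n \<in> polyclo X" for n
    proof (induction n)
      case 0
      have "(\<lambda>x. 0) \<in> polyclo X" by (rule polyclo_const)
      then show ?case by (rule polyclo_cong) (simp add: I_def)
    next
      case (Suc n)
      have "holomorphic2_on F (ball 0 \<delta>)"
        using F \<delta> unfolding holomorphic2_on_def by auto
      then have "(\<lambda>x. F (fst x, I n x)) \<in> polyclo X"
        by (rule polyclo_holomorphic2[OF _ X(1) polyclo_fst Suc, where \<sigma> = "4 * \<rho>"])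
           (use X(2) Ib \<rho> in force)+
      then have "(\<lambda>x. snd x - F (fst x, I n x)) \<in> polyclo X"
        by (intro polyclo_diff polyclo_snd)
      then show ?case by (rule polyclo_cong) (simp add: I_def T_def)
    qed
    have conv: "norm (G x - I n x) \<le> (1/4) ^ n * (4 * \<rho>)" if "x \<in> X" for n x
    proof (induction n)
      case 0
      show ?case using G(1)[of x] that X(2) by (auto simp: I_def)
    next
      case (Suc n)
      have xP: "x \<in> ?P" using that X(2) by auto
      have "norm (G x - I (Suc n) x) = norm (T x (G x) - T x (I n x))"
        using G(2)[OF xP] by (simp add: I_def)
      also have "\<dots> \<le> (1/4) * norm (G x - I n x)"
        by (rule Tcon[OF xP G(1)[OF xP] Ib[OF that]])
      finally show ?case using Suc by simp
    qed
    show ?thesis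
    proof (rule polyclo_limit)
      fix e :: real assume "e > 0"
      have "(\<lambda>n. (1/4) ^ n * (4 * \<rho>)) \<longlonglongrightarrow> 0 * (4 * \<rho>)"
        by (intro tendsto_mult tendsto_const LIMSEQ_realpow_zero) auto
      then have "\<forall>\<^sub>F n in sequentially. (1/4) ^ n * (4 * \<rho>) < e"
        using \<open>e > 0\<close> order_tendstoD(2) by fastforce
      then obtain n where "(1/4) ^ n * (4 * \<rho>) < e" by (auto simp: eventually_sequentially)
      then show "\<exists>v\<in>polyclo X. \<forall>x\<in>X. norm (G x - v x) \<le> e"
        using conv[of _ n] by (intro bexI[OF _ Iin[of n]]) (meson less_imp_le order_trans)
    qed
  qed
  have contG: "continuous_on ?P G"
    by (rule polyclo_continuous_on[OF poly]) (auto intro: compact_Times)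
  have hol: "holomorphic2_on G (ball 0 \<rho> \<times> ball 0 \<rho>)"
    unfolding holomorphic2_on_def
  proof (intro conjI ballI)
    show op: "open (ball (0::complex) \<rho> \<times> ball (0::complex) \<rho>)" by (intro open_Times) auto
    fix y assume y: "y \<in> ball (0::complex) \<rho> \<times> ball (0::complex) \<rho>"
    then have yP: "y \<in> ?P" by auto
    have gy: "(fst y, G y) \<in> ball 0 \<delta>" using yP G(1)[OF yP] by (intro inb) auto
    then have "(fst y, G y) \<in> ball 0 R" using \<delta>(2) by simp
    then obtain a b where d: "(F has_derivative (\<lambda>v. a * fst v + b * snd v)) (at (fst y, G y))"
      by (rule holomorphic2_on_has_derivative[OF F])
    \<comment> \<open>The partial derivative in \<open>w\<close> inherits the Lipschitz constant
      1/4, which makes \<open>1 + b\<close> invertible.\<close>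
    have b: "norm b \<le> 1/4"
    proof -
      have "((\<lambda>t. F (fst y, G y + t)) has_field_derivative b) (at 0)"
        using has_derivative_line[of F a b "fst y" 0 0 "G y" 1] d by simp
      then have "((\<lambda>h. (F (fst y, G y + h) - F (fst y, G y)) / h) \<longlongrightarrow> b) (at 0)"
        by (simp add: DERIV_def)
      then have lim: "((\<lambda>h. norm ((F (fst y, G y + h) - F (fst y, G y)) / h)) \<longlongrightarrow> norm b) (at 0)"
        by (rule tendsto_norm)
      have "isCont (\<lambda>h. (fst y, G y + h)) 0" by (intro continuous_intros)
      then have "\<forall>\<^sub>F h in at 0. (fst y, G y + h) \<in> ball 0 \<delta>"
        using gy by (intro topological_tendstoD[of _ "(fst y, G y + 0)"]) (auto simp: isCont_def)
      then have "\<forall>\<^sub>F h in at 0. norm ((F (fst y, G y + h) - F (fst y, G y)) / h) \<le> 1/4"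
      proof (rule eventually_mono)
        fix h assume "(fst y, G y + h) \<in> ball 0 \<delta>"
        from lip[OF this gy] show "norm ((F (fst y, G y + h) - F (fst y, G y)) / h) \<le> 1/4"
          by (cases "h = 0") (auto simp: norm_divide divide_le_eq norm_Pair)
      qed
      then show ?thesis by (intro tendsto_upperbound[OF lim]) auto
    qed
    have b1: "1 + b \<noteq> 0"
    proof
      assume "1 + b = 0"
      then have "b = - 1" by (simp add: add_eq_0_iff)
      then show False using b by simp
    qed
    define \<Psi> where "\<Psi> p = (fst p, snd p + F p)" for p
    define \<Gamma> where "\<Gamma> p = (fst p, G p)" for p
    \<comment> \<open>\<open>\<Gamma>\<close> is a right inverse of \<open>\<Psi>\<close>, and its
      continuity is known from the uniform approximation; the rule for inverse maps then gives
      differentiability.\<close>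
    have "(\<Gamma> has_derivative (\<lambda>v. (fst v, (snd v - a * fst v) / (1 + b)))) (at y)"
    proof (rule has_derivative_inverse_basic[where T = "ball 0 \<rho> \<times> ball 0 \<rho>" and f = \<Psi>
          and f' = "\<lambda>v. (fst v, snd v + (a * fst v + b * snd v))"])
      have "(F has_derivative (\<lambda>v. a * fst v + b * snd v)) (at (\<Gamma> y))" using d by (simp add: \<Gamma>_def)
      then show "(\<Psi> has_derivative (\<lambda>v. (fst v, snd v + (a * fst v + b * snd v)))) (at (\<Gamma> y))"
        unfolding \<Psi>_def by (auto intro!: derivative_intros)
      show "bounded_linear (\<lambda>v. (fst v, (snd v - a * fst v) / (1 + b)))"
        by (intro bounded_linear_Pair bounded_linear_fst bounded_linear_divide bounded_linear_sub
             bounded_linear_snd bounded_linear_const_mult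
             bounded_linear_compose[OF bounded_linear_divide])
      show "(\<lambda>v. (fst v, (snd v - a * fst v) / (1 + b))) \<circ> (\<lambda>v. (fst v, snd v + (a * fst v + b * snd v))) = id"
        using b1 by (auto simp: fun_eq_iff field_simps)
      have "continuous (at y) G"
      proof -
        have "continuous_on (ball 0 \<rho> \<times> ball 0 \<rho>) G"
          by (rule continuous_on_subset[OF contG]) auto
        then show ?thesis using y op continuous_on_eq_continuous_at by blast
      qed
      then show "continuous (at y) \<Gamma>" unfolding \<Gamma>_def by (intro continuous_intros)
      show "\<Psi> (\<Gamma> z) = z" if "z \<in> ball 0 \<rho> \<times> ball 0 \<rho>" for z
        using eq[of z] that by (cases z) (auto simp: \<Psi>_def \<Gamma>_def)
    qed (use op y in auto)
    then have "((\<lambda>p. snd (\<Gamma> p)) has_derivative (\<lambda>v. snd (fst v, (snd v - a * fst v) / (1 + b)))) (at y)"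
      by (rule has_derivative_snd)
    then have "(G has_derivative (\<lambda>v. (- a / (1 + b)) * fst v + (1 / (1 + b)) * snd v)) (at y)"
      by (simp add: \<Gamma>_def diff_divide_distrib)
    then show "\<exists>a b. (G has_derivative (\<lambda>v. a * fst v + b * snd v)) (at y)" by blast
  qed
  have "G (0, 0) = 0"
  proof -
    have P0: "(0, 0) \<in> ?P" using \<rho> by auto
    have "norm (T (0, 0) (G (0, 0)) - T (0, 0) 0) \<le> (1/4) * norm (G (0, 0) - 0)"
      using \<rho> by (intro Tcon[OF P0 G(1)[OF P0]]) auto
    moreover have "T (0, 0) 0 = 0" using F0 by (simp add: T_def zero_prod_def)
    ultimately show ?thesis using G(2)[OF P0] by simp
  qed
  then show ?thesis
    using that[OF \<rho>(1) _ _ _ hol] poly eq by blast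
qed

subsection \<open>Functions of class \<open>C\<^sup>1\<close> near the origin\<close>

text \<open>\<open>P\<close> and \<open>Q\<close> are the Wirtinger derivatives. In these terms
  continuity of the derivative is continuity of two complex functions, and the chain rule becomes a
  formula.\<close>

lemma C1_near0_iff_wirtinger:
  "C1_near0 f \<longleftrightarrow> (\<exists>r>0. \<exists>P Q. continuous_on (ball 0 r) P \<and> continuous_on (ball 0 r) Q \<and>
     (\<forall>z\<in>ball 0 r. (f has_derivative (\<lambda>v. P z * v + Q z * cnj v)) (at z)))" (is "_ \<longleftrightarrow> ?R")
proof
  assume "C1_near0 f"
  then obtain r f' where r: "r > 0" and d: "\<And>z. z \<in> ball 0 r \<Longrightarrow> (f has_derivative blinfun_apply (f' z)) (at z)"
    and c: "continuous_on (ball 0 r) f'"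
    unfolding C1_near0_def by metis
  define P Q where "P z = (blinfun_apply (f' z) 1 - \<i> * blinfun_apply (f' z) \<i>) / 2"
    and "Q z = (blinfun_apply (f' z) 1 + \<i> * blinfun_apply (f' z) \<i>) / 2" for z
  have cPQ: "continuous_on (ball 0 r) P" "continuous_on (ball 0 r) Q"
    unfolding P_def Q_def by (intro continuous_intros c; simp)+
  have eq: "blinfun_apply (f' z) v = P z * v + Q z * cnj v" for z v
  proof -
    have "blinfun_apply (f' z) v = blinfun_apply (f' z) (Re v *\<^sub>R 1 + Im v *\<^sub>R \<i>)"
      by (rule arg_cong[of _ _ "blinfun_apply (f' z)"]) (simp add: complex_eq_iff)
    also have "\<dots> = of_real (Re v) * blinfun_apply (f' z) 1 + of_real (Im v) * blinfun_apply (f' z) \<i>"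
      unfolding blinfun.add_right blinfun.scaleR_right by (simp add: scaleR_conv_of_real)
    also have "\<dots> = P z * v + Q z * cnj v"
      by (simp add: P_def Q_def complex_eq_iff algebra_simps add_divide_distrib diff_divide_distrib)
    finally show ?thesis .
  qed
  have "(f has_derivative (\<lambda>v. P z * v + Q z * cnj v)) (at z)" if "z \<in> ball 0 r" for z
    using d[OF that] unfolding eq[abs_def] .
  then show ?R using r cPQ by blast
next
  assume ?R
  then obtain r P Q where r: "r > 0" and c: "continuous_on (ball 0 r) P" "continuous_on (ball 0 r) Q"
    and d: "\<And>z. z \<in> ball 0 r \<Longrightarrow> (f has_derivative (\<lambda>v. P z * v + Q z * cnj v)) (at z)" by metis
  define cnjL where "cnjL = Blinfun cnj"
  have cnjL: "blinfun_apply cnjL = cnj"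
    unfolding cnjL_def by (rule bounded_linear_Blinfun_apply) (rule bounded_linear_cnj)
  define f' where "f' z = blinfun_mult_right (P z) + (blinfun_mult_right (Q z) o\<^sub>L cnjL)" for z
  have "blinfun_apply (f' z) = (\<lambda>v. P z * v + Q z * cnj v)" for z
    by (auto simp: f'_def blinfun.add_left cnjL fun_eq_iff)
  moreover have "continuous_on (ball 0 r) f'"
    unfolding f'_def
    by (intro continuous_intros bounded_linear.continuous_on[OF bounded_linear_blinfun_mult_right] c)
  ultimately show "C1_near0 f"
    unfolding C1_near0_def using r d by (intro exI[of _ r] conjI exI[of _ f']) auto
qed

lemma C1_near0I:
  assumes "r > 0" "continuous_on (ball 0 r) P" "continuous_on (ball 0 r) Q"
    "\<And>z. z \<in> ball 0 r \<Longrightarrow> (f has_derivative (\<lambda>v. P z * v + Q z * cnj v)) (at z)"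
  shows "C1_near0 f"
  unfolding C1_near0_iff_wirtinger using assms by blast

lemma C1_near0E:
  assumes "C1_near0 f"
  obtains r P Q where "r > 0" "continuous_on (ball 0 r) P" "continuous_on (ball 0 r) Q"
    "\<And>z. z \<in> ball 0 r \<Longrightarrow> (f has_derivative (\<lambda>v. P z * v + Q z * cnj v)) (at z)"
  using assms unfolding C1_near0_iff_wirtinger by metis

lemma C1_near0_isCont: "C1_near0 f \<Longrightarrow> isCont f 0"
  by (elim C1_near0E) (metis centre_in_ball has_derivative_continuous)

lemma C1_near0_cnj: "C1_near0 cnj"
  by (rule C1_near0I[of 1 "\<lambda>z. 0" "\<lambda>z. 1"])
     (auto intro: bounded_linear_imp_has_derivative[OF bounded_linear_cnj])

lemma C1_near0_add:
  assumes "C1_near0 f" "C1_near0 g"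
  shows "C1_near0 (\<lambda>z. f z + g z)"
proof -
  obtain r P Q where f: "r > 0" "continuous_on (ball 0 r) P" "continuous_on (ball 0 r) Q"
    "\<And>z. z \<in> ball 0 r \<Longrightarrow> (f has_derivative (\<lambda>v. P z * v + Q z * cnj v)) (at z)"
    using C1_near0E[OF assms(1)] by metis
  obtain s S T where g: "s > 0" "continuous_on (ball 0 s) S" "continuous_on (ball 0 s) T"
    "\<And>z. z \<in> ball 0 s \<Longrightarrow> (g has_derivative (\<lambda>v. S z * v + T z * cnj v)) (at z)"
    using C1_near0E[OF assms(2)] by metis
  show ?thesis
  proof (rule C1_near0I[of "min r s" "\<lambda>z. P z + S z" "\<lambda>z. Q z + T z"])
    fix z :: complex assume "z \<in> ball 0 (min r s)"
    then have "((\<lambda>z. f z + g z) has_derivative (\<lambda>v. (P z * v + Q z * cnj v) + (S z * v + T z * cnj v))) (at z)"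
      by (intro has_derivative_add f g) auto
    then show "((\<lambda>z. f z + g z) has_derivative (\<lambda>v. (P z + S z) * v + (Q z + T z) * cnj v)) (at z)"
      by (rule has_derivative_eq_rhs) (auto simp: fun_eq_iff algebra_simps)
  qed (use f g in \<open>auto intro!: continuous_intros intro: continuous_on_subset\<close>)
qed

lemma C1_near0_minus:
  assumes "C1_near0 f"
  shows "C1_near0 (\<lambda>z. - f z)"
proof -
  obtain r P Q where f: "r > 0" "continuous_on (ball 0 r) P" "continuous_on (ball 0 r) Q"
    "\<And>z. z \<in> ball 0 r \<Longrightarrow> (f has_derivative (\<lambda>v. P z * v + Q z * cnj v)) (at z)"
    using C1_near0E[OF assms(1)] by metis
  show ?thesis
  proof (rule C1_near0I[of r "\<lambda>z. - P z" "\<lambda>z. - Q z"])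
    fix z :: complex assume "z \<in> ball 0 r"
    from has_derivative_minus[OF f(4)[OF this]]
    show "((\<lambda>z. - f z) has_derivative (\<lambda>v. - P z * v + - Q z * cnj v)) (at z)"
      by (rule has_derivative_eq_rhs) (auto simp: fun_eq_iff algebra_simps)
  qed (use f in \<open>auto intro!: continuous_intros\<close>)
qed

lemma C1_near0_diff: "C1_near0 f \<Longrightarrow> C1_near0 g \<Longrightarrow> C1_near0 (\<lambda>z. f z - g z)"
  using C1_near0_add[OF _ C1_near0_minus, of f g] by simp

lemma C1_near0_reflect:
  assumes "C1_near0 f"
  shows "C1_near0 (\<lambda>z. f (- z))"
proof -
  obtain r P Q where f: "r > 0" "continuous_on (ball 0 r) P" "continuous_on (ball 0 r) Q"
    "\<And>z. z \<in> ball 0 r \<Longrightarrow> (f has_derivative (\<lambda>v. P z * v + Q z * cnj v)) (at z)"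
    using C1_near0E[OF assms(1)] by metis
  show ?thesis
  proof (rule C1_near0I[of r "\<lambda>z. - P (- z)" "\<lambda>z. - Q (- z)"])
    fix z :: complex assume "z \<in> ball 0 r"
    then have "(f has_derivative (\<lambda>v. P (-z) * v + Q (-z) * cnj v)) (at (- z))" by (intro f) auto
    from has_derivative_compose[OF has_derivative_minus[OF has_derivative_ident] this]
    show "((\<lambda>z. f (- z)) has_derivative (\<lambda>v. - P (- z) * v + - Q (- z) * cnj v)) (at z)"
      by (rule has_derivative_eq_rhs) (auto simp: fun_eq_iff algebra_simps)
  qed (use f in \<open>auto intro!: continuous_intros continuous_on_compose2[OF f(2)] continuous_on_compose2[OF f(3)]\<close>)
qed

lemma C1_near0_holomorphic2:
  assumes H: "holomorphic2_on H U" and f: "C1_near0 f" and in0: "(0, f 0) \<in> U"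
  shows "C1_near0 (\<lambda>z. H (z, f z))"
proof -
  obtain a b where ab: "continuous_on U a" "continuous_on U b"
    "\<And>w. w \<in> U \<Longrightarrow> (H has_derivative (\<lambda>v. a w * fst v + b w * snd v)) (at w)"
    using holomorphic2_continuous_partials[OF H] by metis
  obtain r P Q where f': "r > 0" "continuous_on (ball 0 r) P" "continuous_on (ball 0 r) Q"
    "\<And>z. z \<in> ball 0 r \<Longrightarrow> (f has_derivative (\<lambda>v. P z * v + Q z * cnj v)) (at z)"
    using C1_near0E[OF f] by metis
  have "open U" using H by (simp add: holomorphic2_on_def)
  have "((\<lambda>z. (z, f z)) \<longlongrightarrow> (0, f 0)) (at 0)"
    using C1_near0_isCont[OF f] by (auto simp: isCont_def intro!: tendsto_intros)
  then have "\<forall>\<^sub>F z in at 0. (z, f z) \<in> U" using \<open>open U\<close> in0 topological_tendstoD by blast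
  then obtain s where s: "s > 0" "\<And>z. z \<noteq> 0 \<Longrightarrow> dist z 0 < s \<Longrightarrow> (z, f z) \<in> U"
    unfolding eventually_at by auto
  define t where "t = min r s"
  have t: "t > 0" "ball 0 t \<subseteq> ball 0 r" using f' s by (auto simp: t_def)
  have inU: "(z, f z) \<in> U" if "z \<in> ball 0 t" for z
    using s(2)[of z] that in0 by (cases "z = 0") (auto simp: t_def)
  have cf: "continuous_on (ball 0 t) f"
    using f'(4) t(2) by (meson continuous_at_imp_continuous_on has_derivative_continuous subsetD)
  have cpair: "continuous_on (ball 0 t) (\<lambda>z. (z, f z))" by (intro continuous_intros cf)
  have img: "(\<lambda>z. (z, f z)) ` ball 0 t \<subseteq> U" using inU by auto
  have "continuous_on (ball 0 t) (\<lambda>z. a (z, f z))" "continuous_on (ball 0 t) (\<lambda>z. b (z, f z))"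
    by (rule continuous_on_compose2[OF ab(1) cpair img] continuous_on_compose2[OF ab(2) cpair img])+
  moreover have "continuous_on (ball 0 t) P" "continuous_on (ball 0 t) Q"
    by (rule continuous_on_subset[OF f'(2) t(2)] continuous_on_subset[OF f'(3) t(2)])+
  ultimately have coeffs: "continuous_on (ball 0 t) (\<lambda>z. a (z, f z) + b (z, f z) * P z)"
    "continuous_on (ball 0 t) (\<lambda>z. b (z, f z) * Q z)"
    by (auto intro!: continuous_on_add continuous_on_mult)
  show ?thesis
  proof (rule C1_near0I[OF t(1) coeffs])
    fix z :: complex assume z: "z \<in> ball 0 t"
    have "((\<lambda>z. (z, f z)) has_derivative (\<lambda>v. (v, P z * v + Q z * cnj v))) (at z)"
      by (intro has_derivative_Pair has_derivative_ident f'(4) subsetD[OF t(2) z])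
    from has_derivative_compose[OF this ab(3)[OF inU[OF z]]]
    show "((\<lambda>z. H (z, f z)) has_derivative
       (\<lambda>v. (a (z, f z) + b (z, f z) * P z) * v + b (z, f z) * Q z * cnj v)) (at z)"
      by (rule has_derivative_eq_rhs) (auto simp: fun_eq_iff algebra_simps)
  qed
qed

lemma small_o_id_tendsto_0:
  assumes "f \<in> o[at 0](\<lambda>z::complex. z)"
  shows "(f \<longlongrightarrow> (0::complex)) (at 0)"
proof (rule Lim_null_comparison)
  show "\<forall>\<^sub>F z in at 0. norm (f z) \<le> norm z"
    using landau_o.smallD[OF assms, of 1] by simp
qed (auto intro!: tendsto_eq_intros)

lemma C1_near0_small_o_at_0:
  assumes "C1_near0 f" "f \<in> o[at 0](\<lambda>z. z)"
  shows "f 0 = 0"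
  using C1_near0_isCont[OF assms(1)] small_o_id_tendsto_0[OF assms(2)]
  unfolding isCont_def by (metis LIM_unique)

text \<open>The derivative at 0 vanishes; its values at 1 and \<open>\<i>\<close> give
  \<open>P 0 = Q 0 = 0\<close>, and continuity makes both small nearby. It shows that
  \<open>g\<close> and \<open>h\<close> are small perturbations in the Lipschitz sense.\<close>

lemma C1_near0_small_lipschitz:
  assumes f: "C1_near0 f" and o: "f \<in> o[at 0](\<lambda>z. z)" and \<epsilon>: "\<epsilon> > 0"
  obtains \<delta> where "\<delta> > 0" "\<And>z w. z \<in> ball 0 \<delta> \<Longrightarrow> w \<in> ball 0 \<delta> \<Longrightarrow> norm (f z - f w) \<le> \<epsilon> * norm (z - w)"
proof -
  obtain r P Q where f': "r > 0" "continuous_on (ball 0 r) P" "continuous_on (ball 0 r) Q"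
    "\<And>z. z \<in> ball 0 r \<Longrightarrow> (f has_derivative (\<lambda>v. P z * v + Q z * cnj v)) (at z)"
    using C1_near0E[OF f] by metis
  have f0: "f 0 = 0" by (rule C1_near0_small_o_at_0[OF f o])
  have "(f has_derivative (\<lambda>v. 0)) (at 0)"
    unfolding has_derivative_at
  proof (intro conjI bounded_linear_zero tendstoI)
    fix e :: real assume "e > 0"
    then have "\<forall>\<^sub>F z in at 0. norm (f z) \<le> e/2 * norm z" using landau_o.smallD[OF o, of "e/2"] by simp
    moreover have "\<forall>\<^sub>F z in at 0. z \<noteq> (0::complex)" by (simp add: eventually_at_filter)
    ultimately show "\<forall>\<^sub>F h in at 0. dist (norm (f (0 + h) - f 0 - 0) / norm h) 0 < e"
    proof eventually_elim
      case (elim z)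
      then have "norm (f z) / norm z \<le> e / 2" by (simp add: divide_le_eq)
      then have "norm (f z) / norm z < e" using \<open>e > 0\<close> by linarith
      then show ?case using f0 by simp
    qed
  qed
  then have z: "(\<lambda>v. P 0 * v + Q 0 * cnj v) = (\<lambda>v. 0)"
    using has_derivative_unique[OF f'(4)[of 0]] f'(1) by auto
  have "P 0 + Q 0 = 0" using fun_cong[OF z, of 1] by simp
  moreover have "P 0 - Q 0 = 0" using fun_cong[OF z, of \<i>] by (simp flip: left_diff_distrib)
  ultimately have PQ0: "P 0 = 0" "Q 0 = 0" by auto
  have "isCont (\<lambda>w. norm (P w) + norm (Q w)) 0"
    using f' by (intro continuous_intros) (auto simp: continuous_on_eq_continuous_at)
  then have "((\<lambda>w. norm (P w) + norm (Q w)) \<longlongrightarrow> 0) (at 0)"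
    using PQ0 by (simp add: isCont_def)
  then have "\<forall>\<^sub>F w in at 0. norm (P w) + norm (Q w) < \<epsilon>" using \<epsilon> order_tendstoD(2) by blast
  then obtain s where s: "s > 0" "\<And>w. w \<noteq> 0 \<Longrightarrow> dist w 0 < s \<Longrightarrow> norm (P w) + norm (Q w) < \<epsilon>"
    unfolding eventually_at by auto
  have small: "norm (P w) + norm (Q w) \<le> \<epsilon>" if "norm w < s" for w
    using s(2)[of w] that PQ0 \<epsilon> by (cases "w = 0") auto
  show ?thesis
  proof (rule that[of "min s r"])
    fix x y :: complex assume xy: "x \<in> ball 0 (min s r)" "y \<in> ball 0 (min s r)"
    show "norm (f x - f y) \<le> \<epsilon> * norm (x - y)"
    proof (rule lipschitz_on_ball_if_derivative_bounded[OF _ _ xy])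
      fix w v :: complex assume w: "w \<in> ball 0 (min s r)"
      then show "(f has_derivative (\<lambda>v. P w * v + Q w * cnj v)) (at w)" by (intro f') auto
      have "norm (P w * v + Q w * cnj v) \<le> norm (P w) * norm v + norm (Q w) * norm v"
        by (metis complex_mod_cnj norm_mult norm_triangle_ineq)
      also have "\<dots> = (norm (P w) + norm (Q w)) * norm v" by (simp add: algebra_simps)
      also have "\<dots> \<le> \<epsilon> * norm v"
        using small[of w] w by (intro mult_right_mono) auto
      finally show "norm (P w * v + Q w * cnj v) \<le> \<epsilon> * norm v" .
    qed
  qed (use s f' in auto)
qed

text \<open>Only differences of \<open>F\<close> enter, never its size. With
  \<open>s = H z - cnj z\<close> and \<open>q = \<sigma> g + h\<close>, the equation reads
  \<open>q - s = F (z, H z) - F (z, cnj z)\<close>, which is at most \<open>\<kappa> |s|\<close> for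
  any \<open>\<kappa> > 0\<close> near 0. Hence \<open>|s| \<le> 2 |q| \<le> 4 |g|\<close>, and
  \<open>s\<close> differs from \<open>q\<close> by \<open>o(g)\<close>.\<close>

lemma straightened_remainder_small_o:
  fixes F :: "complex \<times> complex \<Rightarrow> complex"
  assumes lip: "\<And>\<kappa>. \<kappa> > 0 \<Longrightarrow> \<exists>\<delta>>0. \<forall>x\<in>ball 0 \<delta>. \<forall>y\<in>ball 0 \<delta>. norm (F x - F y) \<le> \<kappa> * norm (x - y)"
    and H: "(H \<longlongrightarrow> 0) (at 0)" and h: "h \<in> o[at 0](g)" and \<sigma>: "norm \<sigma> = 1"
    and eq: "\<forall>\<^sub>F z in at 0. H z + F (z, H z) = cnj z + F (z, cnj z) + \<sigma> * g z + h z"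
  shows "(\<lambda>z. H z - cnj z - \<sigma> * g z) \<in> o[at 0](g)"
proof (rule landau_o.smallI)
  fix c :: real assume c: "c > 0"
  \<comment> \<open>1/2 absorbs \<open>\<kappa> |s|\<close> on the left; \<open>c/8\<close> gives
    \<open>4 \<kappa> \<le> c/2\<close>, the other half of \<open>c\<close> being spent on
    \<open>h\<close>.\<close>
  define \<kappa> where "\<kappa> = min (1/2) (c/8)"
  have \<kappa>: "\<kappa> > 0" "\<kappa> \<le> 1/2" "8 * \<kappa> \<le> c" using c by (auto simp: \<kappa>_def)
  obtain \<delta> where \<delta>: "\<delta> > 0" "\<forall>x\<in>ball 0 \<delta>. \<forall>y\<in>ball 0 \<delta>. norm (F x - F y) \<le> \<kappa> * norm (x - y)"
    using lip[OF \<kappa>(1)] by blast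
  have 1: "\<forall>\<^sub>F z in at 0. norm (h z) \<le> min 1 (c/2) * norm (g z)"
    using landau_o.smallD[OF h, of "min 1 (c/2)"] c by simp
  have "((\<lambda>z. (z, H z)) \<longlongrightarrow> (0, 0)) (at 0)" by (intro tendsto_intros H)
  then have 2: "\<forall>\<^sub>F z in at 0. (z, H z) \<in> ball 0 \<delta>"
    using \<delta>(1) by (intro topological_tendstoD) (auto simp: zero_prod_def)
  have "((\<lambda>z. (z, cnj z)) \<longlongrightarrow> (0, cnj 0)) (at 0)" by (intro tendsto_intros)
  then have 3: "\<forall>\<^sub>F z in at 0. (z, cnj z) \<in> ball 0 \<delta>"
    using \<delta>(1) by (intro topological_tendstoD) (auto simp: zero_prod_def)
  from 1 2 3 eq show "\<forall>\<^sub>F z in at 0. norm (H z - cnj z - \<sigma> * g z) \<le> c * norm (g z)"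
  proof eventually_elim
    case (elim z)
    define s where "s = H z - cnj z"
    define q where "q = \<sigma> * g z + h z"
    have h1: "norm (h z) \<le> norm (g z)" "norm (h z) \<le> c/2 * norm (g z)"
      using order_trans[OF elim(1) mult_right_mono[of "min 1 (c/2)" 1 "norm (g z)"]]
        order_trans[OF elim(1) mult_right_mono[of "min 1 (c/2)" "c/2" "norm (g z)"]] by auto
    have q: "norm q \<le> 2 * norm (g z)"
      using norm_triangle_ineq[of "\<sigma> * g z" "h z"] h1(1) \<sigma> by (simp add: q_def norm_mult)
    have "norm (F (z, H z) - F (z, cnj z)) \<le> \<kappa> * norm s"
      using \<delta>(2) elim(2,3) by (fastforce simp: s_def norm_Pair)
    moreover have "q - s = F (z, H z) - F (z, cnj z)"
      using elim(4) by (simp add: q_def s_def algebra_simps)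
    ultimately have qs: "norm (q - s) \<le> \<kappa> * norm s" by simp
    also have "\<kappa> * norm s \<le> 1/2 * norm s" using \<kappa>(2) by (intro mult_right_mono) auto
    finally have "norm s \<le> 2 * norm q"
      using norm_triangle_ineq2[of s q] by (simp add: norm_minus_commute)
    then have "\<kappa> * norm s \<le> \<kappa> * (4 * norm (g z))"
      using q \<kappa>(1) by (intro mult_left_mono) auto
    also have "\<dots> \<le> c/2 * norm (g z)"
      using mult_right_mono[OF \<kappa>(3), of "norm (g z)"] by simp
    finally have "norm (q - s) \<le> c/2 * norm (g z)" using qs by simp
    moreover have "H z - cnj z - \<sigma> * g z = h z - (q - s)"
      by (simp add: q_def s_def)
    ultimately show ?case
      using norm_triangle_ineq4[of "h z" "q - s"] h1(2) by simp
  qed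
qed

subsection \<open>Polynomials in the squares\<close>

definition is_poly2 :: "(complex \<Rightarrow> complex \<Rightarrow> complex) \<Rightarrow> bool" where
  "is_poly2 f \<longleftrightarrow> (\<exists>N c. \<forall>a b. f a b = poly2 N c a b)"

text \<open>Padding with zero coefficients, so that two polynomials can be added over a common
  degree bound.\<close>

lemma poly2_mono:
  assumes "N \<le> M"
  shows "poly2 N c a b = poly2 M (\<lambda>(i, j). if i \<le> N \<and> j \<le> N then c (i, j) else 0) a b"
proof -
  have "poly2 M (\<lambda>(i, j). if i \<le> N \<and> j \<le> N then c (i, j) else 0) a b
     = (\<Sum>i\<le>M. if i \<le> N then \<Sum>j\<le>M. if j \<le> N then c (i, j) * a ^ i * b ^ j else 0 else 0)"
    unfolding poly2_def by (intro sum.cong refl) (auto intro!: sum.cong)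
  also have "\<dots> = (\<Sum>i\<le>N. \<Sum>j\<le>N. c (i, j) * a ^ i * b ^ j)"
  proof -
    have *: "(\<Sum>i\<le>M. if i \<le> N then t i else 0) = (\<Sum>i\<le>N. t i)" for t :: "nat \<Rightarrow> complex"
      using assms by (intro sum.mono_neutral_cong_right) auto
    show ?thesis unfolding * ..
  qed
  finally show ?thesis by (simp add: poly2_def)
qed

lemma is_poly2_add:
  assumes "is_poly2 f" "is_poly2 g"
  shows "is_poly2 (\<lambda>a b. f a b + g a b)"
proof -
  obtain N c M d where *: "\<And>a b. f a b = poly2 N c a b" "\<And>a b. g a b = poly2 M d a b"
    using assms unfolding is_poly2_def by metis
  define c' d' where "c' = (\<lambda>(i, j). if i \<le> N \<and> j \<le> N then c (i, j) else 0)"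
    and "d' = (\<lambda>(i, j). if i \<le> M \<and> j \<le> M then d (i, j) else 0)"
  have "f a b = poly2 (max N M) c' a b" "g a b = poly2 (max N M) d' a b" for a b
    unfolding * c'_def d'_def by (intro poly2_mono; simp)+
  then have "f a b + g a b = poly2 (max N M) (\<lambda>x. c' x + d' x) a b" for a b
    by (simp add: poly2_def sum.distrib algebra_simps)
  then show ?thesis unfolding is_poly2_def by blast
qed

lemma is_poly2_monomial: "is_poly2 (\<lambda>a b. k * a ^ i * b ^ j)"
proof -
  have "k * a ^ i * b ^ j = poly2 (max i j) (\<lambda>x. if x = (i, j) then k else 0) a b" for a b
  proof -
    have "poly2 (max i j) (\<lambda>x. if x = (i, j) then k else 0) a b
       = (\<Sum>i'\<le>max i j. \<Sum>j'\<le>max i j. if i' = i then if j' = j then k * a ^ i * b ^ j else 0 else 0)"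
      unfolding poly2_def by (intro sum.cong refl) auto
    also have "\<dots> = (\<Sum>i'\<le>max i j. if i' = i then k * a ^ i * b ^ j else 0)"
      by (intro sum.cong refl) auto
    finally show ?thesis by simp
  qed
  then show ?thesis unfolding is_poly2_def by blast
qed

lemma is_poly2_sum:
  assumes "\<And>i. i \<in> I \<Longrightarrow> is_poly2 (f i)"
  shows "is_poly2 (\<lambda>a b. \<Sum>i\<in>I. f i a b)"
proof -
  have "is_poly2 (\<lambda>a b. 0)" using is_poly2_monomial[of 0 0 0] by simp
  then show ?thesis
    using assms by (induction I rule: infinite_finite_induct) (auto intro: is_poly2_add)
qed

lemma is_poly2_mult:
  assumes "is_poly2 f" "is_poly2 g"
  shows "is_poly2 (\<lambda>a b. f a b * g a b)"
proof -
  obtain N c M d where *: "\<And>a b. f a b = poly2 N c a b" "\<And>a b. g a b = poly2 M d a b"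
    using assms unfolding is_poly2_def by metis
  have "f a b * g a b = (\<Sum>k\<le>M. \<Sum>l\<le>M. \<Sum>i\<le>N. \<Sum>j\<le>N. (c (i, j) * d (k, l)) * a ^ (i + k) * b ^ (j + l))" for a b
    unfolding * poly2_def sum_distrib_left sum_distrib_right
    by (intro sum.cong refl) (simp add: power_add mult_ac)
  moreover have "is_poly2 (\<lambda>a b. \<Sum>k\<le>M. \<Sum>l\<le>M. \<Sum>i\<le>N. \<Sum>j\<le>N. (c (i, j) * d (k, l)) * a ^ (i + k) * b ^ (j + l))"
    by (intro is_poly2_sum is_poly2_monomial)
  ultimately show ?thesis by simp
qed

lemma polyfun_is_poly2: "polyfun P \<Longrightarrow> is_poly2 (\<lambda>a b. P (a, b))"
proof (induction rule: polyfun.induct)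
  case (polyfun_const c)
  then show ?case using is_poly2_monomial[of c 0 0] by simp
next
  case polyfun_fst
  then show ?case using is_poly2_monomial[of 1 1 0] by simp
next
  case polyfun_snd
  then show ?case using is_poly2_monomial[of 1 0 1] by simp
qed (auto intro: is_poly2_add is_poly2_mult)

text \<open>The average annihilates every monomial with an odd exponent and fixes the others, in
  which \<open>a\<close> and \<open>b\<close> occur only through their squares.\<close>

lemma polyfun_average_is_poly2_squares:
  assumes "polyfun P"
  obtains N c where
    "\<And>a b. (P (a, b) + P (- a, b) + P (a, - b) + P (- a, - b)) / 4 = poly2 N c (a\<^sup>2) (b\<^sup>2)"
proof -
  obtain N c where c: "\<And>a b. P (a, b) = poly2 N c a b"
    using polyfun_is_poly2[OF assms] unfolding is_poly2_def by blast
  define k where "k i j = (if even i \<and> even j then c (i, j) else 0)" for i j :: nat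
  have mono: "(c (i, j) * a ^ i * b ^ j + c (i, j) * (- a) ^ i * b ^ j + c (i, j) * a ^ i * (- b) ^ j
       + c (i, j) * (- a) ^ i * (- b) ^ j) / 4 = k i j * (a\<^sup>2) ^ (i div 2) * (b\<^sup>2) ^ (j div 2)" for i j a b
    by (cases "even i"; cases "even j") (auto simp: k_def power_mult[symmetric])
  have "(P (a, b) + P (- a, b) + P (a, - b) + P (- a, - b)) / 4
     = (\<Sum>i\<le>N. \<Sum>j\<le>N. k i j * (a\<^sup>2) ^ (i div 2) * (b\<^sup>2) ^ (j div 2))" for a b
    unfolding c poly2_def mono[symmetric] by (simp add: sum.distrib[symmetric] sum_divide_distrib[symmetric])
  moreover have "is_poly2 (\<lambda>a b. \<Sum>i\<le>N. \<Sum>j\<le>N. k i j * a ^ (i div 2) * b ^ (j div 2))"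
    by (intro is_poly2_sum is_poly2_monomial)
  then obtain M d where "\<And>a b. (\<Sum>i\<le>N. \<Sum>j\<le>N. k i j * a ^ (i div 2) * b ^ (j div 2)) = poly2 M d a b"
    unfolding is_poly2_def by blast
  ultimately show ?thesis using that[of M d] by simp
qed

lemma polyclo_average_approx:
  assumes u: "u \<in> polyclo X" and \<epsilon>: "\<epsilon> > 0"
  obtains N c where "\<And>a b. {(a, b), (- a, b), (a, - b), (- a, - b)} \<subseteq> X \<Longrightarrow>
    norm ((u (a, b) + u (- a, b) + u (a, - b) + u (- a, - b)) / 4 - poly2 N c (a\<^sup>2) (b\<^sup>2)) < \<epsilon>"
proof -
  obtain P where P: "polyfun P" "\<And>x. x \<in> X \<Longrightarrow> norm (u x - P x) < \<epsilon>" using polycloE[OF u \<epsilon>] by blast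
  obtain N c where c: "\<And>a b. (P (a, b) + P (- a, b) + P (a, - b) + P (- a, - b)) / 4 = poly2 N c (a\<^sup>2) (b\<^sup>2)"
    using polyfun_average_is_poly2_squares[OF P(1)] by blast
  show ?thesis
  proof (rule that)
    fix a b assume X: "{(a, b), (- a, b), (a, - b), (- a, - b)} \<subseteq> X"
    define D where "D x = u x - P x" for x
    have avg: "(u (a, b) + u (- a, b) + u (a, - b) + u (- a, - b)) / 4 - poly2 N c (a\<^sup>2) (b\<^sup>2)
       = (D (a, b) + D (- a, b) + D (a, - b) + D (- a, - b)) / 4"
      unfolding c[symmetric] D_def by (simp add: field_simps)
    have "norm (D (a, b) + D (- a, b) + D (a, - b) + D (- a, - b))
        \<le> norm (D (a, b)) + norm (D (- a, b)) + norm (D (a, - b)) + norm (D (- a, - b))"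
      by (intro norm_triangle_le add_right_mono) simp
    moreover have "norm (D (a, b)) < \<epsilon>" "norm (D (- a, b)) < \<epsilon>" "norm (D (a, - b)) < \<epsilon>" "norm (D (- a, - b)) < \<epsilon>"
      using P(2) X by (auto simp: D_def)
    ultimately show "norm ((u (a, b) + u (- a, b) + u (a, - b) + u (- a, - b)) / 4 - poly2 N c (a\<^sup>2) (b\<^sup>2)) < \<epsilon>"
      unfolding avg by (simp add: norm_divide)
  qed
qed

lemma polyclo_poly2:
  assumes "u \<in> polyclo X" "v \<in> polyclo X" "bounded X"
  shows "(\<lambda>x. poly2 N c (u x) (v x)) \<in> polyclo X"
  unfolding poly2_def by (intro polyclo_sum polyclo_mult polyclo_const polyclo_power assms)

subsection \<open>Density of the polynomials in the two squares\<close>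

text \<open>Supplies the remainder of the reflected disc: \<open>- phi (- z)\<close> contains
  \<open>- h (- z)\<close>, and evenness allows a comparison with \<open>g z\<close> again.\<close>

lemma small_o_reflect:
  fixes g h :: "complex \<Rightarrow> complex"
  assumes h: "h \<in> o[at 0](g)" and even: "\<forall>\<^sub>F z in at 0. g (- z) = g z"
  shows "(\<lambda>z. - h (- z)) \<in> o[at 0](g)"
proof (rule landau_o.smallI)
  fix c :: real assume "c > 0"
  have refl: "filterlim (\<lambda>z::complex. - z) (at 0) (at 0)"
    unfolding filterlim_at by (auto intro!: tendsto_eq_intros simp: eventually_at_filter)
  have "\<forall>\<^sub>F z in at 0. norm (h z) \<le> c * norm (g z)" using landau_o.smallD[OF h \<open>c > 0\<close>] .
  then have "\<forall>\<^sub>F z in at 0. norm (h (- z)) \<le> c * norm (g (- z))"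
    by (rule eventually_compose_filterlim[OF _ refl])
  with even show "\<forall>\<^sub>F z in at 0. norm (- h (- z)) \<le> c * norm (g z)"
    by eventually_elim simp
qed

text \<open>The quotient \<open>(f - f 0) / m\<close> may blow up at 0, so it is regularised to
  \<open>(f - f 0) cnj m / (|m|^2 + \<eta>)\<close>. The error is
  \<open>(f - f 0) \<eta> / (|m|^2 + \<eta>)\<close>: near 0 the first factor is small, elsewhere
  \<open>|m|\<close> is bounded below and the second one is small.\<close>

lemma multiplier_approximation:
  fixes m f :: "complex \<Rightarrow> complex"
  assumes m: "continuous_on (cball 0 r) m" and m0: "\<And>z. z \<in> cball 0 r \<Longrightarrow> z \<noteq> 0 \<Longrightarrow> m z \<noteq> 0"
    and f: "continuous_on (cball 0 r) f" and r: "r > 0" and \<epsilon>: "\<epsilon> > 0"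
  obtains e where "continuous_on (cball 0 r) e" "\<And>z. z \<in> cball 0 r \<Longrightarrow> norm (f z - (f 0 + m z * e z)) < \<epsilon>"
proof -
  obtain \<delta> where \<delta>: "\<delta> > 0" "\<And>z. z \<in> cball 0 r \<Longrightarrow> dist z 0 < \<delta> \<Longrightarrow> dist (f z) (f 0) < \<epsilon>"
    using f \<epsilon> r unfolding continuous_on_iff by (metis centre_in_cball less_imp_le)
  define K where "K = cball (0::complex) r \<inter> - ball 0 \<delta>"
  have K: "compact K" "K \<subseteq> cball 0 r" "0 \<notin> K" using \<delta>(1) by (auto simp: K_def intro!: compact_Int_closed)
  have "\<exists>\<mu>>0. \<forall>z\<in>K. \<mu> \<le> norm (m z)"
  proof (cases "K = {}")
    case False
    obtain z0 where "z0 \<in> K" "\<forall>z\<in>K. norm (m z0) \<le> norm (m z)"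
      using continuous_attains_inf[OF K(1) False continuous_on_norm[OF continuous_on_subset[OF m K(2)]]] by blast
    moreover have "m z0 \<noteq> 0" using \<open>z0 \<in> K\<close> K by (intro m0) auto
    ultimately show ?thesis by (intro exI[of _ "norm (m z0)"]) auto
  qed (auto intro: exI[of _ 1])
  then obtain \<mu> where \<mu>: "\<mu> > 0" "\<And>z. z \<in> K \<Longrightarrow> \<mu> \<le> norm (m z)" by blast
  have "bounded ((\<lambda>z. f z - f 0) ` cball 0 r)"
    by (intro compact_imp_bounded compact_continuous_image continuous_intros f) auto
  then obtain B where B: "B > 0" "\<And>z. z \<in> cball 0 r \<Longrightarrow> norm (f z - f 0) \<le> B"
    unfolding bounded_pos by blast
  \<comment> \<open>Chosen so that \<open>B \<eta> / \<mu>^2 = \<epsilon> / 2\<close> on the part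
    away from 0.\<close>
  define \<eta> where "\<eta> = \<epsilon> * \<mu>\<^sup>2 / (2 * B)"
  have \<eta>: "\<eta> > 0" using \<epsilon> \<mu> B by (simp add: \<eta>_def)
  define q where "q z = (norm (m z))\<^sup>2 + \<eta>" for z
  have q: "q z > 0" "q z \<ge> \<eta>" for z using \<eta> by (auto simp: q_def add_nonneg_pos)
  define e where "e z = (f z - f 0) * cnj (m z) / of_real (q z)" for z
  have err: "f z - (f 0 + m z * e z) = (f z - f 0) * of_real (\<eta> / q z)" for z
  proof -
    have "m z * cnj (m z) = of_real (q z - \<eta>)"
      by (simp add: q_def complex_norm_square flip: of_real_power)
    then have "m z * e z = (f z - f 0) * of_real (q z - \<eta>) / of_real (q z)"
      by (simp add: e_def mult.assoc mult.left_commute)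
    also have "\<dots> = (f z - f 0) * (1 - of_real (\<eta> / q z))"
      using q(1)[of z] by (simp add: field_simps)
    finally show ?thesis by (simp add: algebra_simps)
  qed
  show ?thesis
  proof (rule that)
    have "of_real (q z) \<noteq> (0::complex)" for z using q(1)[of z] by simp
    then show "continuous_on (cball 0 r) e"
      unfolding e_def q_def by (intro continuous_intros f m) auto
    fix z assume z: "z \<in> cball (0::complex) r"
    have n: "norm (f z - (f 0 + m z * e z)) = norm (f z - f 0) * (\<eta> / q z)"
      unfolding err norm_mult norm_of_real using \<eta> q(1)[of z] by simp
    show "norm (f z - (f 0 + m z * e z)) < \<epsilon>"
    proof (cases "norm z < \<delta>")
      case True
      have "norm (f z - f 0) * (\<eta> / q z) \<le> norm (f z - f 0) * 1"
        using q(1,2)[of z] by (intro mult_left_mono) auto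
      then show ?thesis using \<delta>(2)[OF z] True n by (simp add: dist_norm)
    next
      case False
      then have "z \<in> K" using z by (simp add: K_def)
      then have "\<mu>\<^sup>2 \<le> (norm (m z))\<^sup>2" using \<mu> by (intro power_mono) auto
      then have "\<mu>\<^sup>2 \<le> q z" using \<eta> by (simp add: q_def)
      then have "norm (f z - f 0) * (\<eta> / q z) \<le> B * (\<eta> / \<mu>\<^sup>2)"
        using B(2)[OF z] B(1) \<eta> \<mu>(1) by (intro mult_mono divide_left_mono) (auto intro!: mult_pos_pos divide_nonneg_pos q)
      also have "\<dots> = \<epsilon> / 2" using B \<mu> by (simp add: \<eta>_def field_simps)
      finally show ?thesis using n \<epsilon> by linarith
    qed
  qed
qed

text \<open>\<open>b\<close> is available on two of the four discs only. The upper part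
  \<open>A\<close> of \<open>\<i> z w\<close> vanishes on the other two, so multiplying the upper
  part of \<open>b\<close> by \<open>A\<close> extends it by zero to all four; the product is
  nonzero exactly on \<open>graph\<close> without the origin.\<close>

lemma (in near_conjugation) poly_closure_squares:
  assumes phi0: "phi 0 = 0" and b: "b \<in> polyclo (graph \<union> (\<lambda>z. (- z, - phi z)) ` cball 0 r)"
    and b0: "b (0, 0) = 0"
    and up: "\<And>z. z \<in> cball 0 r \<Longrightarrow> z \<noteq> 0 \<Longrightarrow> Im (b (z, phi z)) > 0"
    and low: "\<And>z. z \<in> cball 0 r \<Longrightarrow> z \<noteq> 0 \<Longrightarrow> Im (b (- z, - phi z)) < 0"
  shows "poly_closure (\<lambda>z. z ^ 2) (\<lambda>z. (phi z) ^ 2) (cball 0 r) = {f. continuous_on (cball 0 r) f}"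
proof (intro equalityI subsetI)
  fix f assume "f \<in> {f :: complex \<Rightarrow> complex. continuous_on (cball 0 r) f}"
  then have f: "continuous_on (cball 0 r) f" by simp
  define D :: "complex set" where "D = cball 0 r"
  define Y2 Y3 Y4 where "Y2 = (\<lambda>z. (- z, - phi z)) ` D" and "Y3 = (\<lambda>z. (- z, phi z)) ` D" and "Y4 = (\<lambda>z. (z, - phi z)) ` D"
  define Y where "Y = graph \<union> Y2"
  define X where "X = Y \<union> (Y3 \<union> Y4)"
  have cphi: "continuous_on D phi"
    unfolding D_def by (rule continuous_on_subset[OF continuous_phi]) (use cball_coords in auto)
  have "compact Y2" "compact Y3" "compact Y4"
    unfolding Y2_def Y3_def Y4_def
    by (intro compact_continuous_image continuous_intros cphi; simp add: D_def)+
  then have cY: "compact Y" and cX: "compact X"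
    unfolding X_def Y_def by (simp_all add: compact_Un compact_graph)
  have bX: "bounded X" using cX compact_imp_bounded by auto
  \<comment> \<open>As \<open>phi\<close> is close to conjugation, \<open>z phi z\<close> is close
    to \<open>|z|^2\<close>.\<close>
  have pos: "Re (z * phi z) > 0" if "z \<in> D" "z \<noteq> 0" for z
  proof -
    have "norm ((phi z - cnj z) - (phi 0 - cnj 0)) \<le> norm (z - 0) / 2"
      using cball_coords[of z] that L0 by (intro lip) (auto simp: D_def)
    then have "norm (phi z - cnj z) \<le> norm z / 2" using phi0 by simp
    from regularised_kernel_denominator[OF this, of 0] have "(norm z)\<^sup>2 / 2 \<le> Re (z * phi z)" by simp
    moreover have "(norm z)\<^sup>2 > 0" using that by simp
    ultimately show ?thesis by linarith
  qed
  define a where "a x = \<i> * (fst x * snd x)" for x :: "complex \<times> complex"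
  have a: "a \<in> polyclo X"
    unfolding a_def by (intro polyclo_cmult polyclo_mult polyclo_fst polyclo_snd bX)
  have aY: "a x = 0 \<or> Im (a x) > 0" if "x \<in> Y" for x
    using that pos unfolding Y_def Y2_def graph_def D_def[symmetric] by (force simp: a_def)
  have aZ: "a x = 0 \<or> Im (a x) < 0" if "x \<in> Y3 \<union> Y4" for x
    using that pos unfolding Y3_def Y4_def by (force simp: a_def)
  define A where "A x = (if Im (a x) > 0 then a x else 0)" for x
  have A: "A \<in> polyclo X"
    unfolding A_def by (rule polyclo_upper_half_part[OF a cX]) (use aY aZ in \<open>fastforce simp: X_def\<close>)
  have bYin: "b \<in> polyclo Y" using b by (simp add: Y_def Y2_def D_def)
  have bsplit: "b x = 0 \<or> Im (b x) \<noteq> 0" if x: "x \<in> Y" for x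
  proof -
    obtain z where "z \<in> D" "x = (z, phi z) \<or> x = (- z, - phi z)"
      using x unfolding Y_def Y2_def graph_def D_def by blast
    then show ?thesis using up[of z] low[of z] b0 phi0 by (cases "z = 0") (auto simp: D_def)
  qed
  define B where "B x = (if Im (b x) > 0 then b x else 0)" for x
  have B: "B \<in> polyclo Y"
    unfolding B_def by (rule polyclo_upper_half_part[OF bYin cY bsplit])
  define psi where "psi x = A x * B x" for x
  have A0: "A x = 0" if "x \<in> Y3 \<union> Y4" for x using aZ[OF that] by (auto simp: A_def)
  have psi: "psi \<in> polyclo X"
    unfolding psi_def by (rule polyclo_extend_by_zero[OF A bX B]) (use A0 in \<open>auto simp: X_def\<close>)
  have B0: "B x = 0" if x: "x \<in> Y2" for x
  proof -
    obtain z where "z \<in> D" "x = (- z, - phi z)" using x by (auto simp: Y2_def)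
    then show ?thesis using low[of z] b0 phi0 by (cases "z = 0") (auto simp: B_def D_def)
  qed
  have psi0: "psi x = 0" if "x \<in> Y2 \<union> (Y3 \<union> Y4)" for x
    using A0[of x] B0[of x] that by (auto simp: psi_def)
  define m where "m z = psi (z, phi z)" for z
  have cm: "continuous_on (cball 0 r) m"
    unfolding m_def
    by (intro continuous_on_compose2[OF polyclo_continuous_on[OF psi]] continuous_intros cphi[unfolded D_def])
       (auto simp: X_def Y_def graph_def)
  have m0: "m z \<noteq> 0" if "z \<in> cball 0 r" "z \<noteq> 0" for z
  proof -
    have "Im (a (z, phi z)) > 0" using pos[of z] that by (simp add: a_def D_def)
    moreover have "Im (b (z, phi z)) > 0" using up[OF that] .
    ultimately show ?thesis by (auto simp: m_def psi_def A_def B_def)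
  qed
  show "f \<in> poly_closure (\<lambda>z. z ^ 2) (\<lambda>z. (phi z) ^ 2) (cball 0 r)"
    unfolding poly_closure_def
  proof (intro CollectI conjI f allI impI)
    fix \<epsilon> :: real assume \<epsilon>: "\<epsilon> > 0"
    obtain e where e: "continuous_on (cball 0 r) e" "\<And>z. z \<in> cball 0 r \<Longrightarrow> norm (f z - (f 0 + m z * e z)) < \<epsilon> / 2"
      using multiplier_approximation[OF cm m0 f r0, of "\<epsilon> / 2"] \<epsilon> by auto
    \<comment> \<open>Of the four points over \<open>z\<close>, only the one on \<open>graph\<close>
      sees the second summand; the factor 4 undoes the averaging.\<close>
    define u where "u x = f 0 + 4 * (psi x * e (fst x))" for x
    have "(\<lambda>x. psi x * e (fst x)) \<in> polyclo X"
      by (rule polyclo_extend_by_zero[OF psi bX continuous_in_polyclo_graph[OF e(1)]])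
         (use psi0 in \<open>auto simp: X_def Y_def\<close>)
    then have "u \<in> polyclo X"
      unfolding u_def by (intro polyclo_add polyclo_const polyclo_cmult)
    then obtain N c where c: "\<And>z w. {(z, w), (- z, w), (z, - w), (- z, - w)} \<subseteq> X \<Longrightarrow>
      norm ((u (z, w) + u (- z, w) + u (z, - w) + u (- z, - w)) / 4 - poly2 N c (z\<^sup>2) (w\<^sup>2)) < \<epsilon> / 2"
      using polyclo_average_approx[of u X "\<epsilon> / 2"] \<epsilon> by auto
    show "\<exists>N c. \<forall>z\<in>cball 0 r. norm (f z - poly2 N c (z ^ 2) ((phi z) ^ 2)) < \<epsilon>"
    proof (intro exI ballI)
      fix z :: complex assume z: "z \<in> cball 0 r"
      have mem: "(- z, phi z) \<in> Y3" "(z, - phi z) \<in> Y4" "(- z, - phi z) \<in> Y2" "(z, phi z) \<in> graph"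
        using z by (auto simp: Y2_def Y3_def Y4_def D_def graph_def)
      then have "psi (- z, phi z) = 0" "psi (z, - phi z) = 0" "psi (- z, - phi z) = 0"
        using psi0 by auto
      then have "(u (z, phi z) + u (- z, phi z) + u (z, - phi z) + u (- z, - phi z)) / 4 = f 0 + m z * e z"
        by (simp add: u_def m_def)
      moreover have "norm ((u (z, phi z) + u (- z, phi z) + u (z, - phi z) + u (- z, - phi z)) / 4 - poly2 N c (z\<^sup>2) ((phi z)\<^sup>2)) < \<epsilon> / 2"
        using mem by (intro c) (auto simp: X_def Y_def)
      ultimately have "norm (f 0 + m z * e z - poly2 N c (z\<^sup>2) ((phi z)\<^sup>2)) < \<epsilon> / 2" by (simp only:)
      with e(2)[OF z] show "norm (f z - poly2 N c (z ^ 2) ((phi z) ^ 2)) < \<epsilon>"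
        using norm_triangle_ineq[of "f z - (f 0 + m z * e z)" "f 0 + m z * e z - poly2 N c (z\<^sup>2) ((phi z)\<^sup>2)"] by simp
    qed
  qed
qed (simp add: poly_closure_def)

theorem theorem2p5:
  fixes F :: "complex \<times> complex \<Rightarrow> complex"
    and g h :: "complex \<Rightarrow> complex"
  assumes F_holo: "\<exists>r>0. holomorphic2_on F (ball 0 r) \<and> (\<forall>w\<in>ball 0 r. F (- w) = - F w)"
    and F_cubic: "\<exists>C r. r > 0 \<and> (\<forall>w\<in>ball 0 r. norm (F w) \<le> C * norm w ^ 3)"
    and g_C1: "C1_near0 g"
    and g_even: "\<forall>\<^sub>F z in nhds 0. g (- z) = g z"
    and g_small: "g \<in> o[at 0](\<lambda>z. z)"
    and g_poly: "\<exists>N c. polynomial_condition g (poly2 N c)"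
    and h_C1: "C1_near0 h"
    and h_small: "h \<in> o[at 0](g)"
  shows "\<exists>r0>0. \<forall>r. 0 < r \<and> r < r0 \<longrightarrow>
           poly_closure (\<lambda>z. z ^ 2) (\<lambda>z. (cnj z + F (z, cnj z) + g z + h z) ^ 2) (cball 0 r)
             = {\<phi>. continuous_on (cball 0 r) \<phi>}"
proof -
  obtain R1 where R1: "R1 > 0" "holomorphic2_on F (ball 0 R1)" "\<forall>w\<in>ball 0 R1. F (- w) = - F w"
    using F_holo by blast
  obtain C R2 where R2: "R2 > 0" "\<forall>w\<in>ball 0 R2. norm (F w) \<le> C * norm w ^ 3"
    using F_cubic by blast
  define R where "R = min R1 R2"
  have R: "R > 0" using R1 R2 by (simp add: R_def)
  have F: "holomorphic2_on F (ball 0 R)"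
    using R1(2) unfolding holomorphic2_on_def R_def by auto
  have odd: "F (- w) = - F w" if "w \<in> ball 0 R" for w
    using R1(3) that by (auto simp: R_def)
  have cubic: "norm (F w) \<le> C * norm w ^ 3" if "w \<in> ball 0 R" for w
    using R2(2) that by (auto simp: R_def)
  have F0: "F (0, 0) = 0" using cubic[of 0] R by (simp add: zero_prod_def)
  have h_small': "h \<in> o[at 0](\<lambda>z. z)"
    using landau_o.small_trans[OF h_small g_small] .
  have g0: "g 0 = 0" by (rule C1_near0_small_o_at_0[OF g_C1 g_small])
  have h0: "h 0 = 0" by (rule C1_near0_small_o_at_0[OF h_C1 h_small'])
  have g_even': "\<forall>\<^sub>F z in at 0. g (- z) = g z"
    using g_even by (simp add: eventually_nhds_conv_at)
  have lipF: "\<exists>\<delta>>0. \<forall>x\<in>ball 0 \<delta>. \<forall>y\<in>ball 0 \<delta>. norm (F x - F y) \<le> \<kappa> * norm (x - y)" if "\<kappa> > 0" for \<kappa>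
    by (rule holomorphic2_small_lipschitz[OF F R cubic that]) blast+
  define phi where "phi z = cnj z + F (z, cnj z) + g z + h z" for z
  have phi0: "phi 0 = 0" by (simp add: phi_def F0 g0 h0)
  have "C1_near0 (\<lambda>z. F (z, cnj z))"
    by (rule C1_near0_holomorphic2[OF F C1_near0_cnj]) (use R in \<open>simp add: zero_prod_def[symmetric]\<close>)
  then have phi_C1: "C1_near0 phi"
    unfolding phi_def by (intro C1_near0_add C1_near0_cnj g_C1 h_C1)

  obtain \<rho> G where \<rho>: "\<rho> > 0" and G0: "G (0, 0) = 0"
    and Gpoly: "\<forall>X. compact X \<and> X \<subseteq> cball 0 \<rho> \<times> cball 0 \<rho> \<longrightarrow> G \<in> polyclo X"
    and Geq: "\<forall>x \<in> cball 0 \<rho> \<times> cball 0 \<rho>. G x + F (fst x, G x) = snd x"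
    and Ghol: "holomorphic2_on G (ball 0 \<rho> \<times> ball 0 \<rho>)"
    by (rule straightening[OF F R cubic])
  obtain N c where p: "polynomial_condition g (poly2 N c)" using g_poly by blast

  text \<open>For \<open>\<sigma> = 1\<close> and \<open>\<psi> = phi\<close>, and for \<open>\<sigma> = - 1\<close> and \<open>\<psi>(z) = - phi(- z)\<close>, the function
    \<open>G(z, \<psi>(z))\<close> has the form required by the polynomial condition.\<close>

  have straight: "C1_near0 (\<lambda>z. G (z, \<psi> z)) \<and> ((\<lambda>z. G (z, \<psi> z)) \<longlongrightarrow> 0) (at 0) \<and>
      (\<lambda>z. G (z, \<psi> z) - cnj z - \<sigma> * g z) \<in> o[at 0](g)"
    if \<psi>: "C1_near0 \<psi>" "\<psi> 0 = 0" and \<sigma>: "norm \<sigma> = 1" and k: "k \<in> o[at 0](g)"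
      and eq: "\<forall>\<^sub>F z in at 0. \<psi> z = cnj z + F (z, cnj z) + \<sigma> * g z + k z" for \<psi> \<sigma> k
  proof (intro conjI)
    show C1: "C1_near0 (\<lambda>z. G (z, \<psi> z))"
      by (rule C1_near0_holomorphic2[OF Ghol \<psi>(1)]) (use \<psi>(2) \<rho> in auto)
    show lim: "((\<lambda>z. G (z, \<psi> z)) \<longlongrightarrow> 0) (at 0)"
      using C1_near0_isCont[OF C1] \<psi>(2) G0 by (simp add: isCont_def)
    have "((\<lambda>z. (z, \<psi> z)) \<longlongrightarrow> (0, 0)) (at 0)"
      using C1_near0_isCont[OF \<psi>(1)] \<psi>(2) by (intro tendsto_intros) (simp add: isCont_def)
    then have "\<forall>\<^sub>F z in at 0. (z, \<psi> z) \<in> ball 0 \<rho> \<times> ball 0 \<rho>"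
      by (rule topological_tendstoD) (use \<rho> in \<open>auto intro: open_Times\<close>)
    with eq have eqG: "\<forall>\<^sub>F z in at 0. G (z, \<psi> z) + F (z, G (z, \<psi> z)) = cnj z + F (z, cnj z) + \<sigma> * g z + k z"
    proof eventually_elim
      case (elim z)
      then have "(z, \<psi> z) \<in> cball 0 \<rho> \<times> cball 0 \<rho>" by auto
      from bspec[OF Geq this] elim(1) show ?case by simp
    qed
    show "(\<lambda>z. G (z, \<psi> z) - cnj z - \<sigma> * g z) \<in> o[at 0](g)"
      by (rule straightened_remainder_small_o[OF _ lim k \<sigma> eqG]) (rule lipF)
  qed
  define phi' where "phi' z = - phi (- z)" for z
  define H1 H2 where "H1 z = G (z, phi z)" and "H2 z = G (z, phi' z)" for z
  have S1: "C1_near0 H1" "(H1 \<longlongrightarrow> 0) (at 0)" "(\<lambda>z. H1 z - cnj z - 1 * g z) \<in> o[at 0](g)"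
    using straight[OF phi_C1 phi0, of 1 h] h_small by (auto simp: H1_def[abs_def] phi_def)
  \<comment> \<open>Oddness of \<open>F\<close> and evenness of \<open>g\<close> enter here.\<close>
  have eq2: "\<forall>\<^sub>F z in at 0. phi' z = cnj z + F (z, cnj z) + (- 1) * g z + - h (- z)"
  proof -
    have "((\<lambda>z. (z, cnj z)) \<longlongrightarrow> (0, cnj 0)) (at 0)" by (intro tendsto_intros)
    then have "\<forall>\<^sub>F z in at 0. (z, cnj z) \<in> ball 0 R"
      using R by (intro topological_tendstoD) (auto simp: zero_prod_def)
    with g_even' show ?thesis
    proof eventually_elim
      case (elim z)
      then show ?case using odd[OF elim(2)] by (simp add: phi'_def phi_def)
    qed
  qed
  have S2: "C1_near0 H2" "(H2 \<longlongrightarrow> 0) (at 0)" "(\<lambda>z. H2 z - cnj z - (- 1) * g z) \<in> o[at 0](g)"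
    using straight[of phi' "-1" "\<lambda>z. - h (- z)", OF _ _ _ small_o_reflect[OF h_small g_even'] eq2]
      C1_near0_minus[OF C1_near0_reflect[OF phi_C1]] phi0
    by (auto simp: H2_def[abs_def] phi'_def[abs_def])
  let ?p = "poly2 N c"
  have up: "\<forall>\<^sub>F z in at 0. Im (?p z (H1 z)) > 0"
  proof -
    have "C1_near0 (\<lambda>z. H1 z - cnj z - 1 * g z)"
      using C1_near0_diff[OF C1_near0_diff[OF S1(1) C1_near0_cnj] g_C1] by simp
    then have "\<forall>\<^sub>F z in at 0. Im (?p z (cnj z + g z + (H1 z - cnj z - 1 * g z))) > 0"
      using p S1(3) unfolding polynomial_condition_def by (blast intro: eventually_mono)
    then show ?thesis by simp
  qed
  have low: "\<forall>\<^sub>F z in at 0. Im (?p z (H2 z)) < 0"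
  proof -
    have "C1_near0 (\<lambda>z. H2 z - cnj z - (- 1) * g z)"
      using C1_near0_add[OF C1_near0_diff[OF S2(1) C1_near0_cnj] g_C1] by simp
    then have "\<forall>\<^sub>F z in at 0. Im (?p z (cnj z - g z + (H2 z - cnj z - (- 1) * g z))) < 0"
      using p S2(3) unfolding polynomial_condition_def by (blast intro: eventually_mono)
    then show ?thesis by simp
  qed
  have plim: "((\<lambda>z. Im (?p z (H z))) \<longlongrightarrow> Im (?p 0 0)) (at 0)" if "(H \<longlongrightarrow> 0) (at 0)" for H
    unfolding poly2_def by (intro tendsto_intros that)
  \<comment> \<open>A limit of positive and of negative numbers, so \<open>Im p(0, 0) = 0\<close>.
    Subtracting \<open>p(0, 0)\<close> below then makes the separating function vanish at the origin
    without changing the signs.\<close>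
  have "Im (?p 0 0) \<ge> 0"
    by (rule tendsto_lowerbound[OF plim[OF S1(2)]]) (use up in \<open>auto elim: eventually_mono\<close>)
  moreover have "Im (?p 0 0) \<le> 0"
    by (rule tendsto_upperbound[OF plim[OF S2(2)]]) (use low in \<open>auto elim: eventually_mono\<close>)
  ultimately have p00: "Im (?p 0 0) = 0" by simp
  obtain s1 where s1: "s1 > 0" "\<And>z. z \<noteq> 0 \<Longrightarrow> norm z < s1 \<Longrightarrow> Im (?p z (H1 z)) > 0"
    using up unfolding eventually_at by auto
  obtain s2 where s2: "s2 > 0" "\<And>z. z \<noteq> 0 \<Longrightarrow> norm z < s2 \<Longrightarrow> Im (?p z (H2 z)) < 0"
    using low unfolding eventually_at by auto

  \<comment> \<open>The Lipschitz budget 1/2 is split as 1/4 + 1/8 + 1/8. \<open>F\<close> starts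
    from 1/8 because its argument \<open>(z, cnj z)\<close> varies up to twice as fast as
    \<open>z\<close>.\<close>
  obtain dF where dF: "dF > 0" "\<forall>x\<in>ball 0 dF. \<forall>y\<in>ball 0 dF. norm (F x - F y) \<le> 1/8 * norm (x - y)"
    using lipF[of "1/8"] by auto
  obtain dg where dg: "dg > 0" "\<And>z w. z \<in> ball 0 dg \<Longrightarrow> w \<in> ball 0 dg \<Longrightarrow> norm (g z - g w) \<le> 1/8 * norm (z - w)"
    using C1_near0_small_lipschitz[OF g_C1 g_small, of "1/8"] by auto
  obtain dh where dh: "dh > 0" "\<And>z w. z \<in> ball 0 dh \<Longrightarrow> w \<in> ball 0 dh \<Longrightarrow> norm (h z - h w) \<le> 1/8 * norm (z - w)"
    using C1_near0_small_lipschitz[OF h_C1 h_small', of "1/8"] by auto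
  define d where "d = min (dF / 2) (min dg dh)"
  have d: "d > 0" using dF dg dh by (simp add: d_def)
  have lip_phi: "norm ((phi z - cnj z) - (phi w - cnj w)) \<le> norm (z - w) / 2" if "norm z < d" "norm w < d" for z w
  proof -
    have inF: "(u, cnj u) \<in> ball 0 dF" if "norm u < d" for u
      using norm_Pair_le[of u "cnj u"] that by (simp del: norm_Pair_le add: d_def)
    have "norm (F (z, cnj z) - F (w, cnj w)) \<le> 1/8 * norm ((z, cnj z) - (w, cnj w))"
      using dF(2) inF[OF that(1)] inF[OF that(2)] by blast
    also have "norm ((z, cnj z) - (w, cnj w)) \<le> norm (z - w) + norm (z - w)"
      using norm_Pair_le[of "z - w" "cnj (z - w)"] by (simp del: complex_cnj_diff) simp
    finally have "norm (F (z, cnj z) - F (w, cnj w)) \<le> 1/4 * norm (z - w)" by simp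
    moreover have "norm (g z - g w) \<le> 1/8 * norm (z - w)" "norm (h z - h w) \<le> 1/8 * norm (z - w)"
      by (rule dg dh; use that in \<open>simp add: d_def\<close>)+
    moreover have "(phi z - cnj z) - (phi w - cnj w) = (F (z, cnj z) - F (w, cnj w)) + (g z - g w) + (h z - h w)"
      by (simp add: phi_def)
    then have "norm ((phi z - cnj z) - (phi w - cnj w)) \<le> norm (F (z, cnj z) - F (w, cnj w)) + norm (g z - g w) + norm (h z - h w)"
      by (metis add_right_mono norm_triangle_ineq order_trans)
    ultimately show ?thesis by linarith
  qed
  \<comment> \<open>The square of half-side \<open>L = 2 r\<close> lies in the disc of radius
    \<open>4 r < d\<close>. The bound \<open>\<rho> / 2\<close> suits
    \<open>|phi z| \<le> 3/2 |z|\<close>, and \<open>s1\<close>, \<open>s2\<close> secure the two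
    signs.\<close>
  define r0 where "r0 = Min {d / 4, \<rho> / 2, s1, s2}"
  have radius: "r0 > 0" "r0 \<le> d / 4" "r0 \<le> \<rho> / 2" "r0 \<le> s1" "r0 \<le> s2"
    using d \<rho> s1(1) s2(1) by (auto simp: r0_def)
  have "poly_closure (\<lambda>z. z ^ 2) (\<lambda>z. (phi z) ^ 2) (cball 0 r) = {f. continuous_on (cball 0 r) f}"
    if r: "0 < r" "r < r0" for r
  proof -
    interpret near_conjugation phi "2 * r" r
    proof
      fix z w :: complex
      assume zw: "\<bar>Re z\<bar> \<le> 2 * r" "\<bar>Im z\<bar> \<le> 2 * r" "\<bar>Re w\<bar> \<le> 2 * r" "\<bar>Im w\<bar> \<le> 2 * r"
      have "norm z < d" "norm w < d"
        using cmod_le[of z] cmod_le[of w] zw r radius(2) by linarith+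
      then show "norm ((phi z - cnj z) - (phi w - cnj w)) \<le> norm (z - w) / 2" by (rule lip_phi)
    qed (use r in auto)
    have small: "norm z \<le> \<rho>" "norm (phi z) \<le> \<rho>" if "z \<in> cball 0 r" for z
    proof -
      have "norm (phi z - cnj z) \<le> norm z / 2"
        using lip_phi[of z 0] that r radius(2) d phi0 by simp
      then have "norm (phi z) \<le> norm z / 2 + norm z"
        using norm_triangle_sub[of "phi z" "cnj z"] by simp
      then show "norm z \<le> \<rho>" "norm (phi z) \<le> \<rho>"
        using that r radius(3) by auto
    qed
    let ?Y = "graph \<union> (\<lambda>z. (- z, - phi z)) ` cball 0 r"
    have cY: "compact ?Y"
      by (intro compact_Un compact_graph compact_continuous_image continuous_intros continuous_on_subset[OF continuous_phi])
         (use cball_coords in auto)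
    have "?Y \<subseteq> cball 0 \<rho> \<times> cball 0 \<rho>" using small by (auto simp: graph_def)
    with Gpoly cY have "G \<in> polyclo ?Y" by blast
    then have "(\<lambda>x. ?p (fst x) (G x) - ?p 0 0) \<in> polyclo ?Y"
      by (intro polyclo_diff polyclo_const polyclo_poly2 polyclo_fst compact_imp_bounded cY)
    then show ?thesis
    proof (rule poly_closure_squares[OF phi0])
      fix z :: complex assume z: "z \<in> cball 0 r" "z \<noteq> 0"
      show "0 < Im (?p (fst (z, phi z)) (G (z, phi z)) - ?p 0 0)"
        using s1(2)[of z] z r radius(4) p00 by (simp add: H1_def)
      show "Im (?p (fst (- z, - phi z)) (G (- z, - phi z)) - ?p 0 0) < 0"
        using s2(2)[of "- z"] z r radius(5) p00 by (simp add: H2_def phi'_def)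
    qed (simp add: G0)
  qed
  then show ?thesis using radius(1) unfolding phi_def by blast
qed

end
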